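(* \textsc{MSO$_1$ Reconfiguration} (MSOR$_1$) parameterized by $\mathrm{nd}(G) + |\phi|$ is fixed-parameter tractable, where $G$ is the input graph and $\phi$ the input formula. Furthermore, for a yes-instance of MSOR$_1$, finding a shortest $\mathsf{TJ}(\phi)$-sequence from $S$ to $S'$ is fixed-parameter tractable with the same parameter.
   Context: A colored graph is a tuple $G=(V,E,\mathcal{C})$ where $V$ is a finite vertex set, $E$ is a set of unordered pairs of vertices, and $\mathcal{C}=\langle C_1,\dots,C_c\rangle$ is a tuple of subsets of $V$ (colors). MSO$_1$ formulas over colored graphs use vertex variables and vertex-set variables, atomic formulas $x=y$, $E(x,y)$ (adjacency), $C_i(x)$ (membership of $x$ in color $C_i$) and $X(x)$ ($x\in X$), and are closed under Boolean connectives and quantification over vertices and vertex sets; $|\phi|$ is the length of $\phi$. For an MSO$_1$ formula $\phi(X)$ with one free vertex-set variable, a $\mathsf{TJ}(\phi)$-sequence from $S_0$ to $S_\ell$ (of length $\ell$) is a sequence $S_0,\dots,S_\ell$ of vertex subsets of $G$ with $|S_{i-1}\setminus S_i|=|S_i\setminus S_{i-1}|=1$ for all $i\in[\ell]$ and $G\models\phi(S_i)$ for all $0\le i\le \ell$. MSOR$_1$: given an MSO$_1$ formula $\phi(X)$ with one free set variable, a colored graph $G=(V,E,\mathcal{C})$, and sets $S,S'\subseteq V$ with $|S|=|S'|$, $G\models\phi(S)$, $G\models\phi(S')$, decide whether there is a $\mathsf{TJ}(\phi)$-sequence from $S$ to $S'$. Two vertices $u,v$ are twins if $N(u)=N(v)$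 or $N[u]=N[v]$; the neighborhood diversity $\mathrm{nd}(G)$ is the number of classes in the partition of $V$ into maximal sets of pairwise twin vertices. Fixed-parameter tractable with parameter $p$ means solvable in time $f(p)\cdot n^{O(1)}$ for a computable $f$, $n$ the input size. *)

theory Defs
  imports Main
begin

section \<open>Model of computation\<close>

text \<open>
  Programs are first-order, call-by-value recursive functions over binary trees (compare the language F
  over S-expressions in N. D. Jones, \<^emph>\<open>Computability and Complexity from a Programming Perspective\<close>).
  A program is a list of function bodies, function 0 is the entry point, variables are de Bruijn
  indices into the list of arguments and let-bound values. Every evaluated expression node costs one
  step. Since the only operations on data are allocating a cell, following a pointer and testing
  for the empty tree, step counts are polynomially related to Turing machine time.
\<close>

datatype tree = Leaf | Node tree tree

primrec tree_size :: "tree \<Rightarrow> nat" where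
  "tree_size Leaf = 1"
| "tree_size (Node a b) = Suc (tree_size a + tree_size b)"

primrec tree_left :: "tree \<Rightarrow> tree" where
  "tree_left Leaf = Leaf"
| "tree_left (Node a b) = a"

primrec tree_right :: "tree \<Rightarrow> tree" where
  "tree_right Leaf = Leaf"
| "tree_right (Node a b) = b"

datatype expr =
    EVar nat
  | ELeaf
  | ENode expr expr
  | ELeft expr
  | ERight expr
  | EIf expr expr expr
  | ELet expr expr
  | ECall nat "expr list"

type_synonym program = "expr list"

inductive eval :: "program \<Rightarrow> tree list \<Rightarrow> expr \<Rightarrow> tree \<Rightarrow> nat \<Rightarrow> bool"
  and evals :: "program \<Rightarrow> tree list \<Rightarrow> expr list \<Rightarrow> tree list \<Rightarrow> nat \<Rightarrow> bool"
  for P :: program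
where
  eval_Var: "i < length env \<Longrightarrow> eval P env (EVar i) (env ! i) 1"
| eval_Leaf: "eval P env ELeaf Leaf 1"
| eval_Node: "eval P env a u s \<Longrightarrow> eval P env b v t \<Longrightarrow>
    eval P env (ENode a b) (Node u v) (Suc (s + t))"
| eval_Left: "eval P env a u s \<Longrightarrow> eval P env (ELeft a) (tree_left u) (Suc s)"
| eval_Right: "eval P env a u s \<Longrightarrow> eval P env (ERight a) (tree_right u) (Suc s)"
| eval_If_true: "eval P env a u s \<Longrightarrow> u \<noteq> Leaf \<Longrightarrow> eval P env b v t \<Longrightarrow>
    eval P env (EIf a b c) v (Suc (s + t))"
| eval_If_false: "eval P env a Leaf s \<Longrightarrow> eval P env c v t \<Longrightarrow>
    eval P env (EIf a b c) v (Suc (s + t))"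
| eval_Let: "eval P env a u s \<Longrightarrow> eval P (u # env) b v t \<Longrightarrow>
    eval P env (ELet a b) v (Suc (s + t))"
| eval_Call: "i < length P \<Longrightarrow> evals P env as us s \<Longrightarrow> eval P us (P ! i) v t \<Longrightarrow>
    eval P env (ECall i as) v (Suc (s + t))"
| evals_Nil: "evals P env [] [] 0"
| evals_Cons: "eval P env a u s \<Longrightarrow> evals P env as us t \<Longrightarrow>
    evals P env (a # as) (u # us) (s + t)"

inductive_cases eval_VarE: "eval P env (EVar i) v t"
inductive_cases eval_LeafE: "eval P env ELeaf v t"
inductive_cases eval_NodeE: "eval P env (ENode a b) v t"
inductive_cases eval_LeftE: "eval P env (ELeft a) v t"
inductive_cases eval_RightE: "eval P env (ERight a) v t"
inductive_cases eval_IfE: "eval P env (EIf a b c) v t"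
inductive_cases eval_LetE: "eval P env (ELet a b) v t"
inductive_cases eval_CallE: "eval P env (ECall i as) v t"
inductive_cases evals_NilE: "evals P env [] vs t"
inductive_cases evals_ConsE: "evals P env (a # as) vs t"

lemma eval_deterministic:
  "eval P env a u s \<Longrightarrow> (\<forall>v t. eval P env a v t \<longrightarrow> u = v \<and> s = t)"
  "evals P env as us s \<Longrightarrow> (\<forall>vs t. evals P env as vs t \<longrightarrow> us = vs \<and> s = t)"
proof (induction rule: eval_evals.inducts)
  case eval_Var then show ?case by (auto elim: eval_VarE)
next
  case eval_Leaf then show ?case by (auto elim: eval_LeafE)
next
  case eval_Node then show ?case by (blast elim: eval_NodeE)
next
  case eval_Left then show ?case by (blast elim: eval_LeftE)
next
  case eval_Right then show ?case by (blast elim: eval_RightE)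
next
  case eval_If_true then show ?case by (blast elim: eval_IfE)
next
  case eval_If_false then show ?case by (blast elim: eval_IfE)
next
  case eval_Let then show ?case by (blast elim: eval_LetE)
next
  case eval_Call then show ?case by (blast elim: eval_CallE)
next
  case evals_Nil then show ?case by (auto elim: evals_NilE)
next
  case evals_Cons then show ?case by (blast elim: evals_ConsE)
qed

text \<open>
  The size of the result is charged as well: it is the time to write the output down, which can
  exceed the number of evaluation steps because subtrees may be shared.
\<close>

definition runs_in_time :: "program \<Rightarrow> tree \<Rightarrow> tree \<Rightarrow> nat \<Rightarrow> bool" where
  "runs_in_time P x y T \<longleftrightarrow> (\<exists>t. eval P [x] (ECall 0 [EVar 0]) y t \<and> t + tree_size y \<le> T)"

fun enc_nat :: "nat \<Rightarrow> tree" where \<comment> \<open>binary, least significant bit first\<close>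
  "enc_nat n = (if n = 0 then Leaf
     else Node (if odd n then Node Leaf Leaf else Leaf) (enc_nat (n div 2)))"

declare enc_nat.simps [simp del]

primrec enc_list :: "('a \<Rightarrow> tree) \<Rightarrow> 'a list \<Rightarrow> tree" where
  "enc_list enc [] = Leaf"
| "enc_list enc (x # xs) = Node (enc x) (enc_list enc xs)"

definition computable :: "(nat \<Rightarrow> nat) \<Rightarrow> bool" where
  "computable f \<longleftrightarrow> (\<exists>P. \<forall>k. \<exists>T. runs_in_time P (enc_nat k) (enc_nat (f k)) T)"


section \<open>Fixed-parameter tractability\<close>

text \<open>
  Problems are given by a set of admissible instances, an encoding of instances, a parameter, and
  for each instance the set of correct outputs (search) or the answer (decision).
\<close>

definition fpt_search ::
  "'i set \<Rightarrow> ('i \<Rightarrow> tree) \<Rightarrow> ('i \<Rightarrow> nat) \<Rightarrow> ('i \<Rightarrow> tree \<Rightarrow> bool) \<Rightarrow> bool" where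
  "fpt_search Insts enc param correct \<longleftrightarrow>
     (\<exists>P f c. computable f \<and>
        (\<forall>I\<in>Insts. \<exists>y. correct I y \<and>
           runs_in_time P (enc I) y (f (param I) * tree_size (enc I) ^ c)))"

definition fpt_decision ::
  "'i set \<Rightarrow> ('i \<Rightarrow> tree) \<Rightarrow> ('i \<Rightarrow> nat) \<Rightarrow> ('i \<Rightarrow> bool) \<Rightarrow> bool" where
  "fpt_decision Insts enc param yes \<longleftrightarrow>
     fpt_search Insts enc param (\<lambda>I y. y = (if yes I then Node Leaf Leaf else Leaf))"


section \<open>Colored graphs and neighborhood diversity\<close>

record 'v cgraph =
  verts :: "'v set"
  edges :: "'v set set"
  colors :: "'v set list"

definition colored_graph :: "'v cgraph \<Rightarrow> bool" where
  "colored_graph G \<longleftrightarrow>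
     finite (verts G) \<and>
     (\<forall>e\<in>edges G. \<exists>u\<in>verts G. \<exists>v\<in>verts G. u \<noteq> v \<and> e = {u, v}) \<and>
     (\<forall>C\<in>set (colors G). C \<subseteq> verts G)"

definition nbhd :: "'v cgraph \<Rightarrow> 'v \<Rightarrow> 'v set" where
  "nbhd G u = {v \<in> verts G. {u, v} \<in> edges G}"

definition closed_nbhd :: "'v cgraph \<Rightarrow> 'v \<Rightarrow> 'v set" where
  "closed_nbhd G u = insert u (nbhd G u)"

definition twins :: "'v cgraph \<Rightarrow> 'v \<Rightarrow> 'v \<Rightarrow> bool" where
  "twins G u v \<longleftrightarrow> nbhd G u = nbhd G v \<or> closed_nbhd G u = closed_nbhd G v"

definition twin_set :: "'v cgraph \<Rightarrow> 'v set \<Rightarrow> bool" where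
  "twin_set G T \<longleftrightarrow> T \<noteq> {} \<and> T \<subseteq> verts G \<and> (\<forall>u\<in>T. \<forall>v\<in>T. twins G u v)"

definition twin_classes :: "'v cgraph \<Rightarrow> 'v set set" where
  "twin_classes G = {T. twin_set G T \<and> (\<forall>T'. twin_set G T' \<and> T \<subseteq> T' \<longrightarrow> T' = T)}"

definition nd :: "'v cgraph \<Rightarrow> nat" where
  "nd G = card (twin_classes G)"


section \<open>MSO1 over colored graphs\<close>

text \<open>Vertex variables and set variables are two separate name spaces, both indexed by naturals.\<close>

datatype mso1 =
    VEq nat nat
  | Adj nat nat
  | Color nat nat  \<comment> \<open>color index (counted from 0), vertex variable\<close>
  | Mem nat nat    \<comment> \<open>set variable, vertex variable\<close>
  | Neg mso1
  | Conj mso1 mso1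
  | Disj mso1 mso1
  | Imp mso1 mso1
  | Iff mso1 mso1
  | ExV nat mso1
  | AllV nat mso1
  | ExS nat mso1
  | AllS nat mso1

primrec sat :: "'v cgraph \<Rightarrow> mso1 \<Rightarrow> (nat \<Rightarrow> 'v) \<Rightarrow> (nat \<Rightarrow> 'v set) \<Rightarrow> bool" where
  "sat G (VEq x y) \<alpha> \<beta> \<longleftrightarrow> \<alpha> x = \<alpha> y"
| "sat G (Adj x y) \<alpha> \<beta> \<longleftrightarrow> {\<alpha> x, \<alpha> y} \<in> edges G"
| "sat G (Color i x) \<alpha> \<beta> \<longleftrightarrow> i < length (colors G) \<and> \<alpha> x \<in> colors G ! i"
| "sat G (Mem X x) \<alpha> \<beta> \<longleftrightarrow> \<alpha> x \<in> \<beta> X"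
| "sat G (Neg p) \<alpha> \<beta> \<longleftrightarrow> \<not> sat G p \<alpha> \<beta>"
| "sat G (Conj p q) \<alpha> \<beta> \<longleftrightarrow> sat G p \<alpha> \<beta> \<and> sat G q \<alpha> \<beta>"
| "sat G (Disj p q) \<alpha> \<beta> \<longleftrightarrow> sat G p \<alpha> \<beta> \<or> sat G q \<alpha> \<beta>"
| "sat G (Imp p q) \<alpha> \<beta> \<longleftrightarrow> (sat G p \<alpha> \<beta> \<longrightarrow> sat G q \<alpha> \<beta>)"
| "sat G (Iff p q) \<alpha> \<beta> \<longleftrightarrow> (sat G p \<alpha> \<beta> \<longleftrightarrow> sat G q \<alpha> \<beta>)"
| "sat G (ExV x p) \<alpha> \<beta> \<longleftrightarrow> (\<exists>v\<in>verts G. sat G p (\<alpha>(x := v)) \<beta>)"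
| "sat G (AllV x p) \<alpha> \<beta> \<longleftrightarrow> (\<forall>v\<in>verts G. sat G p (\<alpha>(x := v)) \<beta>)"
| "sat G (ExS X p) \<alpha> \<beta> \<longleftrightarrow> (\<exists>A\<subseteq>verts G. sat G p \<alpha> (\<beta>(X := A)))"
| "sat G (AllS X p) \<alpha> \<beta> \<longleftrightarrow> (\<forall>A\<subseteq>verts G. sat G p \<alpha> (\<beta>(X := A)))"

primrec free_vvars :: "mso1 \<Rightarrow> nat set" where
  "free_vvars (VEq x y) = {x, y}"
| "free_vvars (Adj x y) = {x, y}"
| "free_vvars (Color i x) = {x}"
| "free_vvars (Mem X x) = {x}"
| "free_vvars (Neg p) = free_vvars p"
| "free_vvars (Conj p q) = free_vvars p \<union> free_vvars q"
| "free_vvars (Disj p q) = free_vvars p \<union> free_vvars q"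
| "free_vvars (Imp p q) = free_vvars p \<union> free_vvars q"
| "free_vvars (Iff p q) = free_vvars p \<union> free_vvars q"
| "free_vvars (ExV x p) = free_vvars p - {x}"
| "free_vvars (AllV x p) = free_vvars p - {x}"
| "free_vvars (ExS X p) = free_vvars p"
| "free_vvars (AllS X p) = free_vvars p"

primrec free_svars :: "mso1 \<Rightarrow> nat set" where
  "free_svars (VEq x y) = {}"
| "free_svars (Adj x y) = {}"
| "free_svars (Color i x) = {}"
| "free_svars (Mem X x) = {X}"
| "free_svars (Neg p) = free_svars p"
| "free_svars (Conj p q) = free_svars p \<union> free_svars q"
| "free_svars (Disj p q) = free_svars p \<union> free_svars q"
| "free_svars (Imp p q) = free_svars p \<union> free_svars q"
| "free_svars (Iff p q) = free_svars p \<union> free_svars q"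
| "free_svars (ExV x p) = free_svars p"
| "free_svars (AllV x p) = free_svars p"
| "free_svars (ExS X p) = free_svars p - {X}"
| "free_svars (AllS X p) = free_svars p - {X}"

primrec color_indices :: "mso1 \<Rightarrow> nat set" where
  "color_indices (VEq x y) = {}"
| "color_indices (Adj x y) = {}"
| "color_indices (Color i x) = {i}"
| "color_indices (Mem X x) = {}"
| "color_indices (Neg p) = color_indices p"
| "color_indices (Conj p q) = color_indices p \<union> color_indices q"
| "color_indices (Disj p q) = color_indices p \<union> color_indices q"
| "color_indices (Imp p q) = color_indices p \<union> color_indices q"
| "color_indices (Iff p q) = color_indices p \<union> color_indices q"
| "color_indices (ExV x p) = color_indices p"
| "color_indices (AllV x p) = color_indices p"
| "color_indices (ExS X p) = color_indices p"
| "color_indices (AllS X p) = color_indices p"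

text \<open>Length is the number of symbols; an occurrence of a variable or of a color is one symbol.\<close>

primrec mso1_length :: "mso1 \<Rightarrow> nat" where
  "mso1_length (VEq x y) = 3"
| "mso1_length (Adj x y) = 3"
| "mso1_length (Color i x) = 2"
| "mso1_length (Mem X x) = 2"
| "mso1_length (Neg p) = 1 + mso1_length p"
| "mso1_length (Conj p q) = 1 + mso1_length p + mso1_length q"
| "mso1_length (Disj p q) = 1 + mso1_length p + mso1_length q"
| "mso1_length (Imp p q) = 1 + mso1_length p + mso1_length q"
| "mso1_length (Iff p q) = 1 + mso1_length p + mso1_length q"
| "mso1_length (ExV x p) = 2 + mso1_length p"
| "mso1_length (AllV x p) = 2 + mso1_length p"
| "mso1_length (ExS X p) = 2 + mso1_length p"
| "mso1_length (AllS X p) = 2 + mso1_length p"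

text \<open>
  The satisfaction of \<open>\<phi>(S)\<close> when \<open>X\<close> is the only free variable of \<open>\<phi>\<close>: the values
  assigned to all other variables are then irrelevant.
\<close>

definition models_set :: "'v cgraph \<Rightarrow> mso1 \<Rightarrow> nat \<Rightarrow> 'v set \<Rightarrow> bool" where
  "models_set G \<phi> X S \<longleftrightarrow> sat G \<phi> (\<lambda>_. undefined) ((\<lambda>_. {})(X := S))"


section \<open>MSO1 reconfiguration\<close>

definition TJ_sequence ::
  "'v cgraph \<Rightarrow> mso1 \<Rightarrow> nat \<Rightarrow> 'v set \<Rightarrow> 'v set \<Rightarrow> 'v set list \<Rightarrow> bool" where
  "TJ_sequence G \<phi> X S S' Ss \<longleftrightarrow>
     Ss \<noteq> [] \<and> hd Ss = S \<and> last Ss = S' \<and>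
     (\<forall>A\<in>set Ss. A \<subseteq> verts G \<and> models_set G \<phi> X A) \<and>
     (\<forall>i. Suc i < length Ss \<longrightarrow>
        card (Ss ! i - Ss ! Suc i) = 1 \<and> card (Ss ! Suc i - Ss ! i) = 1)"

text \<open>A list of length \<open>\<ell> + 1\<close> is a sequence of length \<open>\<ell>\<close>, so comparing list lengths is enough.\<close>

definition shortest_TJ_sequence ::
  "'v cgraph \<Rightarrow> mso1 \<Rightarrow> nat \<Rightarrow> 'v set \<Rightarrow> 'v set \<Rightarrow> 'v set list \<Rightarrow> bool" where
  "shortest_TJ_sequence G \<phi> X S S' Ss \<longleftrightarrow>
     TJ_sequence G \<phi> X S S' Ss \<and>
     (\<forall>Ts. TJ_sequence G \<phi> X S S' Ts \<longrightarrow> length Ss \<le> length Ts)"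

record msor1 =
  formula :: mso1
  free_var :: nat
  graph :: "nat cgraph"
  source :: "nat set"
  target :: "nat set"

definition msor1_instances :: "msor1 set" where
  "msor1_instances = {I.
     colored_graph (graph I) \<and>
     free_vvars (formula I) = {} \<and> free_svars (formula I) = {free_var I} \<and>
     color_indices (formula I) \<subseteq> {..<length (colors (graph I))} \<and>
     source I \<subseteq> verts (graph I) \<and> target I \<subseteq> verts (graph I) \<and>
     card (source I) = card (target I) \<and>
     models_set (graph I) (formula I) (free_var I) (source I) \<and>
     models_set (graph I) (formula I) (free_var I) (target I)}"

definition msor1_param :: "msor1 \<Rightarrow> nat" where
  "msor1_param I = nd (graph I) + mso1_length (formula I)"

definition msor1_yes :: "msor1 \<Rightarrow> bool" where
  "msor1_yes I \<longleftrightarrow>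
     (\<exists>Ss. TJ_sequence (graph I) (formula I) (free_var I) (source I) (target I) Ss)"


section \<open>Encoding of instances and solutions\<close>

primrec enc_mso1 :: "mso1 \<Rightarrow> tree" where
  "enc_mso1 (VEq x y) = Node (enc_nat 0) (Node (enc_nat x) (enc_nat y))"
| "enc_mso1 (Adj x y) = Node (enc_nat 1) (Node (enc_nat x) (enc_nat y))"
| "enc_mso1 (Color i x) = Node (enc_nat 2) (Node (enc_nat i) (enc_nat x))"
| "enc_mso1 (Mem X x) = Node (enc_nat 3) (Node (enc_nat X) (enc_nat x))"
| "enc_mso1 (Neg p) = Node (enc_nat 4) (enc_mso1 p)"
| "enc_mso1 (Conj p q) = Node (enc_nat 5) (Node (enc_mso1 p) (enc_mso1 q))"
| "enc_mso1 (Disj p q) = Node (enc_nat 6) (Node (enc_mso1 p) (enc_mso1 q))"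
| "enc_mso1 (Imp p q) = Node (enc_nat 7) (Node (enc_mso1 p) (enc_mso1 q))"
| "enc_mso1 (Iff p q) = Node (enc_nat 8) (Node (enc_mso1 p) (enc_mso1 q))"
| "enc_mso1 (ExV x p) = Node (enc_nat 9) (Node (enc_nat x) (enc_mso1 p))"
| "enc_mso1 (AllV x p) = Node (enc_nat 10) (Node (enc_nat x) (enc_mso1 p))"
| "enc_mso1 (ExS X p) = Node (enc_nat 11) (Node (enc_nat X) (enc_mso1 p))"
| "enc_mso1 (AllS X p) = Node (enc_nat 12) (Node (enc_nat X) (enc_mso1 p))"

definition enc_vset :: "nat set \<Rightarrow> tree" where
  "enc_vset A = enc_list enc_nat (sorted_list_of_set A)"

text \<open>Graphs are encoded by adjacency lists, followed by the list of colors.\<close>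

definition enc_cgraph :: "nat cgraph \<Rightarrow> tree" where
  "enc_cgraph G =
     Node (enc_list (\<lambda>u. Node (enc_nat u) (enc_vset (nbhd G u))) (sorted_list_of_set (verts G)))
          (enc_list enc_vset (colors G))"

definition enc_msor1 :: "msor1 \<Rightarrow> tree" where
  "enc_msor1 I =
     Node (enc_mso1 (formula I)) (Node (enc_nat (free_var I)) (Node (enc_cgraph (graph I))
       (Node (enc_vset (source I)) (enc_vset (target I)))))"

definition encodes_shortest_TJ_sequence :: "msor1 \<Rightarrow> tree \<Rightarrow> bool" where
  "encodes_shortest_TJ_sequence I y \<longleftrightarrow>
     (\<exists>Ss. shortest_TJ_sequence (graph I) (formula I) (free_var I) (source I) (target I) Ss \<and>
           y = enc_list enc_vset Ss)"

end

theory Submission imports Defs begin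

text \<open>
  Partition the vertices by twin class, by the colors that occur in \<open>\<phi>\<close>, and by membership in \<open>S\<close> and \<open>S'\<close>.
  By a back-and-forth argument, \<open>\<phi>(A)\<close> depends only on the numbers of vertices of each cell inside and
  outside \<open>A\<close>, truncated at a threshold that is exponential in \<open>|\<phi>|\<close>. So a set becomes a vector of counts,
  and two vectors with the same truncation are joined by monotone moves that never leave their class.
  A shortest sequence can therefore be replaced by a skeleton which enters and leaves each class at
  most once, with cost the sum of the distances of consecutive vectors. Among the optimal skeletons
  there is one whose entries are linear forms in the cell sizes with coefficients bounded in the
  parameter, since any other entries can be shifted along a circulation without increasing the cost.

  The formula together with the colors and adjacencies of the cells is a kernel of size bounded in the
  parameter. From the kernel alone one computes the feasible classes and all candidate skeletons, as
  linear forms; these are evaluated on the actual cell sizes, and the cheapest valid one is expanded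
  to a sequence of sets in polynomial time. Running times are controlled by two families of bounds that
  are closed under composition: the polynomials, and the levels of a fast-growing hierarchy, which are
  computable and closed under bounded iteration.
\<close>


section \<open>A calculus of resource-bounded programs\<close>

text \<open>The cell sizes are not bounded in the parameter, yet the entries of a shortest sequence
  depend on them. Linear forms separate the two: coefficients come from the kernel, sizes are
  substituted later. Splitting cells by \<open>S\<close> and \<open>S'\<close> makes the end vectors
  consist of entries 0 and full cell sizes. These are linear forms themselves, and such a vector
  determines its set. The cost is a sum of absolute values of differences, linear under small shifts
  wherever consecutive rows differ by at least 2. Where they differ by less, both entries must move
  together. Since all rows have the same sum, an entry that is no small form is never the only such
  entry on either side, so these entries contain a cycle. Shifting it by plus and minus one keeps
  the average cost, while a strictly convex second objective rules such a shift out. The factor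
  depending on the parameter need only be computable. The work on the kernel is therefore never
  estimated beyond lying in some level of the hierarchy, whereas in the polynomial part every
  iteration needs a bound on its intermediate results. \<open>fpt_kernel\<close> joins the
  two.\<close>

primrec shift :: "nat \<Rightarrow> expr \<Rightarrow> expr" where
  "shift k (EVar i) = EVar i"
| "shift k ELeaf = ELeaf"
| "shift k (ENode a b) = ENode (shift k a) (shift k b)"
| "shift k (ELeft a) = ELeft (shift k a)"
| "shift k (ERight a) = ERight (shift k a)"
| "shift k (EIf a b c) = EIf (shift k a) (shift k b) (shift k c)"
| "shift k (ELet a b) = ELet (shift k a) (shift k b)"
| "shift k (ECall i as) = ECall (k + i) (map (shift k) as)"

text \<open>Prefixing \<open>X\<close> moves every function of \<open>P\<close> by
  \<open>length X\<close>, and the calls are relocated accordingly. This allows programs to be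
  linked by concatenation.\<close>

lemma eval_shift:
  "eval P env e v t \<Longrightarrow> eval (X @ map (shift (length X)) P @ Y) env (shift (length X) e) v t"
  "evals P env es vs t \<Longrightarrow> evals (X @ map (shift (length X)) P @ Y) env (map (shift (length X)) es) vs t"
  by (induction rule: eval_evals.inducts) (auto intro: eval_evals.intros eval_Var[simplified] eval_Leaf[simplified] simp: nth_append)

text \<open>An upper bound in place of the exact cost: branches of different cost can share one
  bound.\<close>

definition evalb :: "program \<Rightarrow> tree list \<Rightarrow> expr \<Rightarrow> tree \<Rightarrow> nat \<Rightarrow> bool" where
  "evalb P env e v T \<longleftrightarrow> (\<exists>t\<le>T. eval P env e v t)"

definition evalsb :: "program \<Rightarrow> tree list \<Rightarrow> expr list \<Rightarrow> tree list \<Rightarrow> nat \<Rightarrow> bool" where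
  "evalsb P env es vs T \<longleftrightarrow> (\<exists>t\<le>T. evals P env es vs t)"

lemma evalb_mono: "evalb P env e v s \<Longrightarrow> s \<le> t \<Longrightarrow> evalb P env e v t"
  unfolding evalb_def by (meson le_trans)

lemma evalb_Var: "i < length env \<Longrightarrow> evalb P env (EVar i) (env ! i) 1"
  unfolding evalb_def by (blast intro: eval_Var)

lemma evalb_Leaf: "evalb P env ELeaf Leaf 1"
  unfolding evalb_def by (blast intro: eval_Leaf)

lemma evalb_Node: "evalb P env a u s \<Longrightarrow> evalb P env b v t \<Longrightarrow> evalb P env (ENode a b) (Node u v) (Suc (s + t))"
  unfolding evalb_def by (meson eval_Node Suc_le_mono add_le_mono)

lemma evalb_Left: "evalb P env a u s \<Longrightarrow> evalb P env (ELeft a) (tree_left u) (Suc s)"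
  unfolding evalb_def by (meson eval_Left Suc_le_mono)

lemma evalb_Right: "evalb P env a u s \<Longrightarrow> evalb P env (ERight a) (tree_right u) (Suc s)"
  unfolding evalb_def by (meson eval_Right Suc_le_mono)

lemma evalb_If: "evalb P env a u s \<Longrightarrow> (if u \<noteq> Leaf then evalb P env b v t else evalb P env c v t) \<Longrightarrow>
    evalb P env (EIf a b c) v (Suc (s + t))"
  unfolding evalb_def
  by (cases "u = Leaf") (auto, (meson eval_If_true eval_If_false Suc_le_mono add_le_mono)+)

lemma evalb_Call: "i < length P \<Longrightarrow> evalsb P env as us s \<Longrightarrow> evalb P us (P ! i) v t \<Longrightarrow>
    evalb P env (ECall i as) v (Suc (s + t))"
  unfolding evalb_def evalsb_def by (meson eval_Call Suc_le_mono add_le_mono)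

lemma evalsb_Nil: "evalsb P env [] [] 0"
  unfolding evalsb_def by (blast intro: evals_Nil)

lemma evalsb_Cons: "evalb P env a u s \<Longrightarrow> evalsb P env as us t \<Longrightarrow> evalsb P env (a # as) (u # us) (s + t)"
  unfolding evalb_def evalsb_def by (meson evals_Cons add_le_mono)

section \<open>Tree encodings of data types\<close>

class encodable =
  fixes encode :: "'a \<Rightarrow> tree"
  assumes encode_inject: "encode x = encode y \<longleftrightarrow> x = y"

instantiation tree :: encodable
begin
definition encode_tree :: "tree \<Rightarrow> tree" where "encode_tree t = t"
instance by standard (simp add: encode_tree_def)
end

instantiation unit :: encodable
begin
definition encode_unit :: "unit \<Rightarrow> tree" where "encode_unit u = Leaf"
instance by standard simp
end

instantiation bool :: encodable
begin
definition encode_bool :: "bool \<Rightarrow> tree" where "encode_bool b = (if b then Node Leaf Leaf else Leaf)"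
instance by standard (simp add: encode_bool_def)
end

text \<open>Naturals are encoded in unary; binary numerals stay raw trees, compared only for equality.\<close>

instantiation nat :: encodable
begin
primrec encode_nat :: "nat \<Rightarrow> tree" where
  "encode_nat 0 = Leaf"
| "encode_nat (Suc n) = Node Leaf (encode_nat n)"
instance
proof
  fix x y :: nat
  show "encode x = encode y \<longleftrightarrow> x = y"
  proof (induction x arbitrary: y)
    case 0 then show ?case by (cases y) auto
  next
    case (Suc x) then show ?case by (cases y) auto
  qed
qed
end

instantiation prod :: (encodable, encodable) encodable
begin
definition encode_prod :: "'a \<times> 'b \<Rightarrow> tree" where "encode_prod p = Node (encode (fst p)) (encode (snd p))"
instance by standard (simp add: encode_prod_def encode_inject prod_eq_iff)
end

instantiation list :: (encodable) encodable
begin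
definition encode_list :: "'a list \<Rightarrow> tree" where "encode_list xs = enc_list encode xs"
instance
proof
  fix x y :: "'a list"
  show "encode x = encode y \<longleftrightarrow> x = y" unfolding encode_list_def
  proof (induction x arbitrary: y)
    case Nil then show ?case by (cases y) auto
  next
    case (Cons x y) then show ?case by (cases y) (auto simp: encode_inject)
  qed
qed
end

lemma encode_list_simps [simp]: "encode [] = Leaf" "encode (x # xs) = Node (encode x) (encode xs)"
  by (auto simp: encode_list_def)

lemma encode_pair [simp]: "encode (x, y) = Node (encode x) (encode y)"
  by (simp add: encode_prod_def)

abbreviation sz :: "'a::encodable \<Rightarrow> nat" where "sz x \<equiv> tree_size (encode x)"

lemma tree_size_pos [simp]: "0 < tree_size t"
  by (cases t) auto

lemma tree_size_neq [simp]: "tree_size t \<noteq> 0"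
  by (cases t) auto

section \<open>Programs for functions, and how to combine them\<close>

definition prog :: "program \<Rightarrow> ('a::encodable \<Rightarrow> 'b::encodable) \<Rightarrow> ('a \<Rightarrow> nat) \<Rightarrow> bool" where
  "prog P f \<tau> \<longleftrightarrow> P \<noteq> [] \<and> (\<forall>x. evalb P [encode x] (P ! 0) (encode (f x)) (\<tau> x))"

definition runs :: "('a::encodable \<Rightarrow> 'b::encodable) \<Rightarrow> ('a \<Rightarrow> nat) \<Rightarrow> bool" where
  "runs f \<tau> \<longleftrightarrow> (\<exists>P. prog P f \<tau>)"

lemma evalb_link:
  assumes "prog P f \<tau>" "Q = X @ map (shift (length X)) P @ Y" "evalb Q env a (encode x) s" "k = length X"
  shows "evalb Q env (ECall k [a]) (encode (f x)) (Suc (s + \<tau> x))"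
proof -
  have P: "P \<noteq> []" and e: "evalb P [encode x] (P ! 0) (encode (f x)) (\<tau> x)"
    using assms(1) by (auto simp: prog_def)
  have "evalb Q [encode x] (Q ! k) (encode (f x)) (\<tau> x)"
    using e P eval_shift(1)[of P _ "P ! 0" _ _ X Y] unfolding evalb_def assms(2,4)
    by (auto simp: nth_append)
  moreover have "k < length Q" using P by (simp add: assms(2,4))
  moreover have "evalsb Q env [a] [encode x] (s + 0)"
    by (intro evalsb_Cons evalsb_Nil assms)
  ultimately show ?thesis using evalb_Call by fastforce
qed

lemma runs_mono: "runs f \<tau> \<Longrightarrow> (\<And>x. \<tau> x \<le> \<sigma> x) \<Longrightarrow> runs f \<sigma>"
  unfolding runs_def prog_def by (meson evalb_mono)

lemma runs_expr:
  assumes "\<And>x. evalb [e] [encode x] e (encode (f x)) (\<tau> x)"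
  shows "runs f \<tau>"
  unfolding runs_def prog_def by (rule exI[of _ "[e]"]) (use assms in auto)

lemma runs_id: "runs (\<lambda>x. x) (\<lambda>_. 1)"
  by (rule runs_expr[of "EVar 0"]) (use evalb_Var[of 0 "[_]"] in simp)

lemma runs_left: "runs (\<lambda>x. fst x) (\<lambda>_. 2)"
proof (rule runs_expr)
  fix x :: "'a \<times> 'b"
  show "evalb [ELeft (EVar 0)] [encode x] (ELeft (EVar 0)) (encode (fst x)) 2"
    using evalb_Left[OF evalb_Var[of 0 "[encode x]"]] by (cases x) (simp add: numeral_2_eq_2)
qed

lemma runs_right: "runs (\<lambda>x. snd x) (\<lambda>_. 2)"
proof (rule runs_expr)
  fix x :: "'a \<times> 'b"
  show "evalb [ERight (EVar 0)] [encode x] (ERight (EVar 0)) (encode (snd x)) 2"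
    using evalb_Right[OF evalb_Var[of 0 "[encode x]"]] by (cases x) (simp add: numeral_2_eq_2)
qed

primrec const_expr :: "tree \<Rightarrow> expr" where
  "const_expr Leaf = ELeaf"
| "const_expr (Node a b) = ENode (const_expr a) (const_expr b)"

lemma evalb_const: "evalb P env (const_expr t) t (tree_size t)"
proof (induction t)
  case Leaf show ?case by (simp add: evalb_Leaf[simplified])
next
  case (Node a b) then show ?case using evalb_Node by fastforce
qed

lemma runs_const: "runs (\<lambda>x. c) (\<lambda>_. sz c)"
  by (rule runs_expr[of "const_expr (encode c)"]) (rule evalb_const)

text \<open>Functions with equal encodings, such as conversions between representations, share programs.\<close>

lemma runs_recode:
  assumes "runs f \<tau>" "\<And>x. \<exists>y. encode x = encode y \<and> encode (g x) = encode (f y) \<and> \<tau> y \<le> \<sigma> x"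
  shows "runs g \<sigma>"
proof -
  obtain P where P: "prog P f \<tau>" using assms(1) by (auto simp: runs_def)
  have "prog P g \<sigma>"
    unfolding prog_def
  proof (intro conjI allI)
    show "P \<noteq> []" using P by (simp add: prog_def)
    fix x
    obtain y where y: "encode x = encode y" "encode (g x) = encode (f y)" "\<tau> y \<le> \<sigma> x" using assms(2) by blast
    have "evalb P [encode y] (P ! 0) (encode (f y)) (\<tau> y)" using P by (simp add: prog_def)
    then show "evalb P [encode x] (P ! 0) (encode (g x)) (\<sigma> x)" using y evalb_mono by fastforce
  qed
  then show ?thesis by (auto simp: runs_def)
qed

lemma runs_comp:
  fixes f :: "'b::encodable \<Rightarrow> 'c::encodable" and g :: "'a::encodable \<Rightarrow> 'b"
  assumes "runs f \<tau>" "runs g \<sigma>"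
  shows "runs (\<lambda>x. f (g x)) (\<lambda>x. \<sigma> x + \<tau> (g x) + 3)"
proof -
  obtain P1 P2 where P: "prog P1 f \<tau>" "prog P2 g \<sigma>" using assms by (auto simp: runs_def)
  let ?n = "Suc (length P1)"
  let ?e = "ECall 1 [ECall ?n [EVar 0]]"
  let ?Q = "?e # map (shift 1) P1 @ map (shift ?n) P2"
  have Q1: "?Q = [?e] @ map (shift (length [?e])) P1 @ map (shift ?n) P2" by simp
  have Q2: "?Q = (?e # map (shift 1) P1) @ map (shift (length (?e # map (shift 1) P1))) P2 @ []" by simp
  have "prog ?Q (\<lambda>x. f (g x)) (\<lambda>x. \<sigma> x + \<tau> (g x) + 3)"
    unfolding prog_def
  proof (intro conjI allI)
    fix x :: 'a
    have 0: "evalb ?Q [encode x] (EVar 0) (encode x) 1" using evalb_Var[of 0 "[encode x]"] by simp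
    have 1: "evalb ?Q [encode x] (ECall ?n [EVar 0]) (encode (g x)) (Suc (1 + \<sigma> x))"
      by (rule evalb_link[OF P(2) Q2 0]) simp
    have "evalb ?Q [encode x] ?e (encode (f (g x))) (Suc (Suc (1 + \<sigma> x) + \<tau> (g x)))"
      by (rule evalb_link[OF P(1) Q1 1]) simp
    then show "evalb ?Q [encode x] (?Q ! 0) (encode (f (g x))) (\<sigma> x + \<tau> (g x) + 3)"
      by (simp split del: if_split, elim evalb_mono, simp)
  qed simp
  then show ?thesis by (auto simp: runs_def)
qed

lemma runs_pair:
  fixes f :: "'a::encodable \<Rightarrow> 'b::encodable" and g :: "'a \<Rightarrow> 'c::encodable"
  assumes "runs f \<tau>" "runs g \<sigma>"
  shows "runs (\<lambda>x. (f x, g x)) (\<lambda>x. \<tau> x + \<sigma> x + 5)"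
proof -
  obtain P1 P2 where P: "prog P1 f \<tau>" "prog P2 g \<sigma>" using assms by (auto simp: runs_def)
  let ?n = "Suc (length P1)"
  let ?e = "ENode (ECall 1 [EVar 0]) (ECall ?n [EVar 0])"
  let ?Q = "?e # map (shift 1) P1 @ map (shift ?n) P2"
  have Q1: "?Q = [?e] @ map (shift (length [?e])) P1 @ map (shift ?n) P2" by simp
  have Q2: "?Q = (?e # map (shift 1) P1) @ map (shift (length (?e # map (shift 1) P1))) P2 @ []" by simp
  have "prog ?Q (\<lambda>x. (f x, g x)) (\<lambda>x. \<tau> x + \<sigma> x + 5)"
    unfolding prog_def
  proof (intro conjI allI)
    fix x :: 'a
    have 0: "evalb ?Q [encode x] (EVar 0) (encode x) 1" using evalb_Var[of 0 "[encode x]"] by simp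
    have 1: "evalb ?Q [encode x] (ECall ?n [EVar 0]) (encode (g x)) (Suc (1 + \<sigma> x))"
      by (rule evalb_link[OF P(2) Q2 0]) simp
    have 2: "evalb ?Q [encode x] (ECall 1 [EVar 0]) (encode (f x)) (Suc (1 + \<tau> x))"
      by (rule evalb_link[OF P(1) Q1 0]) simp
    show "evalb ?Q [encode x] (?Q ! 0) (encode (f x, g x)) (\<tau> x + \<sigma> x + 5)"
      using evalb_Node[OF 2 1] by (simp split del: if_split, elim evalb_mono, simp)
  qed simp
  then show ?thesis by (auto simp: runs_def)
qed

lemma runs_if:
  fixes f :: "'a::encodable \<Rightarrow> 'b::encodable"
  assumes "runs c \<rho>" "runs f \<tau>" "runs g \<sigma>"
  shows "runs (\<lambda>x. if c x then f x else g x) (\<lambda>x. \<rho> x + (if c x then \<tau> x else \<sigma> x) + 5)"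
proof -
  obtain P0 P1 P2 where P: "prog P0 c \<rho>" "prog P1 f \<tau>" "prog P2 g \<sigma>" using assms by (auto simp: runs_def)
  let ?n = "Suc (length P0)" let ?m = "Suc (length P0 + length P1)"
  let ?e = "EIf (ECall 1 [EVar 0]) (ECall ?n [EVar 0]) (ECall ?m [EVar 0])"
  let ?Q = "?e # map (shift 1) P0 @ map (shift ?n) P1 @ map (shift ?m) P2"
  have Q0: "?Q = [?e] @ map (shift (length [?e])) P0 @ map (shift ?n) P1 @ map (shift ?m) P2" by simp
  have Q1: "?Q = (?e # map (shift 1) P0) @ map (shift (length (?e # map (shift 1) P0))) P1 @ map (shift ?m) P2" by simp
  have Q2: "?Q = (?e # map (shift 1) P0 @ map (shift ?n) P1) @
     map (shift (length (?e # map (shift 1) P0 @ map (shift ?n) P1))) P2 @ []" by simp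
  have "prog ?Q (\<lambda>x. if c x then f x else g x) (\<lambda>x. \<rho> x + (if c x then \<tau> x else \<sigma> x) + 5)"
    unfolding prog_def
  proof (intro conjI allI)
    fix x :: 'a
    have z: "evalb ?Q [encode x] (EVar 0) (encode x) 1" using evalb_Var[of 0 "[encode x]"] by simp
    have 0: "evalb ?Q [encode x] (ECall 1 [EVar 0]) (encode (c x)) (Suc (1 + \<rho> x))"
      by (rule evalb_link[OF P(1) Q0 z]) simp
    have 1: "evalb ?Q [encode x] (ECall ?n [EVar 0]) (encode (f x)) (Suc (1 + \<tau> x))"
      by (rule evalb_link[OF P(2) Q1 z]) simp
    have 2: "evalb ?Q [encode x] (ECall ?m [EVar 0]) (encode (g x)) (Suc (1 + \<sigma> x))"
      by (rule evalb_link[OF P(3) Q2 z]) simp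
    have "evalb ?Q [encode x] ?e (encode (if c x then f x else g x))
        (Suc (Suc (1 + \<rho> x) + Suc (1 + (if c x then \<tau> x else \<sigma> x))))"
      by (rule evalb_If[OF 0]) (use 1 2 in \<open>auto simp: encode_bool_def\<close>)
    then show "evalb ?Q [encode x] (?Q ! 0) (encode (if c x then f x else g x)) (\<rho> x + (if c x then \<tau> x else \<sigma> x) + 5)"
      by (simp split del: if_split, elim evalb_mono, simp)
  qed simp
  then show ?thesis by (auto simp: runs_def)
qed

lemma runs_fold:
  fixes f :: "'e::encodable \<Rightarrow> 'x::encodable \<Rightarrow> 'a::encodable \<Rightarrow> 'a"
  assumes "runs (\<lambda>p. f (fst p) (fst (snd p)) (snd (snd p))) \<tau>"
  shows "runs (\<lambda>p. fold (f (fst p)) (fst (snd p)) (snd (snd p)))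
     (\<lambda>p. (\<Sum>k<length (fst (snd p)). \<tau> (fst p, fst (snd p) ! k, fold (f (fst p)) (take k (fst (snd p))) (snd (snd p))) + 15) + 13)"
proof -
  obtain P where P: "prog P (\<lambda>p. f (fst p) (fst (snd p)) (snd (snd p))) \<tau>" using assms by (auto simp: runs_def)
  \<comment> \<open>Function 0 unpacks the argument, function 1 is the loop with environment,
    remaining list and accumulator as its arguments, and the code of \<open>f\<close> starts at
    index 2. \<open>?a\<close> packs the argument triple of \<open>f\<close>.\<close>
  let ?a = "ENode (EVar 0) (ENode (ELeft (EVar 1)) (EVar 2))"
  let ?l = "EIf (EVar 1) (ECall 1 [EVar 0, ERight (EVar 1), ECall 2 [?a]]) (EVar 2)"
  let ?m = "ECall 1 [ELeft (EVar 0), ELeft (ERight (EVar 0)), ERight (ERight (EVar 0))]"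
  let ?Q = "[?m, ?l] @ map (shift (length [?m, ?l])) P @ []"
  define T where "T e xs a = (\<Sum>k<length xs. \<tau> (e, xs ! k, fold (f e) (take k xs) a) + 15) + 3" for e xs a
  have var: "evalb ?Q env (EVar i) (env ! i) 1" if "i < length env" for env i
    using evalb_Var that by blast
  have loop: "evalb ?Q [encode e, encode xs, encode a] ?l (encode (fold (f e) xs a)) (T e xs a)" for e xs a
  proof (induction xs arbitrary: a)
    case Nil
    have "evalb ?Q [encode e, encode ([]::'x list), encode a] ?l (encode a) (Suc (1 + 1))"
      by (rule evalb_If[OF var]) (use var[of 2 "[_,_,_]"] in auto)
    then show ?case by (auto simp: T_def numeral_3_eq_3)
  next
    case (Cons x xs)
    let ?env = "[encode e, encode (x # xs), encode a]"
    have v0: "evalb ?Q ?env (EVar 0) (encode e) 1"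
     and v1: "evalb ?Q ?env (EVar 1) (Node (encode x) (encode xs)) 1"
     and v2: "evalb ?Q ?env (EVar 2) (encode a) 1"
      using var[of 0 ?env] var[of 1 ?env] var[of 2 ?env] by auto
    have a: "evalb ?Q ?env ?a (encode (e, x, a)) (Suc (1 + Suc (Suc 1 + 1)))"
      using evalb_Node[OF v0 evalb_Node[OF evalb_Left[OF v1] v2]] by simp
    have s: "evalb ?Q ?env (ECall 2 [?a]) (encode (f e x a)) (Suc (Suc (1 + Suc (Suc 1 + 1)) + \<tau> (e, x, a)))"
      using evalb_link[OF P refl a, of 2] by simp
    have args: "evalsb ?Q ?env [EVar 0, ERight (EVar 1), ECall 2 [?a]] [encode e, encode xs, encode (f e x a)]
       (1 + (Suc 1 + (Suc (Suc (1 + Suc (Suc 1 + 1)) + \<tau> (e, x, a)) + 0)))"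
      using evalsb_Cons[OF v0 evalsb_Cons[OF evalb_Right[OF v1] evalsb_Cons[OF s evalsb_Nil]]] by simp
    have c: "evalb ?Q ?env (ECall 1 [EVar 0, ERight (EVar 1), ECall 2 [?a]]) (encode (fold (f e) (x # xs) a))
       (Suc (1 + (Suc 1 + (Suc (Suc (1 + Suc (Suc 1 + 1)) + \<tau> (e, x, a)) + 0)) + T e xs (f e x a)))"
      by (rule evalb_Call[OF _ args]) (use Cons.IH[of "f e x a"] in auto)
    have "evalb ?Q ?env ?l (encode (fold (f e) (x # xs) a))
       (Suc (1 + Suc (1 + (Suc 1 + (Suc (Suc (1 + Suc (Suc 1 + 1)) + \<tau> (e, x, a)) + 0)) + T e xs (f e x a))))"
      by (rule evalb_If[OF v1]) (use c in auto)
    then show ?case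
      by (rule evalb_mono) (simp add: T_def sum.lessThan_Suc_shift del: sum.lessThan_Suc)
  qed
  have "prog ?Q (\<lambda>p. fold (f (fst p)) (fst (snd p)) (snd (snd p))) (\<lambda>p. T (fst p) (fst (snd p)) (snd (snd p)) + 10)"
    unfolding prog_def
  proof (intro conjI allI)
    fix p :: "'e \<times> 'x list \<times> 'a"
    obtain e xs a where p: "p = (e, xs, a)" by (cases p) auto
    have v: "evalb ?Q [encode p] (EVar 0) (Node (encode e) (Node (encode xs) (encode a))) 1"
      using var[of 0 "[encode p]"] by (simp add: p)
    have args: "evalsb ?Q [encode p] [ELeft (EVar 0), ELeft (ERight (EVar 0)), ERight (ERight (EVar 0))]
        [encode e, encode xs, encode a] (Suc 1 + (Suc (Suc 1) + (Suc (Suc 1) + 0)))"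
      using evalsb_Cons[OF evalb_Left[OF v] evalsb_Cons[OF evalb_Left[OF evalb_Right[OF v]]
        evalsb_Cons[OF evalb_Right[OF evalb_Right[OF v]] evalsb_Nil]]] by simp
    have "evalb ?Q [encode p] ?m (encode (fold (f e) xs a)) (Suc (Suc 1 + (Suc (Suc 1) + (Suc (Suc 1) + 0)) + T e xs a))"
      by (rule evalb_Call[OF _ args]) (use loop in auto)
    then show "evalb ?Q [encode p] (?Q ! 0) (encode (fold (f (fst p)) (fst (snd p)) (snd (snd p))))
       (T (fst p) (fst (snd p)) (snd (snd p)) + 10)" by (simp add: p, elim evalb_mono, simp)
  qed simp
  then show ?thesis unfolding runs_def T_def by (auto simp: add.assoc)
qed

text \<open>A paramorphism: the step sees the subtrees as well as the recursive results.
  \<open>bin_inc\<close> and \<open>flat_step\<close> use both.\<close>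

primrec tree_foldr :: "'b \<Rightarrow> (tree \<Rightarrow> tree \<Rightarrow> 'b \<Rightarrow> 'b \<Rightarrow> 'b) \<Rightarrow> tree \<Rightarrow> 'b" where
  "tree_foldr z g Leaf = z"
| "tree_foldr z g (Node a b) = g a b (tree_foldr z g a) (tree_foldr z g b)"

primrec tree_foldr_time :: "(tree \<Rightarrow> tree \<Rightarrow> nat) \<Rightarrow> nat \<Rightarrow> tree \<Rightarrow> nat" where
  "tree_foldr_time \<tau> c Leaf = c"
| "tree_foldr_time \<tau> c (Node a b) = \<tau> a b + tree_foldr_time \<tau> c a + tree_foldr_time \<tau> c b + 18"

lemma runs_tree_foldr:
  fixes z :: "'b::encodable"
  assumes "runs (\<lambda>p. g (fst (fst p)) (snd (fst p)) (fst (snd p)) (snd (snd p))) \<tau>"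
  shows "runs (\<lambda>t. tree_foldr z g t)
     (tree_foldr_time (\<lambda>a b. \<tau> ((a, b), (tree_foldr z g a, tree_foldr z g b))) (sz z + 2))"
proof -
  obtain P where P: "prog P (\<lambda>p. g (fst (fst p)) (snd (fst p)) (fst (snd p)) (snd (snd p))) \<tau>"
    using assms by (auto simp: runs_def)
  let ?a = "ENode (EVar 0) (ENode (ECall 0 [ELeft (EVar 0)]) (ECall 0 [ERight (EVar 0)]))"
  let ?m = "EIf (EVar 0) (ECall 1 [?a]) (const_expr (encode z))"
  let ?Q = "[?m] @ map (shift (length [?m])) P @ []"
  let ?\<sigma> = "tree_foldr_time (\<lambda>a b. \<tau> ((a, b), (tree_foldr z g a, tree_foldr z g b))) (sz z + 2)"
  have loop: "evalb ?Q [t] ?m (encode (tree_foldr z g t)) (?\<sigma> t)" for t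
  proof (induction t)
    case Leaf
    have "evalb ?Q [Leaf] ?m (encode z) (Suc (1 + sz z))"
      by (rule evalb_If[OF evalb_Var]) (auto intro: evalb_const)
    then show ?case by simp
  next
    case (Node a b)
    let ?env = "[Node a b]"
    have v: "evalb ?Q ?env (EVar 0) (Node a b) 1" using evalb_Var[of 0 ?env] by simp
    have 1: "evalb ?Q ?env (ECall 0 [ELeft (EVar 0)]) (encode (tree_foldr z g a)) (Suc (Suc 1 + 0 + ?\<sigma> a))"
      by (rule evalb_Call[OF _ evalsb_Cons[OF evalb_Left[OF v] evalsb_Nil]]) (use Node.IH in auto)
    have 2: "evalb ?Q ?env (ECall 0 [ERight (EVar 0)]) (encode (tree_foldr z g b)) (Suc (Suc 1 + 0 + ?\<sigma> b))"
      by (rule evalb_Call[OF _ evalsb_Cons[OF evalb_Right[OF v] evalsb_Nil]]) (use Node.IH in auto)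
    let ?p = "((a, b), (tree_foldr z g a, tree_foldr z g b))"
    have 3: "evalb ?Q ?env ?a (encode ?p) (Suc (1 + Suc (Suc (Suc 1 + 0 + ?\<sigma> a) + Suc (Suc 1 + 0 + ?\<sigma> b))))"
      using evalb_Node[OF v evalb_Node[OF 1 2]] by (simp add: encode_tree_def)
    have 4: "evalb ?Q ?env (ECall 1 [?a]) (encode (tree_foldr z g (Node a b)))
       (Suc (Suc (1 + Suc (Suc (Suc 1 + 0 + ?\<sigma> a) + Suc (Suc 1 + 0 + ?\<sigma> b))) + \<tau> ?p))"
      using evalb_link[OF P refl 3, of 1] by simp
    have "evalb ?Q ?env ?m (encode (tree_foldr z g (Node a b)))
       (Suc (1 + (Suc (Suc (1 + Suc (Suc (Suc 1 + 0 + ?\<sigma> a) + Suc (Suc 1 + 0 + ?\<sigma> b))) + \<tau> ?p))))"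
      by (rule evalb_If[OF v]) (use 4 in auto)
    then show ?case by (rule evalb_mono) simp
  qed
  have "prog ?Q (\<lambda>t. tree_foldr z g t) ?\<sigma>"
    unfolding prog_def using loop by (simp add: encode_tree_def)
  then show ?thesis by (auto simp: runs_def)
qed

text \<open>Both trees are descended in parallel until the first difference, so the size of the
  first one bounds the time. Injectivity of the encoding transfers the answer to values.\<close>

lemma runs_eq: "runs (\<lambda>p. fst p = (snd p :: 'a::encodable)) (\<lambda>p. 16 * sz (fst p) + 6)"
proof -
  let ?t = "ECall 1 [ERight (EVar 0), ERight (EVar 1)]"
  let ?h = "ECall 1 [ELeft (EVar 0), ELeft (EVar 1)]"
  let ?l = "EIf (EVar 0) (EIf (EVar 1) (EIf ?h ?t ELeaf) ELeaf) (EIf (EVar 1) ELeaf (ENode ELeaf ELeaf))"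
  let ?m = "ECall 1 [ELeft (EVar 0), ERight (EVar 0)]"
  let ?Q = "[?m, ?l]"
  have loop: "evalb ?Q [x, y] ?l (encode (x = y)) (16 * tree_size x)" for x y
  proof (induction x arbitrary: y)
    case Leaf
    have v0: "evalb ?Q [Leaf, y] (EVar 0) Leaf 1" and v1: "evalb ?Q [Leaf, y] (EVar 1) y 1"
      using evalb_Var[of 0 "[Leaf, y]"] evalb_Var[of 1 "[Leaf, y]"] by auto
    have "evalb ?Q [Leaf, y] (EIf (EVar 1) ELeaf (ENode ELeaf ELeaf)) (encode (Leaf = y)) (Suc (1 + Suc (1 + 1)))"
      by (rule evalb_If[OF v1])
        (use evalb_Node[OF evalb_Leaf evalb_Leaf] in \<open>auto simp: encode_bool_def intro: evalb_mono[OF evalb_Leaf]\<close>)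
    then have "evalb ?Q [Leaf, y] ?l (encode (Leaf = y)) (Suc (1 + Suc (1 + Suc (1 + 1))))"
      by (intro evalb_If[OF v0]) simp
    then show ?case by (rule evalb_mono) simp
  next
    case (Node a b)
    show ?case
    proof (cases y)
      case y: Leaf
      have v0: "evalb ?Q [Node a b, y] (EVar 0) (Node a b) 1" and v1: "evalb ?Q [Node a b, y] (EVar 1) Leaf 1"
        using evalb_Var[of 0 "[Node a b, y]"] evalb_Var[of 1 "[Node a b, y]"] y by auto
      have "evalb ?Q [Node a b, y] (EIf (EVar 1) (EIf ?h ?t ELeaf) ELeaf) (encode (Node a b = y)) (Suc (1 + 1))"
        by (rule evalb_If[OF v1]) (use evalb_Leaf y in \<open>auto simp: encode_bool_def\<close>)
      then have "evalb ?Q [Node a b, y] ?l (encode (Node a b = y)) (Suc (1 + Suc (1 + 1)))"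
        by (intro evalb_If[OF v0]) simp
      then show ?thesis by (rule evalb_mono) simp
    next
      case y: (Node c d)
      let ?env = "[Node a b, Node c d]"
      have v0: "evalb ?Q ?env (EVar 0) (Node a b) 1" and v1: "evalb ?Q ?env (EVar 1) (Node c d) 1"
        using evalb_Var[of 0 ?env] evalb_Var[of 1 ?env] by auto
      have 1: "evalb ?Q ?env ?h (encode (a = c)) (Suc (Suc 1 + (Suc 1 + 0) + 16 * tree_size a))"
        by (rule evalb_Call[OF _ evalsb_Cons[OF evalb_Left[OF v0] evalsb_Cons[OF evalb_Left[OF v1] evalsb_Nil]]])
          (use Node.IH in auto)
      have 2: "evalb ?Q ?env ?t (encode (b = d)) (Suc (Suc 1 + (Suc 1 + 0) + 16 * tree_size b))"
        by (rule evalb_Call[OF _ evalsb_Cons[OF evalb_Right[OF v0] evalsb_Cons[OF evalb_Right[OF v1] evalsb_Nil]]])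
          (use Node.IH in auto)
      have 3: "evalb ?Q ?env (EIf ?h ?t ELeaf) (encode (Node a b = Node c d))
         (Suc (Suc (Suc 1 + (Suc 1 + 0) + 16 * tree_size a) + (Suc (Suc 1 + (Suc 1 + 0) + 16 * tree_size b))))"
        by (rule evalb_If[OF 1]) (use 2 in \<open>auto simp: encode_bool_def intro: evalb_mono[OF evalb_Leaf]\<close>)
      have 4: "evalb ?Q ?env (EIf (EVar 1) (EIf ?h ?t ELeaf) ELeaf) (encode (Node a b = Node c d))
         (Suc (1 + (Suc (Suc (Suc 1 + (Suc 1 + 0) + 16 * tree_size a) + (Suc (Suc 1 + (Suc 1 + 0) + 16 * tree_size b))))))"
        by (rule evalb_If[OF v1]) (use 3 in simp)
      have "evalb ?Q ?env ?l (encode (Node a b = Node c d))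
         (Suc (1 + Suc (1 + (Suc (Suc (Suc 1 + (Suc 1 + 0) + 16 * tree_size a) + (Suc (Suc 1 + (Suc 1 + 0) + 16 * tree_size b)))))))"
        by (rule evalb_If[OF v0]) (use 4 in simp)
      then show ?thesis by (simp add: y, elim evalb_mono, simp)
    qed
  qed
  have "prog ?Q (\<lambda>p. fst p = (snd p :: 'a)) (\<lambda>p. 16 * sz (fst p) + 6)"
    unfolding prog_def
  proof (intro conjI allI)
    fix p :: "'a \<times> 'a"
    obtain x y where p: "p = (x, y)" by (cases p) auto
    have v: "evalb ?Q [encode p] (EVar 0) (Node (encode x) (encode y)) 1"
      using evalb_Var[of 0 "[encode p]"] by (simp add: p)
    have "evalb ?Q [encode p] ?m (encode (x = y)) (Suc (Suc 1 + (Suc 1 + 0) + 16 * sz x))"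
      by (rule evalb_Call[OF _ evalsb_Cons[OF evalb_Left[OF v] evalsb_Cons[OF evalb_Right[OF v] evalsb_Nil]]])
        (use loop[of "encode x" "encode y"] in \<open>auto simp: encode_inject\<close>)
    then show "evalb ?Q [encode p] (?Q ! 0) (encode (fst p = snd p)) (16 * sz (fst p) + 6)"
      by (simp add: p, elim evalb_mono, simp)
  qed simp
  then show ?thesis by (auto simp: runs_def)
qed


section \<open>Functions with time and output size bounded by a member of a class\<close>

definition fc :: "(nat \<Rightarrow> nat) set \<Rightarrow> ('a::encodable \<Rightarrow> 'b::encodable) \<Rightarrow> bool" where
  "fc B f \<longleftrightarrow> (\<exists>b\<in>B. runs f (\<lambda>x. b (sz x)) \<and> (\<forall>x. sz (f x) \<le> b (sz x)))"

named_theorems fc_intros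

lemma sz_pair [simp]: "sz (x, y) = Suc (sz x + sz y)"
  by simp

lemma sz_nat [simp]: "sz (n :: nat) = 2 * n + 1"
  by (induction n) auto

lemma sz_bool: "sz (b :: bool) \<le> 3"
  by (simp add: encode_bool_def)

lemma sz_member: "x \<in> set xs \<Longrightarrow> sz x < sz xs"
  by (induction xs) auto

lemma length_less_sz: "length xs < sz xs"
  by (induction xs) auto

lemma sz_append: "sz (xs @ ys) + 1 = sz xs + sz ys"
  by (induction xs) auto

lemma sz_fst: "sz (fst p) < sz p" and sz_snd: "sz (snd p) < sz p"
  by (cases p; simp)+

lemma fc_recode:
  assumes "fc B f" "\<And>x. encode (g x) = encode (f x)"
  shows "fc B g"
proof -
  obtain b where b: "b \<in> B" "runs f (\<lambda>x. b (sz x))" "\<forall>x. sz (f x) \<le> b (sz x)" using assms by (auto simp: fc_def)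
  have "runs g (\<lambda>x. b (sz x))" by (rule runs_recode[OF b(2)]) (use assms(2) in auto)
  then show ?thesis using b assms(2) by (auto simp: fc_def)
qed

lemma fold_replicate_funpow: "fold (\<lambda>_::unit. f) (replicate n ()) a = (f ^^ n) a"
  by (induction n arbitrary: a) (auto simp: funpow_swap1)

text \<open>Successor on \<open>enc_nat\<close> numerals: a bit 0 is set and the rest
  \<open>b\<close> kept, a bit 1 is cleared and the carry goes to \<open>rb\<close>. The value at
  \<open>Leaf\<close> is the numeral 1.\<close>

definition bin_inc :: "tree \<Rightarrow> tree" where
  "bin_inc t = tree_foldr (Node (Node Leaf Leaf) Leaf)
     (\<lambda>a b ra rb. if a = Leaf then Node (Node Leaf Leaf) b else Node Leaf rb) t"

text \<open>Closure conditions common to the polynomial and the fast-growing bounds, so that each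
  combinator is analysed once for both.\<close>

locale resource =
  fixes B :: "(nat \<Rightarrow> nat) set"
  assumes mono: "b \<in> B \<Longrightarrow> m \<le> n \<Longrightarrow> b m \<le> b n"
    and comp: "b \<in> B \<Longrightarrow> c \<in> B \<Longrightarrow> \<exists>d\<in>B. \<forall>n. b (c n) \<le> d n"
    and add: "b \<in> B \<Longrightarrow> c \<in> B \<Longrightarrow> \<exists>d\<in>B. \<forall>n. b n + c n \<le> d n"
    and mult: "b \<in> B \<Longrightarrow> c \<in> B \<Longrightarrow> \<exists>d\<in>B. \<forall>n. b n * c n \<le> d n"
    and const: "\<exists>d\<in>B. \<forall>n. k \<le> d n"
    and ident: "\<exists>d\<in>B. \<forall>n. n \<le> d n"
begin

definition bd :: "(nat \<Rightarrow> nat) \<Rightarrow> bool" where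
  "bd h \<longleftrightarrow> (\<exists>b\<in>B. \<forall>n. h n \<le> b n)"

lemma bd_mem: "b \<in> B \<Longrightarrow> bd b"
  by (auto simp: bd_def)

lemma bd_const: "bd (\<lambda>_. k)"
  using const by (auto simp: bd_def)

lemma bd_id: "bd (\<lambda>n. n)"
  using ident by (auto simp: bd_def)

lemma bd_add: "bd f \<Longrightarrow> bd g \<Longrightarrow> bd (\<lambda>n. f n + g n)"
  unfolding bd_def by (meson add add_mono le_trans)

lemma bd_Suc: "bd f \<Longrightarrow> bd (\<lambda>n. Suc (f n))"
  using bd_add[of f "\<lambda>_. 1"] bd_const by simp

lemma bd_mult: "bd f \<Longrightarrow> bd g \<Longrightarrow> bd (\<lambda>n. f n * g n)"
  unfolding bd_def by (meson mult mult_le_mono le_trans)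

lemma bd_comp: "bd f \<Longrightarrow> bd g \<Longrightarrow> bd (\<lambda>n. f (g n))"
proof -
  assume "bd f" "bd g"
  then obtain b c where bc: "b \<in> B" "c \<in> B" "\<And>n. f n \<le> b n" "\<And>n. g n \<le> c n" by (auto simp: bd_def)
  obtain d where d: "d \<in> B" "\<And>n. b (c n) \<le> d n" using comp[OF bc(1,2)] by blast
  have "f (g n) \<le> d n" for n
    using bc(3)[of "g n"] mono[OF bc(1) bc(4)[of n]] d(2)[of n] by linarith
  then show ?thesis using d(1) by (auto simp: bd_def)
qed

lemma bd_le: "bd g \<Longrightarrow> (\<And>n. f n \<le> g n) \<Longrightarrow> bd f"
  unfolding bd_def by (meson le_trans)

lemmas bd_intros = bd_const bd_id bd_add bd_Suc bd_mult

lemma fcI: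
  assumes "runs f \<tau>" "\<And>x. \<tau> x \<le> h (sz x)" "\<And>x. sz (f x) \<le> h' (sz x)" "bd h" "bd h'"
  shows "fc B f"
proof -
  obtain b where b: "b \<in> B" "\<And>n. h n + h' n \<le> b n" using bd_add[OF assms(4,5)] by (auto simp: bd_def)
  have "runs f (\<lambda>x. b (sz x))"
    by (rule runs_mono[OF assms(1)]) (meson assms(2) b(2) add_leE le_trans)
  moreover have "sz (f x) \<le> b (sz x)" for x by (meson assms(3) b(2) add_leE le_trans)
  ultimately show ?thesis using b(1) by (auto simp: fc_def)
qed

lemma fcE:
  assumes "fc B f"
  obtains b where "b \<in> B" "bd b" "runs f (\<lambda>x. b (sz x))" "\<And>x. sz (f x) \<le> b (sz x)"
    "\<And>m n. m \<le> n \<Longrightarrow> b m \<le> b n"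
  using assms mono bd_mem by (auto simp: fc_def)

lemma fc_id [fc_intros]: "fc B (\<lambda>x. x)"
  by (rule fcI[OF runs_id _ _ bd_const[of 1] bd_id]) auto

lemma fc_const [fc_intros]: "fc B (\<lambda>x. c)"
  by (rule fcI[OF runs_const _ _ bd_const[of "sz c"] bd_const[of "sz c"]]) auto

text \<open>The output size of the inner function bounds the input size of the outer one. This is
  why \<open>fc\<close> bounds time and output size together.\<close>

lemma fc_comp:
  assumes "fc B f" "fc B g"
  shows "fc B (\<lambda>x. f (g x))"
proof -
  obtain b where b: "bd b" "runs f (\<lambda>x. b (sz x))" "\<And>x. sz (f x) \<le> b (sz x)" "\<And>m n. m \<le> n \<Longrightarrow> b m \<le> b n"
    using assms(1) by (elim fcE) blast
  obtain c where c: "bd c" "runs g (\<lambda>x. c (sz x))" "\<And>x. sz (g x) \<le> c (sz x)" "\<And>m n. m \<le> n \<Longrightarrow> c m \<le> c n"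
    using assms(2) by (elim fcE) blast
  have bc: "bd (\<lambda>n. b (c n))" by (rule bd_comp[OF b(1) c(1)])
  show ?thesis
  proof (rule fcI[OF runs_comp[OF b(2) c(2)]])
    fix x
    have "b (sz (g x)) \<le> b (c (sz x))" by (rule b(4)) (rule c(3))
    then show "c (sz x) + b (sz (g x)) + 3 \<le> c (sz x) + b (c (sz x)) + 3" "sz (f (g x)) \<le> b (c (sz x))"
      using b(3)[of "g x"] by linarith+
    show "bd (\<lambda>n. c n + b (c n) + 3)" by (intro bd_add bd_const c(1) bc)
  qed (rule bc)
qed

lemma fc_fst [fc_intros]:
  fixes a :: "'a::encodable \<Rightarrow> 'b::encodable \<times> 'c::encodable"
  assumes "fc B a"
  shows "fc B (\<lambda>e. fst (a e))"
proof -
  have "fc B (\<lambda>x :: 'b \<times> 'c. fst x)"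
    by (rule fcI[OF runs_left, of "\<lambda>_. 2" "\<lambda>n. n"]) (auto intro: less_imp_le sz_fst bd_intros)
  from fc_comp[OF this assms] show ?thesis .
qed

lemma fc_snd [fc_intros]:
  fixes a :: "'a::encodable \<Rightarrow> 'b::encodable \<times> 'c::encodable"
  assumes "fc B a"
  shows "fc B (\<lambda>e. snd (a e))"
proof -
  have "fc B (\<lambda>x :: 'b \<times> 'c. snd x)"
    by (rule fcI[OF runs_right, of "\<lambda>_. 2" "\<lambda>n. n"]) (auto intro: less_imp_le sz_snd bd_intros)
  from fc_comp[OF this assms] show ?thesis .
qed

lemma fc_pair [fc_intros]:
  assumes "fc B f" "fc B g"
  shows "fc B (\<lambda>x. (f x, g x))"
proof -
  obtain b where b: "bd b" "runs f (\<lambda>x. b (sz x))" "\<And>x. sz (f x) \<le> b (sz x)"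
    using assms(1) by (elim fcE) blast
  obtain c where c: "bd c" "runs g (\<lambda>x. c (sz x))" "\<And>x. sz (g x) \<le> c (sz x)"
    using assms(2) by (elim fcE) blast
  show ?thesis
    by (rule fcI[OF runs_pair[OF b(2) c(2)], of "\<lambda>n. b n + c n + 5" "\<lambda>n. Suc (b n + c n)"])
      (use b(3) c(3) in \<open>auto intro!: bd_intros b(1) c(1) simp: add_mono\<close>)
qed

lemma fc_if [fc_intros]:
  assumes "fc B c" "fc B f" "fc B g"
  shows "fc B (\<lambda>x. if c x then f x else g x)"
proof -
  obtain a where a: "bd a" "runs c (\<lambda>x. a (sz x))" using assms(1) by (elim fcE) blast
  obtain b where b: "bd b" "runs f (\<lambda>x. b (sz x))" "\<And>x. sz (f x) \<le> b (sz x)"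
    using assms(2) by (elim fcE) blast
  obtain d where d: "bd d" "runs g (\<lambda>x. d (sz x))" "\<And>x. sz (g x) \<le> d (sz x)"
    using assms(3) by (elim fcE) blast
  show ?thesis
  proof (rule fcI[OF runs_if[OF a(2) b(2) d(2)], of "\<lambda>n. a n + (b n + d n) + 5" "\<lambda>n. b n + d n"])
    fix x
    show "sz (if c x then f x else g x) \<le> b (sz x) + d (sz x)" using b(3)[of x] d(3)[of x] by simp
  qed (auto intro!: bd_intros a(1) b(1) d(1))
qed

lemma fc_comp2:
  assumes "fc B (\<lambda>p. f (fst p) (snd p))" "fc B a" "fc B b"
  shows "fc B (\<lambda>e. f (a e) (b e))"
  using fc_comp[OF assms(1) fc_pair[OF assms(2,3)]] by simp

lemma fc_comp3:
  assumes "fc B (\<lambda>p. f (fst p) (fst (snd p)) (snd (snd p)))" "fc B a" "fc B b" "fc B c"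
  shows "fc B (\<lambda>e. f (a e) (b e) (c e))"
  using fc_comp[OF assms(1) fc_pair[OF assms(2) fc_pair[OF assms(3,4)]]] by simp

lemma fc_Let [fc_intros]:
  assumes "fc B a" "fc B (\<lambda>p. f (fst p) (snd p))"
  shows "fc B (\<lambda>e. Let (a e) (f e))"
  using fc_comp2[OF assms(2) fc_id assms(1)] by (simp add: Let_def)

lemma fc_eq [fc_intros]:
  fixes a b :: "'a::encodable \<Rightarrow> 'b::encodable"
  assumes "fc B a" "fc B b"
  shows "fc B (\<lambda>e. a e = b e)"
proof -
  have "fc B (\<lambda>p. fst p = (snd p :: 'b))"
  proof (rule fcI[OF runs_eq])
    fix x :: "'b \<times> 'b"
    show "16 * sz (fst x) + 6 \<le> 16 * sz x + 6" using sz_fst[of x] by simp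
    show "sz (fst x = snd x) \<le> 3" by (rule sz_bool)
  qed (intro bd_intros)+
  from fc_comp2[OF this assms] show ?thesis .
qed

text \<open>Iterating a step that merely has a polynomial bound can blow up the accumulator, hence
  the bound \<open>h\<close> on all partial folds.\<close>

lemma fc_fold_bounded:
  assumes "fc B (\<lambda>p. f (fst p) (fst (snd p)) (snd (snd p)))" "fc B l" "fc B i" "bd h"
    and bound: "\<And>e k. sz (fold (f e) (take k (l e)) (i e)) \<le> h (sz e)"
  shows "fc B (\<lambda>e. fold (f e) (l e) (i e))"
proof -
  obtain b where b: "bd b" "runs (\<lambda>p. f (fst p) (fst (snd p)) (snd (snd p))) (\<lambda>x. b (sz x))"
     "\<And>m n. m \<le> n \<Longrightarrow> b m \<le> b n"
    using assms(1) by (elim fcE) blast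
  obtain c where c: "bd c" "runs (\<lambda>e. (e, l e, i e)) (\<lambda>x. c (sz x))"
    using fc_pair[OF fc_id fc_pair[OF assms(2,3)]] by (elim fcE) blast
  obtain d where d: "bd d" "\<And>x. sz (l x) \<le> d (sz x)"
    using assms(2) by (elim fcE) blast
  show ?thesis
  proof (rule fcI[OF runs_mono])
    show "runs (\<lambda>e. fold (f e) (l e) (i e)) (\<lambda>e. c (sz e) + ((\<Sum>k<length (l e). b (sz (e, l e ! k, fold (f e) (take k (l e)) (i e))) + 15) + 13) + 3)"
      using runs_comp[OF runs_fold[OF b(2)] c(2)] by simp
    fix e
    have "b (sz (e, l e ! k, fold (f e) (take k (l e)) (i e))) + 15 \<le> b (Suc (sz e + Suc (d (sz e) + h (sz e)))) + 15"
      if "k < length (l e)" for k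
    proof -
      have "sz (l e ! k) \<le> d (sz e)" using sz_member[of "l e ! k" "l e"] that d(2)[of e] by simp
      then have "sz (e, l e ! k, fold (f e) (take k (l e)) (i e)) \<le> Suc (sz e + Suc (d (sz e) + h (sz e)))"
        using bound[of e k] unfolding sz_pair by linarith
      then show ?thesis using b(3) by simp
    qed
    then have "(\<Sum>k<length (l e). b (sz (e, l e ! k, fold (f e) (take k (l e)) (i e))) + 15)
      \<le> length (l e) * (b (Suc (sz e + Suc (d (sz e) + h (sz e)))) + 15)"
      using sum_bounded_above[of "{..<length (l e)}" "\<lambda>k. b (sz (e, l e ! k, fold (f e) (take k (l e)) (i e))) + 15"] by auto
    also have "\<dots> \<le> d (sz e) * (b (Suc (sz e + Suc (d (sz e) + h (sz e)))) + 15)"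
      using length_less_sz[of "l e"] d(2)[of e] by (intro mult_le_mono1) linarith
    finally show "c (sz e) + ((\<Sum>k<length (l e). b (sz (e, l e ! k, fold (f e) (take k (l e)) (i e))) + 15) + 13) + 3
       \<le> c (sz e) + (d (sz e) * (b (Suc (sz e + Suc (d (sz e) + h (sz e)))) + 15) + 13) + 3" by simp
    show "c (sz e) + (d (sz e) * (b (Suc (sz e + Suc (d (sz e) + h (sz e)))) + 15) + 13) + 3
       \<le> (\<lambda>s. c s + (d s * (b (Suc (s + Suc (d s + h s))) + 15) + 13) + 3) (sz e)" by simp
    show "sz (fold (f e) (l e) (i e)) \<le> h (sz e)" using bound[of e "length (l e)"] by simp
  next
    show "bd (\<lambda>s. c s + (d s * (b (Suc (s + Suc (d s + h s))) + 15) + 13) + 3)"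
      by (intro bd_intros c d assms(4) bd_comp[OF b(1)])
  qed (rule assms(4))
qed

text \<open>If a step adds an amount that depends on the environment only, the growth is at most the
  list length times this amount.\<close>

lemma fc_fold_additive:
  assumes "fc B (\<lambda>p. f (fst p) (fst (snd p)) (snd (snd p)))" "fc B l" "fc B i" "bd g"
    and step: "\<And>e x a. x \<in> set (l e) \<Longrightarrow> sz (f e x a) \<le> sz a + g (sz e)"
  shows "fc B (\<lambda>e. fold (f e) (l e) (i e))"
proof -
  obtain d where d: "bd d" "\<And>x. sz (l x) \<le> d (sz x)" using assms(2) by (elim fcE) blast
  obtain c where c: "bd c" "\<And>x. sz (i x) \<le> c (sz x)" using assms(3) by (elim fcE) blast
  have *: "sz (fold (f e) xs a) \<le> sz a + length xs * g (sz e)" if "set xs \<subseteq> set (l e)" for e xs a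
    using that
  proof (induction xs arbitrary: a)
    case (Cons x xs)
    have "sz (fold (f e) (x # xs) a) \<le> sz (f e x a) + length xs * g (sz e)" using Cons by auto
    also have "\<dots> \<le> sz a + length (x # xs) * g (sz e)" using step[of x e a] Cons.prems by auto
    finally show ?case .
  qed simp
  show ?thesis
  proof (rule fc_fold_bounded[OF assms(1-3)])
    show "bd (\<lambda>s. c s + d s * g s)" by (intro bd_intros c d assms(4))
    fix e k
    have "sz (fold (f e) (take k (l e)) (i e)) \<le> sz (i e) + length (take k (l e)) * g (sz e)"
      by (rule *) (rule set_take_subset)
    also have "\<dots> \<le> c (sz e) + d (sz e) * g (sz e)"
      using c(2)[of e] length_less_sz[of "l e"] d(2)[of e] by (intro add_mono mult_le_mono1) auto
    finally show "sz (fold (f e) (take k (l e)) (i e)) \<le> c (sz e) + d (sz e) * g (sz e)" .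
  qed
qed

lemma fc_Cons [fc_intros]:
  assumes "fc B a" "fc B l" shows "fc B (\<lambda>e. a e # l e)"
  by (rule fc_recode[OF fc_pair[OF assms]]) simp

lemma fc_rev [fc_intros]:
  assumes "fc B l" shows "fc B (\<lambda>e. rev (l e))"
proof -
  obtain d where d: "bd d" "\<And>x. sz (l x) \<le> d (sz x)" using assms by (elim fcE) blast
  have "fc B (\<lambda>e. fold Cons (l e) [])"
  proof (rule fc_fold_additive[OF _ assms _ bd_Suc[OF d(1)]])
    fix e x and a :: "'b list" assume "x \<in> set (l e)"
    from sz_member[OF this] show "sz (x # a) \<le> sz a + Suc (d (sz e))" using d(2)[of e] by simp
  qed (intro fc_intros)+
  then show ?thesis by (simp add: fold_Cons_rev)
qed

lemma fc_foldr_additive: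
  assumes "fc B (\<lambda>p. f (fst p) (fst (snd p)) (snd (snd p)))" "fc B l" "fc B i" "bd g"
    and step: "\<And>e x a. x \<in> set (l e) \<Longrightarrow> sz (f e x a) \<le> sz a + g (sz e)"
  shows "fc B (\<lambda>e. foldr (f e) (l e) (i e))"
  using fc_fold_additive[OF assms(1) fc_rev[OF assms(2)] assms(3,4)] step by (simp add: foldr_conv_fold)

lemma fc_append [fc_intros]:
  assumes "fc B l" "fc B m" shows "fc B (\<lambda>e. l e @ m e)"
proof -
  obtain d where d: "bd d" "\<And>x. sz (l x) \<le> d (sz x)" using assms(1) by (elim fcE) blast
  have "fc B (\<lambda>e. foldr Cons (l e) (m e))"
  proof (rule fc_foldr_additive[OF _ assms bd_Suc[OF d(1)]])
    fix e x and a :: "'b list" assume "x \<in> set (l e)"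
    from sz_member[OF this] show "sz (x # a) \<le> sz a + Suc (d (sz e))" using d(2)[of e] by simp
  qed (intro fc_intros)
  then show ?thesis by (simp add: foldr_conv_fold fold_Cons_rev)
qed

lemma bound_on_members:
  assumes "fc B (\<lambda>p. f (fst p) (snd p))" "fc B l"
  obtains g where "bd g" "\<And>e x. x \<in> set (l e) \<Longrightarrow> sz (f e x) \<le> g (sz e)"
proof -
  obtain d where d: "bd d" "\<And>x. sz (l x) \<le> d (sz x)" using assms(2) by (elim fcE) blast
  obtain c where c: "bd c" "\<And>p. sz (f (fst p) (snd p)) \<le> c (sz p)" "\<And>m n. m \<le> n \<Longrightarrow> c m \<le> c n"
    using assms(1) by (elim fcE) blast
  show thesis
  proof
    show "bd (\<lambda>s. c (Suc (s + d s)))" by (intro bd_comp[OF c(1)] bd_intros d)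
    fix e x assume "x \<in> set (l e)"
    from sz_member[OF this] have "sz (e, x) \<le> Suc (sz e + d (sz e))" using d(2)[of e] by simp
    from c(3)[OF this] show "sz (f e x) \<le> c (Suc (sz e + d (sz e)))" using c(2)[of "(e, x)"] by simp
  qed
qed

lemma fc_map [fc_intros]:
  assumes "fc B (\<lambda>p. f (fst p) (snd p))" "fc B l" shows "fc B (\<lambda>e. map (f e) (l e))"
proof -
  obtain g where g: "bd g" "\<And>e x. x \<in> set (l e) \<Longrightarrow> sz (f e x) \<le> g (sz e)" using bound_on_members[OF assms] by blast
  have "fc B (\<lambda>e. foldr (\<lambda>x a. f e x # a) (l e) [])"
  proof (rule fc_foldr_additive[OF _ assms(2) _ bd_Suc[OF g(1)]])
    show "fc B (\<lambda>p. f (fst p) (fst (snd p)) # snd (snd p))"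
      by (intro fc_intros fc_comp2[OF assms(1)])
    show "sz (f e x # a) \<le> sz a + Suc (g (sz e))" if "x \<in> set (l e)" for e x a using g(2)[OF that] by simp
  qed (intro fc_intros)
  moreover have "foldr (\<lambda>x a. f e x # a) xs [] = map (f e) xs" for e xs by (induction xs) auto
  ultimately show ?thesis by simp
qed

lemma fc_filter [fc_intros]:
  assumes "fc B (\<lambda>p. P (fst p) (snd p))" "fc B l" shows "fc B (\<lambda>e. filter (P e) (l e))"
proof -
  obtain g where g: "bd g" "\<And>e x. x \<in> set (l e) \<Longrightarrow> sz ((\<lambda>e x. x) e x) \<le> g (sz e)"
    using bound_on_members[OF _ assms(2), of "\<lambda>e x. x"] fc_snd[OF fc_id] by blast
  have "fc B (\<lambda>e. foldr (\<lambda>x a. if P e x then x # a else a) (l e) [])"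
  proof (rule fc_foldr_additive[OF _ assms(2) _ bd_Suc[OF g(1)]])
    show "fc B (\<lambda>p. if P (fst p) (fst (snd p)) then fst (snd p) # snd (snd p) else snd (snd p))"
      by (intro fc_intros fc_comp2[OF assms(1)])
    show "sz (if P e x then x # a else a) \<le> sz a + Suc (g (sz e))" if "x \<in> set (l e)" for e x a
      using g(2)[OF that] by simp
  qed (intro fc_intros)
  moreover have "foldr (\<lambda>x a. if P e x then x # a else a) xs [] = filter (P e) xs" for e xs by (induction xs) auto
  ultimately show ?thesis by simp
qed

lemma fc_concat [fc_intros]:
  assumes "fc B l" shows "fc B (\<lambda>e. concat (l e))"
proof -
  obtain g where g: "bd g" "\<And>e x. x \<in> set (l e) \<Longrightarrow> sz ((\<lambda>e x. x) e x) \<le> g (sz e)"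
    using bound_on_members[OF _ assms, of "\<lambda>e x. x"] fc_snd[OF fc_id] by blast
  have "fc B (\<lambda>e. foldr (@) (l e) [])"
  proof (rule fc_foldr_additive[OF _ assms _ g(1)])
    fix e x and a :: "'b list" assume "x \<in> set (l e)"
    from g(2)[OF this] show "sz (x @ a) \<le> sz a + g (sz e)" using sz_append[of x a] by simp
  qed (intro fc_intros)+
  then show ?thesis by (simp add: concat_conv_foldr)
qed

lemma fc_Not [fc_intros]:
  assumes "fc B a" shows "fc B (\<lambda>e. \<not> a e)"
proof -
  have *: "(\<not> a e) = (if a e then False else True)" for e by simp
  show ?thesis unfolding * by (rule fc_if[OF assms fc_const fc_const])
qed

lemma fc_conj [fc_intros]:
  assumes "fc B a" "fc B b" shows "fc B (\<lambda>e. a e \<and> b e)"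
proof -
  have *: "(a e \<and> b e) = (if a e then b e else False)" for e by simp
  show ?thesis unfolding * by (rule fc_if[OF assms fc_const])
qed

lemma fc_disj [fc_intros]:
  assumes "fc B a" "fc B b" shows "fc B (\<lambda>e. a e \<or> b e)"
proof -
  have *: "(a e \<or> b e) = (if a e then True else b e)" for e by simp
  show ?thesis unfolding * by (rule fc_if[OF assms(1) fc_const assms(2)])
qed

lemma fc_imp [fc_intros]:
  assumes "fc B a" "fc B b" shows "fc B (\<lambda>e. a e \<longrightarrow> b e)"
proof -
  have *: "(a e \<longrightarrow> b e) = (if a e then b e else True)" for e by simp
  show ?thesis unfolding * by (rule fc_if[OF assms fc_const])
qed

lemma fc_Bex [fc_intros]:
  assumes "fc B (\<lambda>p. P (fst p) (snd p))" "fc B l" shows "fc B (\<lambda>e. \<exists>x\<in>set (l e). P e x)"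
  using fc_Not[OF fc_eq[OF fc_filter[OF assms] fc_const[of "[]"]]] by (simp add: filter_empty_conv)

lemma fc_Ball [fc_intros]:
  assumes "fc B (\<lambda>p. P (fst p) (snd p))" "fc B l" shows "fc B (\<lambda>e. \<forall>x\<in>set (l e). P e x)"
  using fc_Not[OF fc_Bex[of "\<lambda>e x. \<not> P e x", OF fc_Not[OF assms(1)] assms(2)]] by simp

lemma fc_member [fc_intros]:
  assumes "fc B a" "fc B l" shows "fc B (\<lambda>e. a e \<in> set (l e))"
  using fc_Bex[of "\<lambda>e x. x = a e", OF fc_eq[OF fc_snd[OF fc_id] fc_comp[OF assms(1) fc_fst[OF fc_id]]] assms(2)] by simp

lemma fc_hd [fc_intros]:
  assumes "fc B l" shows "fc B (\<lambda>e. hd (l e))"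
proof -
  obtain g where g: "bd g" "\<And>e x. x \<in> set (l e) \<Longrightarrow> sz ((\<lambda>e x. x) e x) \<le> g (sz e)"
    using bound_on_members[OF _ assms, of "\<lambda>e x. x"] fc_snd[OF fc_id] by blast
  \<comment> \<open>\<open>hd []\<close> is unspecified but one fixed value, so it can be the
    constant start value.\<close>
  have "fc B (\<lambda>e. foldr (\<lambda>x a. x) (l e) (hd []))"
  proof (rule fc_foldr_additive[OF _ assms _ g(1)])
    show "sz x \<le> sz a + g (sz e)" if "x \<in> set (l e)" for e x and a :: 'b using g(2)[OF that] by simp
  qed (intro fc_intros)+
  moreover have "foldr (\<lambda>x a. x) xs (hd []) = hd xs" for xs :: "'b list" by (cases xs) auto
  ultimately show ?thesis by simp
qed

lemma runs_tree_right: "runs (\<lambda>t. tree_right t) (\<lambda>_. 2)"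
  by (rule runs_expr[of "ERight (EVar 0)"])
    (use evalb_Right[OF evalb_Var[of 0 "[_]"]] in \<open>simp add: numeral_2_eq_2 encode_tree_def\<close>)

lemma fc_tl [fc_intros]: "fc B l \<Longrightarrow> fc B (\<lambda>e. tl (l e))"
proof (erule fc_comp[rotated, where f = tl], rule fcI[OF _ _ _ bd_const[of 2] bd_id])
  show "runs (\<lambda>xs::'b list. tl xs) (\<lambda>_. 2)"
  proof (rule runs_recode[OF runs_tree_right])
    fix xs :: "'b list"
    show "\<exists>y. encode xs = encode y \<and> encode (tl xs) = encode (tree_right y) \<and> (2::nat) \<le> 2"
      by (rule exI[of _ "encode xs"], cases xs) (auto simp: encode_tree_def)
  qed
  fix xs :: "'b list" show "sz (tl xs) \<le> sz xs" by (cases xs) auto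
qed simp

text \<open>A unary number has the encoding of a list of units, so bounded iteration is a fold and
  inherits its bounds.\<close>

lemma encode_units: "encode (replicate n ()) = encode n"
  by (induction n) (auto simp: encode_unit_def)

lemma fc_units: "fc B a \<Longrightarrow> fc B (\<lambda>e. replicate (a e) ())"
  by (rule fc_recode[of _ a]) (simp_all add: encode_units)

lemma fc_funpow_bounded:
  fixes f :: "'e::encodable \<Rightarrow> 'b::encodable \<Rightarrow> 'b"
  assumes "fc B (\<lambda>p. f (fst p) (snd p))" "fc B n" "fc B i" "bd h"
    and bound: "\<And>e k. k \<le> n e \<Longrightarrow> sz ((f e ^^ k) (i e)) \<le> h (sz e)"
  shows "fc B (\<lambda>e. (f e ^^ n e) (i e))"
proof -
  have "fc B (\<lambda>e. fold (\<lambda>_. f e) (replicate (n e) ()) (i e))"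
  proof (rule fc_fold_bounded[OF _ fc_units[OF assms(2)] assms(3,4)])
    show "fc B (\<lambda>p. f (fst p) (snd (snd p)))" by (rule fc_comp2[OF assms(1)]) (intro fc_intros)+
    fix e k
    show "sz (fold (\<lambda>_. f e) (take k (replicate (n e) ())) (i e)) \<le> h (sz e)"
      using bound[of "min k (n e)" e] by (simp add: fold_replicate_funpow)
  qed
  then show ?thesis by (simp add: fold_replicate_funpow)
qed

lemma fc_funpow_additive:
  fixes f :: "'e::encodable \<Rightarrow> 'b::encodable \<Rightarrow> 'b"
  assumes "fc B (\<lambda>p. f (fst p) (snd p))" "fc B n" "fc B i" "bd g"
    and step: "\<And>e a. sz (f e a) \<le> sz a + g (sz e)"
  shows "fc B (\<lambda>e. (f e ^^ n e) (i e))"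
proof -
  have "fc B (\<lambda>e. fold (\<lambda>_. f e) (replicate (n e) ()) (i e))"
  proof (rule fc_fold_additive[OF _ fc_units[OF assms(2)] assms(3,4)])
    show "fc B (\<lambda>p. f (fst p) (snd (snd p)))" by (rule fc_comp2[OF assms(1)]) (intro fc_intros)+
  qed (rule step)
  then show ?thesis by (simp add: fold_replicate_funpow)
qed

lemma fc_Suc [fc_intros]:
  assumes "fc B a" shows "fc B (\<lambda>e. Suc (a e))"
  by (rule fc_recode[OF fc_Cons[OF fc_const[of "()"] fc_units[OF assms]]]) (simp add: encode_units encode_unit_def)

lemma fc_add [fc_intros]:
  fixes a b :: "'a::encodable \<Rightarrow> nat"
  assumes "fc B a" "fc B b" shows "fc B (\<lambda>e. a e + b e)"
proof -
  have "fc B (\<lambda>e. (Suc ^^ a e) (b e))"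
    by (rule fc_funpow_additive[OF _ assms bd_const[of 2]]) (intro fc_intros, simp)
  then show ?thesis by simp
qed

lemma fc_mult [fc_intros]:
  fixes a b :: "'a::encodable \<Rightarrow> nat"
  assumes a: "fc B a" and b: "fc B b" shows "fc B (\<lambda>e. a e * b e)"
proof -
  obtain d where d: "bd d" "\<And>x. sz (b x) \<le> d (sz x)" using b by (elim fcE) blast
  have "fc B (\<lambda>e. ((+) (b e) ^^ a e) 0)"
  proof (rule fc_funpow_additive[OF _ a _ d(1)])
    fix e :: 'a and x
    show "sz (b e + x) \<le> sz x + d (sz e)" using d(2)[of e] by simp
  qed (intro fc_intros fc_comp[OF b] | rule fc_comp[OF b])+
  moreover have "((+) y ^^ x) 0 = x * y" for x y :: nat by (induction x) auto
  ultimately show ?thesis by simp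
qed

lemma fc_pred:
  assumes "fc B a" shows "fc B (\<lambda>e. a e - (1::nat))"
  by (rule fc_recode[OF fc_tl[OF fc_units[OF assms]]]) (simp add: encode_units[symmetric])

lemma fc_diff [fc_intros]:
  fixes a b :: "'a::encodable \<Rightarrow> nat"
  assumes "fc B a" "fc B b" shows "fc B (\<lambda>e. a e - b e)"
proof -
  have "fc B (\<lambda>e. ((\<lambda>x. x - 1) ^^ b e) (a e))"
    by (rule fc_funpow_additive[OF _ assms(2,1) bd_const[of 0]]) (rule fc_pred, intro fc_intros, simp)
  moreover have "((\<lambda>x. x - 1) ^^ y) x = x - y" for x y :: nat by (induction y) auto
  ultimately show ?thesis by simp
qed

lemma fc_le [fc_intros]:
  fixes a b :: "'a::encodable \<Rightarrow> nat"
  assumes "fc B a" "fc B b" shows "fc B (\<lambda>e. a e \<le> b e)"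
  using fc_eq[OF fc_diff[OF assms] fc_const[of 0]] by simp

lemma fc_less [fc_intros]:
  fixes a b :: "'a::encodable \<Rightarrow> nat"
  assumes "fc B a" "fc B b" shows "fc B (\<lambda>e. a e < b e)"
  using fc_Not[OF fc_le[OF assms(2,1)]] by (simp add: not_le)

lemma fc_min [fc_intros]:
  fixes a b :: "'a::encodable \<Rightarrow> nat"
  assumes "fc B a" "fc B b" shows "fc B (\<lambda>e. min (a e) (b e))"
  unfolding min_def by (intro fc_intros assms)

lemma fc_length [fc_intros]: "fc B l \<Longrightarrow> fc B (\<lambda>e. length (l e))"
proof -
  assume l: "fc B l"
  have "fc B (\<lambda>e. fold (\<lambda>_. Suc) (l e) 0)"
    by (rule fc_fold_additive[OF _ l _ bd_const[of 2]]) ((intro fc_intros)+, simp)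
  moreover have "fold (\<lambda>_. Suc) xs n = length xs + n" for xs :: "'b list" and n
    by (induction xs arbitrary: n) auto
  ultimately show ?thesis by simp
qed

lemma fc_sum_list [fc_intros]: "fc B l \<Longrightarrow> fc B (\<lambda>e. sum_list (l e))" for l :: "_ \<Rightarrow> nat list"
proof -
  assume l: "fc B l"
  obtain g where g: "bd g" "\<And>e x. x \<in> set (l e) \<Longrightarrow> sz ((\<lambda>e x. x) e x) \<le> g (sz e)"
    using bound_on_members[OF _ l, of "\<lambda>e x. x"] fc_snd[OF fc_id] by blast
  have "fc B (\<lambda>e. foldr (+) (l e) 0)"
  proof (rule fc_foldr_additive[OF _ l _ g(1)])
    show "sz (x + a) \<le> sz a + g (sz e)" if "x \<in> set (l e)" for e x a using g(2)[OF that] by simp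
  qed (intro fc_intros)+
  then show ?thesis by (simp add: sum_list.eq_foldr)
qed

lemma fc_drop [fc_intros]: "fc B a \<Longrightarrow> fc B l \<Longrightarrow> fc B (\<lambda>e. drop (a e) (l e))"
proof -
  assume a: "fc B a" and l: "fc B l"
  have *: "sz (tl xs) \<le> sz xs" for xs :: "'b list" by (cases xs) auto
  have "fc B (\<lambda>e. (tl ^^ a e) (l e))"
    by (rule fc_funpow_additive[OF _ a l bd_const[of 0]]) ((intro fc_intros)+, simp add: *)
  moreover have "(tl ^^ n) xs = drop n xs" for n and xs :: "'b list"
    by (induction n) (auto simp: drop_Suc drop_tl)
  ultimately show ?thesis by simp
qed

lemma fc_take [fc_intros]: "fc B a \<Longrightarrow> fc B l \<Longrightarrow> fc B (\<lambda>e. take (a e) (l e))"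
proof -
  assume a: "fc B a" and l: "fc B l"
  have "fc B (\<lambda>e. rev (drop (length (l e) - a e) (rev (l e))))" by (intro fc_intros a l)
  moreover have "rev (drop (length xs - n) (rev xs)) = take n xs" for n and xs :: "'b list"
    by (cases "n \<le> length xs") (simp_all add: rev_drop)
  ultimately show ?thesis by simp
qed

lemma fc_upt [fc_intros]: "fc B a \<Longrightarrow> fc B (\<lambda>e. [0..<a e])"
proof -
  assume a: "fc B a"
  obtain d where d: "bd d" "\<And>x. sz (a x) \<le> d (sz x)" using a by (elim fcE) blast
  have eq: "((\<lambda>xs. xs @ [length xs]) ^^ n) [] = [0..<n]" for n by (induction n) auto
  have sz: "sz [0..<k] \<le> k * (2 * k + 2) + 1" for k
  proof (induction k)
    case (Suc k) then show ?case using sz_append[of "[0..<k]" "[k]"] by simp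
  qed simp
  have "fc B (\<lambda>e. ((\<lambda>xs. xs @ [length xs]) ^^ a e) [])"
  proof (rule fc_funpow_bounded[OF _ a])
    show "bd (\<lambda>s. d s * (2 * d s + 2) + 1)" by (intro bd_intros d)
    fix e :: 'a and k assume "k \<le> a e"
    then have "k \<le> d (sz e)" using d(2)[of e] by simp
    then have "k * (2 * k + 2) + 1 \<le> d (sz e) * (2 * d (sz e) + 2) + 1" by (intro add_mono mult_le_mono) auto
    then show "sz (((\<lambda>xs. xs @ [length xs]) ^^ k) []) \<le> d (sz e) * (2 * d (sz e) + 2) + 1"
      unfolding eq using sz[of k] by linarith
  qed (intro fc_intros)+
  then show ?thesis by (simp add: eq)
qed

lemma fc_zip [fc_intros]: "fc B l \<Longrightarrow> fc B m \<Longrightarrow> fc B (\<lambda>e. zip (l e) (m e))"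
proof -
  assume l: "fc B l" and m: "fc B m"
  have "zip xs ys = map (\<lambda>i. (hd (drop i xs), hd (drop i ys))) [0..<min (length xs) (length ys)]"
    for xs :: "'b list" and ys :: "'c list"
    by (rule nth_equalityI) (auto simp: hd_drop_conv_nth)
  then show ?thesis by (simp only:) (intro fc_intros fc_comp[OF l] fc_comp[OF m] l m)
qed

lemma fc_remdups [fc_intros]:
  assumes "fc B l" shows "fc B (\<lambda>e. remdups (l e))"
proof -
  obtain g where g: "bd g" "\<And>e x. x \<in> set (l e) \<Longrightarrow> sz ((\<lambda>e x. x) e x) \<le> g (sz e)"
    using bound_on_members[OF _ assms, of "\<lambda>e x. x"] fc_snd[OF fc_id] by blast
  have "fc B (\<lambda>e. foldr (\<lambda>x a. if x \<in> set a then a else x # a) (l e) [])"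
  proof (rule fc_foldr_additive[OF _ assms _ bd_Suc[OF g(1)]])
    show "sz (if x \<in> set a then a else x # a) \<le> sz a + Suc (g (sz e))" if "x \<in> set (l e)" for e x a
      using g(2)[OF that] by simp
  qed (intro fc_intros)+
  moreover have "foldr (\<lambda>x a. if x \<in> set a then a else x # a) xs [] = remdups xs" for xs :: "'b list"
  proof (induction xs)
    case (Cons x xs) then show ?case by simp
  qed simp
  ultimately show ?thesis by simp
qed

lemma fc_replicate [fc_intros]:
  assumes "fc B n" "fc B a" shows "fc B (\<lambda>e. replicate (n e) (a e))"
  using fc_map[of "\<lambda>e _. a e", OF fc_comp[OF assms(2) fc_fst[OF fc_id]] fc_upt[OF assms(1)]]
  by (simp add: map_replicate_const)

lemma fc_list_update [fc_intros]:
  "fc B l \<Longrightarrow> fc B n \<Longrightarrow> fc B a \<Longrightarrow> fc B (\<lambda>e. (l e)[n e := a e])"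
proof -
  assume *: "fc B l" "fc B n" "fc B a"
  have "xs[i := x] = (if i < length xs then take i xs @ x # drop (Suc i) xs else xs)" for xs :: "'b list" and i x
    by (auto simp: upd_conv_take_nth_drop list_update_beyond)
  then show ?thesis by (simp only:) (intro fc_intros *)
qed

lemma fc_tree_left [fc_intros]: "fc B a \<Longrightarrow> fc B (\<lambda>e. tree_left (a e))"
proof (erule fc_comp[rotated, where f = tree_left], rule fcI[OF _ _ _ bd_const[of 2] bd_id])
  show "runs tree_left (\<lambda>_. 2)"
    by (rule runs_expr[of "ELeft (EVar 0)"])
      (use evalb_Left[OF evalb_Var[of 0 "[_]"]] in \<open>simp add: numeral_2_eq_2 encode_tree_def\<close>)
  fix t :: tree show "sz (tree_left t) \<le> sz t" by (cases t) (auto simp: encode_tree_def)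
qed simp

lemma fc_tree_right [fc_intros]: "fc B a \<Longrightarrow> fc B (\<lambda>e. tree_right (a e))"
proof (erule fc_comp[rotated, where f = tree_right], rule fcI[OF runs_tree_right _ _ bd_const[of 2] bd_id])
  fix t :: tree show "sz (tree_right t) \<le> sz t" by (cases t) (auto simp: encode_tree_def)
qed simp

lemma fc_Node [fc_intros]:
  assumes "fc B a" "fc B b" shows "fc B (\<lambda>e. Node (a e) (b e))"
  by (rule fc_recode[OF fc_pair[OF assms]]) (simp add: encode_tree_def)

lemma fc_tree_foldr_bounded:
  assumes g: "fc B (\<lambda>p. g (fst (fst p)) (snd (fst p)) (fst (snd p)) (snd (snd p)))" and h: "bd h"
    and bound: "\<And>t. sz (tree_foldr z g t) \<le> h (tree_size t)"
  shows "fc B (\<lambda>t. tree_foldr z g t)"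
proof -
  obtain b where b: "bd b" "runs (\<lambda>p. g (fst (fst p)) (snd (fst p)) (fst (snd p)) (snd (snd p))) (\<lambda>x. b (sz x))"
     "\<And>m n. m \<le> n \<Longrightarrow> b m \<le> b n"
    using g by (elim fcE) blast
  \<comment> \<open>Members of the class are monotone, \<open>h\<close> need not be. With
    \<open>c\<close>, the bound at the size of the whole tree also covers all subtrees.\<close>
  obtain c where c: "c \<in> B" "\<And>n. h n \<le> c n" using h by (auto simp: bd_def)
  let ?\<tau> = "\<lambda>a b'. b (sz ((a, b'), (tree_foldr z g a, tree_foldr z g b')))"
  have *: "tree_foldr_time ?\<tau> (sz z + 2) t \<le> tree_size t * (b (Suc (n + 1 + Suc (c n + c n))) + sz z + 20)"
    if "tree_size t \<le> n" for t n
    using that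
  proof (induction t)
    case (Node x y)
    have "c (tree_size x) \<le> c n" "c (tree_size y) \<le> c n" using Node.prems mono[OF c(1)] by auto
    then have "sz (tree_foldr z g x) \<le> c n" "sz (tree_foldr z g y) \<le> c n"
      using bound[of x] bound[of y] c(2)[of "tree_size x"] c(2)[of "tree_size y"] by linarith+
    then have "?\<tau> x y \<le> b (Suc (n + 1 + Suc (c n + c n)))"
      using Node.prems by (intro b(3)) (simp add: encode_tree_def)
    then show ?case using Node by (simp add: algebra_simps)
  qed simp
  show ?thesis
  proof (rule fcI[OF runs_tree_foldr[OF b(2)] _ _ _ h])
    show "bd (\<lambda>n. n * (b (Suc (n + 1 + Suc (c n + c n))) + sz z + 20))"
      by (intro bd_intros bd_comp[OF b(1)] bd_mem[OF c(1)])
  qed (use * bound in \<open>auto simp: encode_tree_def\<close>)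
qed

lemma fc_bin_inc [fc_intros]: "fc B a \<Longrightarrow> fc B (\<lambda>e. bin_inc (a e))"
proof (erule fc_comp[rotated, where f = bin_inc], unfold bin_inc_def, rule fc_tree_foldr_bounded)
  show "bd (\<lambda>n. n + 4)" by (intro bd_intros)
  fix t
  have "tree_size (tree_foldr (Node (Node Leaf Leaf) Leaf)
     (\<lambda>a b ra rb. if a = Leaf then Node (Node Leaf Leaf) b else Node Leaf rb) t) \<le> tree_size t + 4"
  proof (induction t)
    case (Node a b) then show ?case using tree_size_pos[of a] by (simp del: tree_size_pos tree_size_neq)
  qed simp
  then show "sz (tree_foldr (Node (Node Leaf Leaf) Leaf)
     (\<lambda>a b ra rb. if a = Leaf then Node (Node Leaf Leaf) b else Node Leaf rb) t) \<le> tree_size t + 4"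
    by (simp add: encode_tree_def)
qed (intro fc_intros)

end

lemma enc_nat_0: "enc_nat 0 = Leaf"
  by (subst enc_nat.simps) simp

lemma bin_inc_enc_nat: "bin_inc (enc_nat n) = enc_nat (Suc n)"
proof (induction n rule: less_induct)
  case (less n)
  show ?case
  proof (cases "n = 0")
    case True then show ?thesis by (simp add: bin_inc_def enc_nat.simps)
  next
    case False
    have n: "enc_nat n = Node (if odd n then Node Leaf Leaf else Leaf) (enc_nat (n div 2))"
      using False enc_nat.simps[of n] by simp
    have S: "enc_nat (Suc n) = Node (if even n then Node Leaf Leaf else Leaf) (enc_nat (Suc n div 2))"
      using enc_nat.simps[of "Suc n"] by simp
    have "bin_inc (enc_nat (n div 2)) = enc_nat (Suc (n div 2))" using less[of "n div 2"] False by simp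
    then show ?thesis unfolding n S by (auto simp: bin_inc_def)
  qed
qed

section \<open>The polynomial and the fast-growing bounds\<close>

definition polys :: "(nat \<Rightarrow> nat) set" where
  "polys = {\<lambda>n. (n + 2) ^ c |c. 1 \<le> c}"

text \<open>Level 0 squares, so it dominates products of a value with itself. The
  \<open>n + 2\<close> iterations let level \<open>Suc m\<close> absorb two nested calls of level
  \<open>m\<close> (\<open>grow_grow\<close>) and any number of iterations up to the argument
  (\<open>grow_funpow_le\<close>).\<close>

fun grow :: "nat \<Rightarrow> nat \<Rightarrow> nat" where
  "grow 0 n = (n + 2) ^ 2"
| "grow (Suc m) n = (grow m ^^ (n + 2)) n"

definition fast :: "(nat \<Rightarrow> nat) set" where
  "fast = range grow"

interpretation pt: resource polys
proof
  \<comment> \<open>One more factor \<open>n + 2\<close> absorbs a factor 2, and thereby sums; the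
    base \<open>n\<close> would fail for small arguments.\<close>
  have double: "(n + 2) ^ c + (n + 2) ^ c \<le> (n + 2) ^ Suc c" for n c :: nat by simp
  fix b c assume "b \<in> polys" "c \<in> polys"
  then obtain i j where i: "b = (\<lambda>n. (n + 2) ^ i)" "1 \<le> i" and j: "c = (\<lambda>n. (n + 2) ^ j)" "1 \<le> j" by (auto simp: polys_def)
  show "b m \<le> b n" if "m \<le> n" for m n using that by (simp add: i power_mono)
  have "b (c n) \<le> (n + 2) ^ (Suc j * i)" for n
  proof -
    have "2 ^ 1 \<le> (2::nat) ^ j" using j(2) by (intro power_increasing) auto
    also have "\<dots> \<le> (n + 2) ^ j" by (intro power_mono) auto
    finally have "(n + 2) ^ j + 2 \<le> (n + 2) ^ Suc j" using double[of n j] unfolding power_one_right by linarith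
    then have "b (c n) \<le> ((n + 2) ^ Suc j) ^ i" unfolding i j by (intro power_mono) auto
    then show ?thesis by (simp only: power_mult)
  qed
  moreover have "(\<lambda>n. (n + 2) ^ (Suc j * i)) \<in> polys" using i(2) by (auto simp: polys_def intro!: exI[of _ "Suc j * i"])
  ultimately show "\<exists>d\<in>polys. \<forall>n. b (c n) \<le> d n" by (intro bexI[of _ "\<lambda>n. (n + 2) ^ (Suc j * i)"]) blast+
  have "b n * c n \<le> (n + 2) ^ (i + j)" for n by (simp add: i j power_add)
  moreover have ij: "(\<lambda>n. (n + 2) ^ (i + j)) \<in> polys" using i(2) by (auto simp: polys_def intro!: exI[of _ "i + j"])
  ultimately show "\<exists>d\<in>polys. \<forall>n. b n * c n \<le> d n" by (intro bexI[of _ "\<lambda>n. (n + 2) ^ (i + j)"]) blast+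
  have "b n + c n \<le> (n + 2) ^ Suc (i + j)" for n
  proof -
    have "(n + 2) ^ i \<le> (n + 2) ^ (i + j)" "(n + 2) ^ j \<le> (n + 2) ^ (i + j)" by (intro power_increasing; simp)+
    then show ?thesis using double[of n "i + j"] unfolding i j by linarith
  qed
  moreover have "(\<lambda>n. (n + 2) ^ Suc (i + j)) \<in> polys" by (auto simp only: polys_def intro!: exI[of _ "Suc (i + j)"])
  ultimately show "\<exists>d\<in>polys. \<forall>n. b n + c n \<le> d n" by (intro bexI[of _ "\<lambda>n. (n + 2) ^ Suc (i + j)"]) blast+
next
  fix k :: nat
  have "k \<le> (n + 2) ^ Suc k" for n
  proof -
    have "k < 2 ^ k" by (rule less_exp)
    also have "\<dots> \<le> (2::nat) ^ Suc k" by simp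
    also have "\<dots> \<le> (n + 2) ^ Suc k" by (intro power_mono) auto
    finally show ?thesis by simp
  qed
  moreover have "(\<lambda>n. (n + 2) ^ Suc k) \<in> polys" by (auto simp only: polys_def intro!: exI[of _ "Suc k"])
  ultimately show "\<exists>d\<in>polys. \<forall>n. k \<le> d n" by (intro bexI[of _ "\<lambda>n. (n + 2) ^ Suc k"]) blast+
  have "n \<le> (n + 2) ^ 1" for n :: nat by simp
  moreover have "(\<lambda>n. (n + 2) ^ 1) \<in> polys" by (auto simp only: polys_def)
  ultimately show "\<exists>d\<in>polys. \<forall>n. n \<le> d n" by (intro bexI[of _ "\<lambda>n. (n + 2) ^ 1"]) blast+
qed

lemma funpow_le_funpow:
  fixes f :: "nat \<Rightarrow> nat"
  assumes "\<And>x y. x \<le> y \<Longrightarrow> f x \<le> f y" "\<And>x. x \<le> f x" "i \<le> j" "x \<le> y"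
  shows "(f ^^ i) x \<le> (f ^^ j) y"
proof -
  have 1: "(f ^^ i) x \<le> (f ^^ i) y" by (induction i) (auto intro: assms)
  have "(f ^^ i) y \<le> (f ^^ (i + k)) y" for k by (induction k) (auto intro: le_trans assms(2))
  from this[of "j - i"] 1 assms(3) show ?thesis by simp
qed

lemma grow_props: "n + 2 \<le> grow m n \<and> (\<forall>n'. n \<le> n' \<longrightarrow> grow m n \<le> grow m n')"
proof (induction m arbitrary: n)
  case 0
  have "n + 2 \<le> (n + 2) ^ 2" by (simp add: power2_eq_square)
  then show ?case by (auto intro: power_mono)
next
  case (Suc m)
  have f: "\<And>x y. x \<le> y \<Longrightarrow> grow m x \<le> grow m y" "\<And>x. x \<le> grow m x" "\<And>x. x + 2 \<le> grow m x"
    using Suc.IH by (blast intro: add_leD1)+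
  have "(grow m ^^ 0) n \<le> (grow m ^^ (n + 1)) n" by (rule funpow_le_funpow[OF f(1,2)]) auto
  then have "n + 2 \<le> grow (Suc m) n" using f(3)[of "(grow m ^^ (n + 1)) n"] by simp
  moreover have "grow (Suc m) n \<le> grow (Suc m) n'" if "n \<le> n'" for n'
    unfolding grow.simps by (rule funpow_le_funpow[OF f(1,2)]) (use that in auto)
  ultimately show ?case by blast
qed

lemma grow_ge: "n + 2 \<le> grow m n" and grow_mono: "n \<le> n' \<Longrightarrow> grow m n \<le> grow m n'"
  using grow_props by blast+

lemma grow_le: "n \<le> grow m n"
  using grow_ge[of n m] by linarith

lemma grow_grow: "grow m (grow m n) \<le> grow (Suc m) n"
  using funpow_le_funpow[of "grow m" 2 "n + 2" n n] grow_mono grow_le by (simp add: numeral_2_eq_2)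

lemma grow_mono_level: "m \<le> m' \<Longrightarrow> grow m n \<le> grow m' n"
proof (induction rule: dec_induct)
  case (step k) then show ?case using grow_grow[of k n] grow_le[of "grow k n" k] by linarith
qed simp

lemma le_grow_level: "m \<le> grow m n"
proof (induction m)
  case (Suc m) then show ?case using grow_grow[of m n] grow_ge[of "grow m n" m] by linarith
qed simp

text \<open>Each iteration of level 0 at least doubles, so level 1 dominates the
  exponential.\<close>

lemma pow2_le_grow: "2 ^ n \<le> grow 1 n"
proof -
  have "2 ^ k \<le> (grow 0 ^^ k) n + 1" for k
    by (induction k) (auto simp: power2_eq_square)
  from this[of "n + 2"] have "2 ^ (n + 2) \<le> grow 1 n + 1" by simp
  moreover have "(1::nat) \<le> 2 ^ n" "(2::nat) ^ (n + 2) = 4 * 2 ^ n" by simp_all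
  ultimately show ?thesis by linarith
qed

declare grow.simps [simp del]

interpretation cf: resource fast
proof
  fix b c assume "b \<in> fast" "c \<in> fast"
  then obtain i j where b: "b = grow i" and c: "c = grow j" by (auto simp: fast_def)
  let ?m = "i + j"
  have le: "b n \<le> grow ?m n" "c n \<le> grow ?m n" for n unfolding b c by (auto intro: grow_mono_level)
  show "b m \<le> b n" if "m \<le> n" for m n using that by (simp add: b grow_mono)
  have "b (c n) \<le> grow (Suc ?m) n" for n
    using le(1)[of "c n"] grow_mono[OF le(2)[of n], of ?m] grow_grow[of ?m n] by linarith
  then show "\<exists>d\<in>fast. \<forall>n. b (c n) \<le> d n" by (auto simp: fast_def)
  have sq: "grow ?m n * grow ?m n \<le> grow (Suc ?m) n" for n
  proof -
    have "grow ?m n * grow ?m n \<le> grow 0 (grow ?m n)" by (simp add: grow.simps power2_eq_square)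
    also have "\<dots> \<le> grow ?m (grow ?m n)" by (rule grow_mono_level) simp
    finally show ?thesis using grow_grow[of ?m n] by linarith
  qed
  have "b n * c n \<le> grow (Suc ?m) n" for n using mult_le_mono[OF le(1) le(2), of n n] sq[of n] by linarith
  then show "\<exists>d\<in>fast. \<forall>n. b n * c n \<le> d n" by (auto simp: fast_def)
  have "b n + c n \<le> grow (Suc ?m) n" for n
  proof -
    have "2 * grow ?m n \<le> grow ?m n * grow ?m n" using grow_ge[of n ?m] by (intro mult_le_mono1) linarith
    then show ?thesis using le[of n] sq[of n] by linarith
  qed
  then show "\<exists>d\<in>fast. \<forall>n. b n + c n \<le> d n" by (auto simp: fast_def)
next
  show "\<exists>d\<in>fast. \<forall>n. k \<le> d n" for k using le_grow_level by (auto simp: fast_def)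
  show "\<exists>d\<in>fast. \<forall>n. n \<le> d n" using grow_le by (auto simp: fast_def)
qed

lemma grow_funpow_le: "k \<le> n + 2 \<Longrightarrow> (grow m ^^ k) n \<le> grow (Suc m) n"
  unfolding grow.simps by (rule funpow_le_funpow) (auto intro: grow_mono grow_le)

text \<open>Iterating one level of the hierarchy stays below the next level, so folds need no size bound here.\<close>

lemma cf_fold [fc_intros]:
  assumes "fc fast (\<lambda>p. f (fst p) (fst (snd p)) (snd (snd p)))" "fc fast l" "fc fast i"
  shows "fc fast (\<lambda>e. fold (f e) (l e) (i e))"
proof -
  obtain b where b: "b \<in> fast" "cf.bd b" "\<And>p. sz (f (fst p) (fst (snd p)) (snd (snd p))) \<le> b (sz p)"
     "\<And>m n. m \<le> n \<Longrightarrow> b m \<le> b n"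
    using assms(1) by (elim cf.fcE) blast
  obtain d where d: "cf.bd d" "\<And>x. sz (l x) \<le> d (sz x)" using assms(2) by (elim cf.fcE) blast
  obtain c where c: "cf.bd c" "\<And>x. sz (i x) \<le> c (sz x)" using assms(3) by (elim cf.fcE) blast
  obtain m where m: "\<And>n. b n + n \<le> grow m n"
    using cf.bd_add[OF b(2) cf.bd_id] unfolding cf.bd_def by (auto simp: fast_def)
  \<comment> \<open>\<open>y\<close> covers environment, list and start value at once. With
    \<open>sz e + sz (l e) + 2\<close> added on the left, the invariant bounds the size of the
    triple passed to \<open>f\<close>, so an iteration costs one application of
    \<open>grow m\<close>.\<close>
  define y where "y s = s + d s + c s + 2" for s
  have *: "sz (fold (f e) (take k (l e)) (i e)) + sz e + sz (l e) + 2 \<le> (grow m ^^ k) (y (sz e))"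
    if "k \<le> length (l e)" for e k
    using that
  proof (induction k)
    case 0 then show ?case using c(2)[of e] d(2)[of e] by (simp add: y_def)
  next
    case (Suc k)
    let ?a = "fold (f e) (take k (l e)) (i e)" and ?z = "(grow m ^^ k) (y (sz e))"
    have a: "fold (f e) (take (Suc k) (l e)) (i e) = f e (l e ! k) ?a"
      using Suc.prems by (simp add: take_Suc_conv_app_nth)
    have "sz (l e ! k) < sz (l e)" using Suc.prems by (intro sz_member) simp
    then have "sz (e, l e ! k, ?a) \<le> ?z" using Suc by simp
    from b(4)[OF this] have "sz (f e (l e ! k) ?a) \<le> b ?z" using b(3)[of "(e, l e ! k, ?a)"] by simp
    then show ?case using Suc m[of ?z] a by simp
  qed
  show ?thesis
  proof (rule cf.fc_fold_bounded[OF assms])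
    have "cf.bd (\<lambda>n. grow (Suc m) n)" by (rule cf.bd_mem) (simp add: fast_def)
    moreover have "cf.bd y" unfolding y_def by (intro cf.bd_intros c d)
    ultimately show "cf.bd (\<lambda>s. grow (Suc m) (y s))" by (rule cf.bd_comp)
    fix e k
    let ?k = "min k (length (l e))"
    have "?k \<le> y (sz e) + 2" using length_less_sz[of "l e"] d(2)[of e] by (simp add: y_def)
    then have "(grow m ^^ ?k) (y (sz e)) \<le> grow (Suc m) (y (sz e))" by (rule grow_funpow_le)
    moreover have "take ?k (l e) = take k (l e)" by (simp add: min_def)
    ultimately show "sz (fold (f e) (take k (l e)) (i e)) \<le> grow (Suc m) (y (sz e))"
      using *[of ?k e] by simp
  qed
qed

lemma cf_foldr [fc_intros]:
  assumes "fc fast (\<lambda>p. f (fst p) (fst (snd p)) (snd (snd p)))" "fc fast l" "fc fast i"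
  shows "fc fast (\<lambda>e. foldr (f e) (l e) (i e))"
  using cf_fold[OF assms(1) cf.fc_rev[OF assms(2)] assms(3)] by (simp add: foldr_conv_fold)

lemma cf_funpow [fc_intros]:
  fixes f :: "'e::encodable \<Rightarrow> 'b::encodable \<Rightarrow> 'b"
  assumes "fc fast (\<lambda>p. f (fst p) (snd p))" "fc fast n" "fc fast i"
  shows "fc fast (\<lambda>e. (f e ^^ n e) (i e))"
proof -
  have "fc fast (\<lambda>e. fold (\<lambda>_. f e) (replicate (n e) ()) (i e))"
    by (rule cf_fold[OF _ cf.fc_units[OF assms(2)] assms(3)], rule cf.fc_comp2[OF assms(1)]) (intro fc_intros)+
  then show ?thesis by (simp add: fold_replicate_funpow)
qed

lemma cf_power [fc_intros]:
  fixes a b :: "'e::encodable \<Rightarrow> nat"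
  assumes "fc fast a" "fc fast b"
  shows "fc fast (\<lambda>e. a e ^ b e)"
proof -
  have "(((*) x) ^^ n) 1 = x ^ n" for x n :: nat by (induction n) auto
  then show ?thesis
    using cf_funpow[of "\<lambda>e. (*) (a e)", OF cf.fc_mult[OF cf.fc_comp[OF assms(1) cf.fc_fst[OF cf.fc_id]] cf.fc_snd[OF cf.fc_id]]
      assms(2) cf.fc_const[of 1]] by simp
qed

lemma cf_product_lists [fc_intros]:
  assumes "fc fast l" shows "fc fast (\<lambda>e. product_lists (l e))"
proof -
  have *: "product_lists xss = foldr (\<lambda>xs acc. concat (map (\<lambda>x. map (Cons x) acc) xs)) xss [[]]" for xss :: "'b list list"
    by (induction xss) auto
  show ?thesis unfolding * by (intro fc_intros assms)
qed

lemma cf_subseqs [fc_intros]: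
  assumes "fc fast l" shows "fc fast (\<lambda>e. subseqs (l e))"
proof -
  have *: "subseqs xs = foldr (\<lambda>x acc. map (Cons x) acc @ acc) xs [[]]" for xs :: "'b list"
    by (induction xs) (auto simp: Let_def)
  show ?thesis unfolding * by (intro fc_intros assms)
qed

text \<open>The bounds belong to their own class. Through \<open>computable_grow\<close> they can be
  the factor that depends on the parameter.\<close>

lemma cf_grow: "fc fast (\<lambda>n. grow m n)"
proof (induction m)
  case 0
  show ?case unfolding grow.simps power2_eq_square by (intro fc_intros)
next
  case (Suc m)
  show ?case unfolding grow.simps
    by (rule cf_funpow[OF cf.fc_comp[OF Suc cf.fc_snd[OF cf.fc_id]]]) (intro fc_intros)+
qed

section \<open>Computability of the fast-growing bounds\<close>

lemma runs_in_timeI: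
  assumes "prog P f \<tau>" "\<tau> x + 2 + sz (f x) \<le> T"
  shows "runs_in_time P (encode x) (encode (f x)) T"
proof -
  obtain t where t: "t \<le> \<tau> x" "eval P [encode x] (P ! 0) (encode (f x)) t" and P: "0 < length P"
    using assms(1) by (auto simp: prog_def evalb_def)
  have "evals P [encode x] [EVar 0] [encode x] (1 + 0)"
    using eval_Var[of 0 "[encode x]" P] by (intro evals_Cons evals_Nil) simp
  from eval_Call[OF P this t(2)] show ?thesis
    \<comment> \<open>The entry call and its variable account for the 2 extra steps.\<close>
    unfolding runs_in_time_def using t(1) assms(2) by (intro exI[of _ "Suc (1 + 0 + t)"]) auto
qed

text \<open>Binary to unary: \<open>computable\<close> speaks of binary numerals, while iterations
  are counted in unary. The value is exponential in the size of the numeral, which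
  \<open>fast\<close> absorbs.\<close>

definition bin_val :: "tree \<Rightarrow> nat" where
  "bin_val t = tree_foldr 0 (\<lambda>a b ra rb. (if a = Leaf then 0 else 1) + (rb + rb)) t"

lemma bin_val_enc_nat: "bin_val (enc_nat n) = n"
proof (induction n rule: less_induct)
  case (less n)
  show ?case
  proof (cases "n = 0")
    case True then show ?thesis by (simp add: bin_val_def enc_nat.simps)
  next
    case False
    have n: "enc_nat n = Node (if odd n then Node Leaf Leaf else Leaf) (enc_nat (n div 2))"
      using False enc_nat.simps[of n] by simp
    have "bin_val (enc_nat (n div 2)) = n div 2" using less[of "n div 2"] False by simp
    then show ?thesis unfolding n by (auto simp: bin_val_def) presburger
  qed
qed

lemma cf_bin_val: "fc fast bin_val"
  unfolding bin_val_def
proof (rule cf.fc_tree_foldr_bounded)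
  show "cf.bd (\<lambda>n. 2 * grow 1 n + 1)"
    by (intro cf.bd_intros cf.bd_mem) (auto simp: fast_def)
  fix t
  have *: "tree_foldr (0::nat) (\<lambda>a b ra rb. (if a = Leaf then 0 else 1) + (rb + rb)) t + 1 \<le> 2 ^ tree_size t" for t
  proof (induction t)
    case (Node a b)
    have "2 * 2 ^ tree_size b \<le> (2::nat) ^ tree_size (Node a b)" by (simp add: power_add)
    moreover have "tree_foldr (0::nat) (\<lambda>a b ra rb. (if a = Leaf then 0 else 1) + (rb + rb)) (Node a b) + 1 \<le> 2 * 2 ^ tree_size b"
      using Node.IH(2) by (cases "a = Leaf") simp_all
    ultimately show ?case by linarith
  qed simp
  show "sz (tree_foldr (0::nat) (\<lambda>a b ra rb. (if a = Leaf then 0 else 1) + (rb + rb)) t) \<le> 2 * grow 1 (tree_size t) + 1"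
    using *[of t] pow2_le_grow[of "tree_size t"] unfolding sz_nat by linarith
qed (intro fc_intros)

lemma computable_grow: "computable (grow m)"
proof -
  have "fc fast (\<lambda>t. (bin_inc ^^ grow m (bin_val t)) Leaf)"
    by (intro cf_funpow cf.fc_comp[OF cf_grow cf_bin_val] fc_intros)
  then obtain P \<tau> where P: "prog P (\<lambda>t. (bin_inc ^^ grow m (bin_val t)) Leaf) \<tau>" by (auto simp: fc_def runs_def)
  have inc: "(bin_inc ^^ n) Leaf = enc_nat n" for n
    by (induction n) (simp_all add: bin_inc_enc_nat enc_nat_0)
  show ?thesis unfolding computable_def
  proof (intro exI allI)
    fix k
    show "runs_in_time P (enc_nat k) (enc_nat (grow m k))
       (\<tau> (enc_nat k) + 2 + sz ((bin_inc ^^ grow m (bin_val (enc_nat k))) Leaf))"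
      using runs_in_timeI[OF P order_refl, of "enc_nat k"] by (simp add: inc bin_val_enc_nat encode_tree_def)
  qed
qed


section \<open>Circulations\<close>

text \<open>Read \<open>U\<close> as the edges of a loopless multigraph in which each end of an edge
  meets a second edge. Such a graph has a cycle, and the signed indicator of a cycle is a
  circulation. A longest path supplies the cycle: a further edge at its last node must lead back to
  the path.\<close>

lemma ex_circulation:
  fixes src tgt :: "'e \<Rightarrow> 'n"
  assumes fin: "finite U" and ne: "U \<noteq> {}" and loop: "\<And>e. e \<in> U \<Longrightarrow> src e \<noteq> tgt e"
    and deg: "\<And>e v. e \<in> U \<Longrightarrow> v \<in> {src e, tgt e} \<Longrightarrow> \<exists>e'\<in>U. e' \<noteq> e \<and> v \<in> {src e', tgt e'}"
  shows "\<exists>d :: 'e \<Rightarrow> int. (\<exists>e\<in>U. d e \<noteq> 0) \<and> (\<forall>e. e \<notin> U \<longrightarrow> d e = 0) \<and> (\<forall>e. \<bar>d e\<bar> \<le> 1) \<and>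
    (\<forall>v. (\<Sum>e | e \<in> U \<and> src e = v. d e) = (\<Sum>e | e \<in> U \<and> tgt e = v. d e))"
proof -
  define joins where "joins e u w \<longleftrightarrow> src e = u \<and> tgt e = w \<or> src e = w \<and> tgt e = u" for e u w
  define path where "path n P A \<longleftrightarrow> inj_on P {..n} \<and> (\<forall>k<n. A k \<in> U \<and> joins (A k) (P k) (P (Suc k)))" for n and P :: "nat \<Rightarrow> 'n" and A
  let ?V = "src ` U \<union> tgt ` U"
  obtain e0 where e0: "e0 \<in> U" using ne by blast
  have path1: "path 1 (\<lambda>k. if k = 0 then src e0 else tgt e0) (\<lambda>_. e0)"
    using e0 loop[OF e0] by (auto simp: path_def joins_def inj_on_def)
  have bound: "n \<le> card ?V" if "path n P A" for n P A
  proof (cases n)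
    case (Suc m)
    have "P k \<in> ?V" if k: "k \<le> n" for k
    proof (cases k)
      case 0
      have "A 0 \<in> U" "joins (A 0) (P 0) (P (Suc 0))" using \<open>path n P A\<close> Suc by (auto simp: path_def)
      then have "P k = src (A 0) \<or> P k = tgt (A 0)" "A 0 \<in> U" using 0 unfolding joins_def by auto
      then show ?thesis by blast
    next
      case (Suc k')
      then have "A k' \<in> U" "joins (A k') (P k') (P k)" using \<open>path n P A\<close> k by (auto simp: path_def)
      then have "P k = src (A k') \<or> P k = tgt (A k')" "A k' \<in> U" unfolding joins_def by auto
      then show ?thesis by blast
    qed
    then have "card (P ` {..n}) \<le> card ?V" using fin by (intro card_mono) auto
    then show ?thesis using \<open>path n P A\<close> card_image[of P "{..n}"] by (simp add: path_def)
  qed simp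
  define N where "N = (GREATEST n. \<exists>P A. path n P A)"
  have "\<exists>P A. path N P A" unfolding N_def
    by (rule GreatestI_nat[where b = "card ?V"]) (use path1 bound in blast)+
  then obtain P A where PA: "path N P A" by blast
  have N1: "1 \<le> N" unfolding N_def
    by (rule Greatest_le_nat[where b = "card ?V"]) (use path1 bound in blast)+
  have max: "\<not> path (Suc N) P' A'" for P' A'
  proof
    assume "path (Suc N) P' A'"
    then have "Suc N \<le> N" unfolding N_def by (intro Greatest_le_nat[where b = "card ?V"]) (use bound in blast)+
    then show False by simp
  qed
  define v where "v = P N"
  have inj: "P i = P j \<Longrightarrow> i \<le> N \<Longrightarrow> j \<le> N \<Longrightarrow> i = j" for i j using PA by (auto simp: path_def inj_on_def)
  have AU: "A k \<in> U" "joins (A k) (P k) (P (Suc k))" if "k < N" for k using PA that by (auto simp: path_def)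
  have "v \<in> {src (A (N - 1)), tgt (A (N - 1))}" using AU[of "N - 1"] N1 by (auto simp: joins_def v_def)
  then obtain e where e: "e \<in> U" "e \<noteq> A (N - 1)" "v \<in> {src e, tgt e}"
    using deg[of "A (N - 1)" v] AU(1)[of "N - 1"] N1 by auto
  \<comment> \<open>The other end of \<open>e\<close>. It lies on the path, as otherwise
    \<open>e\<close> would extend it.\<close>
  define w where "w = (if v = src e then tgt e else src e)"
  have jw: "joins e v w" "w \<noteq> v" using e loop[OF e(1)] by (auto simp: joins_def w_def)
  have "\<exists>i\<le>N. w = P i"
  proof (rule ccontr)
    assume neg: "\<not> ?thesis"
    have "path (Suc N) (P(Suc N := w)) (A(N := e))"
      unfolding path_def
    proof (intro conjI allI impI)
      show "inj_on (P(Suc N := w)) {..Suc N}" using neg inj by (auto simp: inj_on_def le_Suc_eq)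
      fix k assume "k < Suc N"
      then show "(A(N := e)) k \<in> U" "joins ((A(N := e)) k) ((P(Suc N := w)) k) ((P(Suc N := w)) (Suc k))"
        using AU[of k] e(1) jw by (auto simp: v_def less_Suc_eq)
    qed
    then show False using max by blast
  qed
  then obtain i where i: "i \<le> N" "w = P i" by blast
  with jw(2) have "i < N" by (cases "i = N") (auto simp: v_def)
  \<comment> \<open>The cycle: its nodes \<open>Q 0\<close>, ..., \<open>Q L\<close> run from
    \<open>P i\<close> along the path to \<open>P N\<close> and through \<open>e\<close> back to
    \<open>P i\<close>, its edges are the \<open>R k\<close>, and \<open>\<sigma> k\<close> is 1
    exactly if \<open>R k\<close> is traversed from source to target.\<close>
  define L where "L = Suc (N - i)"
  define Q where "Q k = (if k \<le> N - i then P (i + k) else w)" for k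
  define R where "R k = (if k < N - i then A (i + k) else e)" for k
  define \<sigma> :: "nat \<Rightarrow> int" where "\<sigma> k = (if src (R k) = Q k then 1 else -1)" for k
  have R: "R k \<in> U" "joins (R k) (Q k) (Q (Suc k))" if kL: "k < L" for k
  proof -
    consider "k < N - i" | "k = N - i" using kL unfolding L_def by linarith
    then have "R k \<in> U \<and> joins (R k) (Q k) (Q (Suc k))"
    proof cases
      case 1 then show ?thesis using AU[of "i + k"] by (auto simp: R_def Q_def)
    next
      case 2 then show ?thesis using e(1) jw i(1) by (auto simp: R_def Q_def v_def)
    qed
    then show "R k \<in> U" "joins (R k) (Q k) (Q (Suc k))" by auto
  qed
  \<comment> \<open>The nodes of a path are distinct, hence so are its edges. The closing edge
    \<open>e\<close> meets \<open>P N\<close>, so the only path edge it could equal is the last one,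
    which its choice excludes.\<close>
  have Rne: "R k \<noteq> R k'" if "k < k'" "k' < L" for k k'
  proof
    assume eq: "R k = R k'"
    have k: "k < N - i" using that by (simp add: L_def)
    have jk: "joins (A (i + k)) (P (i + k)) (P (Suc (i + k)))" "R k = A (i + k)" using AU[of "i + k"] k by (auto simp: R_def)
    show False
    proof (cases "k' < N - i")
      case True
      have "joins (A (i + k)) (P (i + k')) (P (Suc (i + k')))" using AU[of "i + k'"] True eq jk(2) by (simp add: R_def)
      then have "P (Suc (i + k')) = P (i + k) \<or> P (Suc (i + k')) = P (Suc (i + k))"
        using jk(1) by (auto simp: joins_def)
      moreover have "Suc (i + k') \<le> N" "Suc (i + k) \<le> N" "i + k \<le> N" using True k by linarith+
      ultimately show False using inj[of "Suc (i + k')" "i + k"] inj[of "Suc (i + k')" "Suc (i + k)"] that by auto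
    next
      case False
      then have Re: "A (i + k) = e" using eq jk(2) by (simp add: R_def)
      then have "P N = P (i + k) \<or> P N = P (Suc (i + k))" using jk(1) jw(1) by (auto simp: joins_def v_def)
      moreover have "Suc (i + k) \<le> N" "i + k < N" using k by linarith+
      ultimately have "N = Suc (i + k)" using inj[of N "i + k"] inj[of N "Suc (i + k)"] by auto
      then show False using e(2) Re by simp
    qed
  qed
  then have injR: "inj_on R {..<L}" by (intro linorder_inj_onI) auto
  have Q0: "Q 0 = w" "Q L = w" using i \<open>i < N\<close> by (auto simp: Q_def L_def)
  define d :: "'e \<Rightarrow> int" where "d f = (\<Sum>k<L. if R k = f then \<sigma> k else 0)" for f
  have dR: "d (R k) = \<sigma> k" if "k < L" for k
  proof -
    have "d (R k) = (\<Sum>j<L. if j = k then \<sigma> j else 0)" unfolding d_def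
      by (rule sum.cong) (use that injR in \<open>auto simp: inj_on_def\<close>)
    then show ?thesis using that by simp
  qed
  have d0: "d f = 0" if "f \<notin> R ` {..<L}" for f unfolding d_def
    by (rule sum.neutral) (use that in auto)
  \<comment> \<open>With its sign, an edge contributes the difference of the indicators of its two
    nodes in the order of traversal; these differences telescope around the cycle.\<close>
  have h: "\<sigma> k * (of_bool (src (R k) = x) - of_bool (tgt (R k) = x)) = of_bool (Q k = x) - of_bool (Q (Suc k) = x)"
    if kL: "k < L" for k x
  proof (cases "src (R k) = Q k")
    case True
    then have "tgt (R k) = Q (Suc k)" using R(2)[OF kL] loop[OF R(1)[OF kL]] unfolding joins_def by metis
    then show ?thesis using True by (simp add: \<sigma>_def)
  next
    case False
    then have "src (R k) = Q (Suc k)" "tgt (R k) = Q k" using R(2)[OF kL] unfolding joins_def by blast+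
    then show ?thesis using False by (simp add: \<sigma>_def)
  qed
  have div: "(\<Sum>f\<in>U. d f * (of_bool (src f = x) - of_bool (tgt f = x))) = 0" for x
  proof -
    have "(\<Sum>f\<in>U. d f * (of_bool (src f = x) - of_bool (tgt f = x)))
        = (\<Sum>f\<in>R ` {..<L}. d f * (of_bool (src f = x) - of_bool (tgt f = x)))"
      by (rule sum.mono_neutral_right) (use fin R(1) d0 in auto)
    also have "\<dots> = (\<Sum>k<L. d (R k) * (of_bool (src (R k) = x) - of_bool (tgt (R k) = x)))"
      by (rule sum.reindex_cong[OF injR]) auto
    also have "\<dots> = (\<Sum>k<L. of_bool (Q k = x) - of_bool (Q (Suc k) = x))"
      by (rule sum.cong) (use dR h in auto)
    also have "\<dots> = of_bool (Q 0 = x) - of_bool (Q L = x)"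
      by (rule sum_lessThan_telescope')
    finally show ?thesis using Q0 by simp
  qed
  show ?thesis
  proof (intro exI[of _ d] conjI allI impI)
    show "\<exists>f\<in>U. d f \<noteq> 0" using dR[of 0] R(1)[of 0] by (intro bexI[of _ "R 0"]) (auto simp: \<sigma>_def L_def)
    show "d f = 0" if "f \<notin> U" for f using d0[of f] R(1) that by auto
    show "\<bar>d f\<bar> \<le> 1" for f
      by (cases "f \<in> R ` {..<L}") (auto simp: dR d0 \<sigma>_def)
    show "(\<Sum>f | f \<in> U \<and> src f = x. d f) = (\<Sum>f | f \<in> U \<and> tgt f = x. d f)" for x
    proof -
      have "(\<Sum>f\<in>U. d f * of_bool (src f = x)) = (\<Sum>f | f \<in> U \<and> src f = x. d f)"
           "(\<Sum>f\<in>U. d f * of_bool (tgt f = x)) = (\<Sum>f | f \<in> U \<and> tgt f = x. d f)"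
        using fin by (auto intro!: sum.mono_neutral_cong_right)
      moreover have "(\<Sum>f\<in>U. d f * of_bool (src f = x)) - (\<Sum>f\<in>U. d f * of_bool (tgt f = x)) = 0"
        using div[of x] by (simp add: right_diff_distrib sum_subtractf)
      ultimately show ?thesis by simp
    qed
  qed
qed

section \<open>Normal forms of jump sequences\<close>

definition ndist :: "nat \<Rightarrow> nat \<Rightarrow> nat" where
  "ndist a b = (a - b) + (b - a)"

lemma int_ndist: "int (ndist a b) = \<bar>int a - int b\<bar>"
  by (auto simp: ndist_def)

lemma ndist_triangle: "ndist a c \<le> ndist a b + ndist b c"
  by (auto simp: ndist_def)

lemma ndist_self [simp]: "ndist a a = 0"
  by (simp add: ndist_def)

text \<open>A state is a vector of \<open>T\<close> counts, the \<open>t\<close>-th of them at most \<open>n t\<close>; its class records each count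
  and each co-count up to the threshold \<open>q\<close>. States of one class are joined by moves inside the class.\<close>

locale jump =
  fixes T q :: nat and n s s' :: "nat \<Rightarrow> nat" and k :: nat and \<Phi> :: "(nat \<times> nat) list \<Rightarrow> bool"
begin

definition cl :: "(nat \<Rightarrow> nat) \<Rightarrow> (nat \<times> nat) list" where
  "cl x = map (\<lambda>t. (min (x t) q, min (n t - x t) q)) [0..<T]"

definition rdist :: "(nat \<Rightarrow> nat) \<Rightarrow> (nat \<Rightarrow> nat) \<Rightarrow> nat" where
  "rdist x y = (\<Sum>t<T. ndist (x t) (y t))"

text \<open>The second alternative is a single jump, which may change the class; the first stands
  for a whole monotone walk inside one class.\<close>

definition linked :: "(nat \<Rightarrow> nat) \<Rightarrow> (nat \<Rightarrow> nat) \<Rightarrow> bool" where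
  "linked x y \<longleftrightarrow> cl x = cl y \<or> (\<forall>t<T. ndist (x t) (y t) \<le> 1) \<and> rdist x y \<le> 2"

definition state :: "(nat \<Rightarrow> nat) \<Rightarrow> bool" where
  "state x \<longleftrightarrow> (\<forall>t<T. x t \<le> n t) \<and> \<Phi> (cl x) \<and> (\<Sum>t<T. x t) = k"

definition ok :: "nat \<Rightarrow> (nat \<Rightarrow> nat \<Rightarrow> nat) \<Rightarrow> bool" where
  "ok m x \<longleftrightarrow> (\<forall>t<T. x 0 t = s t \<and> x m t = s' t) \<and> (\<forall>j\<le>m. state (x j)) \<and> (\<forall>j<m. linked (x j) (x (Suc j)))"

text \<open>Moving one vertex from a cell to another contributes 2, hence the factor 2 in
  comparisons with lengths.\<close>

definition cost :: "nat \<Rightarrow> (nat \<Rightarrow> nat \<Rightarrow> nat) \<Rightarrow> nat" where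
  "cost m x = (\<Sum>j<m. rdist (x j) (x (Suc j)))"

definition form :: "nat \<Rightarrow> int \<Rightarrow> bool" where
  "form c z \<longleftrightarrow> (\<exists>a0 a. \<bar>a0\<bar> \<le> int c \<and> (\<forall>t<T. \<bar>a t\<bar> \<le> int c) \<and> z = a0 + (\<Sum>t<T. a t * int (n t)))"

lemma cl_eqI: "(\<And>t. t < T \<Longrightarrow> min (x t) q = min (y t) q \<and> min (n t - x t) q = min (n t - y t) q) \<Longrightarrow> cl x = cl y"
  by (simp add: cl_def)

lemma rdist_triangle: "rdist x z \<le> rdist x y + rdist y z"
  unfolding rdist_def sum.distrib[symmetric] by (intro sum_mono ndist_triangle)

lemma cost_triangle:
  "i \<le> j \<Longrightarrow> rdist (x i) (x j) \<le> (\<Sum>l=i..<j. rdist (x l) (x (Suc l)))"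
proof (induction j rule: dec_induct)
  case base show ?case by (simp add: rdist_def)
next
  case (step j) then show ?case using rdist_triangle[of "x i" "x (Suc j)" "x j"] by simp
qed

text \<open>Two states of one class are linked directly, so all states strictly between them can be
  cut out; the triangle inequality keeps the cost.\<close>

lemma ok_shortcut:
  assumes "ok m x" "i + 2 \<le> j" "j \<le> m" "cl (x i) = cl (x j)"
  defines "y \<equiv> \<lambda>l. if l \<le> i then x l else x (l + (j - i - 1))"
  shows "ok (m - (j - i - 1)) y" "cost (m - (j - i - 1)) y \<le> cost m x"
proof -
  let ?g = "j - i - 1" let ?m = "m - ?g"
  have im: "i < ?m" "?m + ?g = m" "Suc i + ?g = j" using assms(2,3) by auto
  show "ok ?m y" unfolding ok_def
  proof (intro conjI allI impI)
    fix t assume "t < T"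
    then show "y 0 t = s t" "y ?m t = s' t" using assms(1) im by (auto simp: y_def ok_def)
  next
    fix l assume "l \<le> ?m"
    then show "state (y l)" using assms(1) im by (auto simp: y_def ok_def)
  next
    fix l assume l: "l < ?m"
    consider "l < i" | "l = i" | "i < l" by linarith
    then show "linked (y l) (y (Suc l))"
    proof cases
      case 1 then show ?thesis using assms(1) im by (auto simp: y_def ok_def)
    next
      case 2 then show ?thesis using assms(4) im by (auto simp: y_def linked_def)
    next
      case 3 then show ?thesis using assms(1) im l by (auto simp: y_def ok_def)
    qed
  qed
  let ?f = "\<lambda>l. rdist (x l) (x (Suc l))"
  have "cost ?m y = (\<Sum>l<i. rdist (y l) (y (Suc l))) + (\<Sum>l=i..<Suc i. rdist (y l) (y (Suc l))) + (\<Sum>l=Suc i..<?m. rdist (y l) (y (Suc l)))"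
    using sum.atLeastLessThan_concat[of 0 i ?m "\<lambda>l. rdist (y l) (y (Suc l))"]
      sum.atLeast_Suc_lessThan[of i ?m "\<lambda>l. rdist (y l) (y (Suc l))"] im(1)
    by (simp add: cost_def lessThan_atLeast0)
  also have "(\<Sum>l<i. rdist (y l) (y (Suc l))) = (\<Sum>l<i. ?f l)" by (rule sum.cong) (auto simp: y_def)
  also have "(\<Sum>l=i..<Suc i. rdist (y l) (y (Suc l))) = rdist (x i) (x j)" using im by (simp add: y_def)
  also have "(\<Sum>l=Suc i..<?m. rdist (y l) (y (Suc l))) = (\<Sum>l=Suc i..<?m. ?f (l + ?g))"
    by (rule sum.cong) (auto simp: y_def)
  also have "\<dots> = (\<Sum>l=j..<m. ?f l)"
    using sum.shift_bounds_nat_ivl[of ?f "Suc i" ?g ?m] im by simp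
  also have "(\<Sum>l<i. ?f l) + rdist (x i) (x j) + (\<Sum>l=j..<m. ?f l) \<le> (\<Sum>l<i. ?f l) + (\<Sum>l=i..<j. ?f l) + (\<Sum>l=j..<m. ?f l)"
    using cost_triangle[of i j x] assms(2) by simp
  also have "\<dots> = cost m x" unfolding cost_def lessThan_atLeast0 using assms(2,3) by (simp add: sum.atLeastLessThan_concat)
  finally show "cost ?m y \<le> cost m x" .
qed

text \<open>Repeating the last state is free, so all candidates can be given the same
  length.\<close>

lemma ok_pad:
  assumes "ok m x" "m \<le> M"
  shows "ok M (\<lambda>j. x (min j m))" "cost M (\<lambda>j. x (min j m)) = cost m x"
proof -
  have "linked (x (min j m)) (x (min (Suc j) m))" for j
    using assms by (cases "j < m") (auto simp: ok_def linked_def)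
  then show "ok M (\<lambda>j. x (min j m))" using assms by (auto simp: ok_def)
  have "cost M (\<lambda>j. x (min j m)) = (\<Sum>j<m. rdist (x (min j m)) (x (min (Suc j) m)))"
    unfolding cost_def using assms(2)
    by (intro sum.mono_neutral_right) (auto simp: min_def rdist_def le_Suc_eq)
  also have "\<dots> = cost m x" unfolding cost_def by (rule sum.cong) auto
  finally show "cost M (\<lambda>j. x (min j m)) = cost m x" .
qed

text \<open>In a sequence with fewest states, \<open>ok_shortcut\<close> allows equal classes only
  at neighbouring positions. The states at even positions thus have distinct classes, whence twice
  the number of classes.\<close>

lemma ok_bounded_length:
  assumes "ok m x"
  shows "\<exists>y. ok (2 * ((q + 1) * (q + 1)) ^ T) y \<and> cost (2 * ((q + 1) * (q + 1)) ^ T) y \<le> cost m x"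
proof -
  let ?P = "\<lambda>m'. \<exists>y. ok m' y \<and> cost m' y \<le> cost m x"
  define l where "l = (LEAST m'. ?P m')"
  have "?P l" unfolding l_def by (rule LeastI[of ?P m]) (use assms in blast)
  then obtain y where y: "ok l y" "cost l y \<le> cost m x" by blast
  have min: "\<not> ?P m'" if "m' < l" for m' using not_less_Least[of m' ?P] that unfolding l_def by blast
  have ne: "cl (y i) \<noteq> cl (y j)" if "i + 2 \<le> j" "j \<le> l" for i j
  proof
    assume "cl (y i) = cl (y j)"
    note sc = ok_shortcut[OF y(1) that this]
    have "l - (j - i - 1) < l" using that by linarith
    from min[OF this] sc y(2) show False using le_trans by blast
  qed
  let ?S = "{c. set c \<subseteq> {..q} \<times> {..q} \<and> length c = T}"
  have fin: "finite ?S" by (rule finite_lists_length_eq) simp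
  have "inj_on (\<lambda>j. cl (y (2 * j))) {..l div 2}"
  proof (rule linorder_inj_onI)
    fix i j assume "i < j" "i \<in> {..l div 2}" "j \<in> {..l div 2}"
    then show "cl (y (2 * i)) \<noteq> cl (y (2 * j))" by (intro ne) auto
  qed auto
  moreover have "(\<lambda>j. cl (y (2 * j))) ` {..l div 2} \<subseteq> ?S" by (auto simp: cl_def)
  ultimately have "card {..l div 2} \<le> card ?S" using fin by (intro card_inj_on_le)
  also have "card ?S = ((q + 1) * (q + 1)) ^ T"
    using card_lists_length_eq[of "{..q} \<times> {..q}" T] by (simp add: card_cartesian_product)
  finally have "l \<le> 2 * ((q + 1) * (q + 1)) ^ T" by simp
  from ok_pad[OF y(1) this] y(2) show ?thesis by auto
qed

section \<open>Small linear forms in the cell sizes, and sequences made of them\<close>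

lemma form_mono: "form c z \<Longrightarrow> c \<le> c' \<Longrightarrow> form c' z"
  unfolding form_def by (smt (verit) of_nat_mono)

lemma form_const: "\<bar>z\<bar> \<le> int c \<Longrightarrow> form c z"
  unfolding form_def by (rule exI[of _ z], rule exI[of _ "\<lambda>_. 0"]) auto

lemma form_add: "form c y \<Longrightarrow> form c' z \<Longrightarrow> form (c + c') (y + z)"
proof -
  assume "form c y" "form c' z"
  then obtain a0 a b0 b where a: "\<bar>a0\<bar> \<le> int c" "\<And>t. t < T \<Longrightarrow> \<bar>a t\<bar> \<le> int c" "y = a0 + (\<Sum>t<T. a t * int (n t))"
    and b: "\<bar>b0\<bar> \<le> int c'" "\<And>t. t < T \<Longrightarrow> \<bar>b t\<bar> \<le> int c'" "z = b0 + (\<Sum>t<T. b t * int (n t))" unfolding form_def by blast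
  show ?thesis unfolding form_def
  proof (intro exI[of _ "a0 + b0"] exI[of _ "\<lambda>t. a t + b t"] conjI allI impI)
    fix t assume "t < T"
    then show "\<bar>a t + b t\<bar> \<le> int (c + c')" using a(2)[of t] b(2)[of t] by linarith
  qed (use a b in \<open>auto simp: sum.distrib distrib_right\<close>)
qed

lemma form_uminus: "form c z \<Longrightarrow> form c (- z)"
proof -
  assume "form c z"
  then obtain a0 a where a: "\<bar>a0\<bar> \<le> int c" "\<And>t. t < T \<Longrightarrow> \<bar>a t\<bar> \<le> int c" "z = a0 + (\<Sum>t<T. a t * int (n t))"
    unfolding form_def by blast
  then show ?thesis unfolding form_def
    by (intro exI[of _ "- a0"] exI[of _ "\<lambda>t. - a t"]) (auto simp: sum_negf)
qed

lemma form_diff: "form c y \<Longrightarrow> form c' z \<Longrightarrow> form (c + c') (y - z)"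
  using form_add[OF _ form_uminus] by simp

lemma form_sum: "finite S \<Longrightarrow> (\<And>i. i \<in> S \<Longrightarrow> form c (f i)) \<Longrightarrow> form (card S * c) (sum f S)"
proof (induction S rule: finite_induct)
  case empty show ?case by (simp add: form_const)
next
  case (insert x S) then show ?case using form_add[of c "f x" "card S * c" "sum f S"] by simp
qed

lemma form_n: "t < T \<Longrightarrow> b < c \<Longrightarrow> form c (int (n t) - int b)"
proof -
  assume "t < T" "b < c"
  have "(\<Sum>u<T. (if u = t then 1 else 0) * int (n u)) = (\<Sum>u<T. if u = t then int (n u) else 0)"
    by (rule sum.cong) auto
  also have "\<dots> = int (n t)" using \<open>t < T\<close> by simp
  finally show ?thesis unfolding form_def using \<open>b < c\<close>
    by (intro exI[of _ "- int b"] exI[of _ "\<lambda>u. if u = t then 1 else 0"]) auto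
qed

text \<open>The absolute value is linear away from its kink: a gap of at least 2 keeps its sign
  under a change by at most 2, so two opposite shifts average out.\<close>

lemma abs_shift: "2 \<le> \<bar>a - b\<bar> \<Longrightarrow> \<bar>e - f\<bar> \<le> 2 \<Longrightarrow> \<bar>a + e - (b + f)\<bar> + \<bar>a - e - (b - f)\<bar> = 2 * \<bar>a - b\<bar>"
  for a b e f :: int
  by (cases "a \<le> b") (simp_all add: abs_if split: if_splits)

text \<open>An entry of an optimal sequence that is no small linear form in the \<open>n t\<close> can be shifted by one in
  both directions along a circulation through such entries; this preserves optimality and increases
  the sum of squares in one of the two directions.\<close>

lemma ok_forms:
  assumes "ok m x" and s: "\<And>t. t < T \<Longrightarrow> s t \<in> {0, n t}" "\<And>t. t < T \<Longrightarrow> s' t \<in> {0, n t}"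
  shows "\<exists>y. ok m y \<and> cost m y \<le> cost m x \<and>
    (\<forall>j\<le>m. \<forall>t<T. form ((q + 1) * (3 * T + 3) ^ ((m + 1) * T)) (int (y j t)))"
proof -
  obtain x0 where x0: "ok m x0" "\<And>y. ok m y \<Longrightarrow> cost m x0 \<le> cost m y"
    using ex_has_least_nat[of "ok m" x "cost m"] assms(1) by blast
  define sq where "sq y = (\<Sum>j\<le>m. \<Sum>t<T. (y j t)\<^sup>2)" for y :: "nat \<Rightarrow> nat \<Rightarrow> nat"
  let ?P = "\<lambda>y. ok m y \<and> cost m y = cost m x0"
  have "sq y < Suc (\<Sum>j\<le>m. \<Sum>t<T. (n t)\<^sup>2)" if "?P y" for y
    unfolding sq_def less_Suc_eq_le using that by (intro sum_mono power_mono) (auto simp: ok_def state_def)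
  then obtain y where y: "ok m y" "cost m y = cost m x0" and ymax: "\<And>z. ?P z \<Longrightarrow> sq z \<le> sq y"
    using ex_has_greatest_nat[of ?P x0 sq "Suc (\<Sum>j\<le>m. \<Sum>t<T. (n t)\<^sup>2)"] x0(1) by blast
  have opt: "cost m y \<le> cost m z" if "ok m z" for z using x0(2)[OF that] y(2) by simp
  \<comment> \<open>Coefficient bounds by level. A factor \<open>3 * T + 3\<close> pays for solving
    an equation between two row sums for one entry. If every level before completion gains an entry,
    \<open>(m + 1) * T\<close> levels suffice, as there are that many entries.\<close>
  define C where "C r = (q + 1) * (3 * T + 3) ^ r" for r
  define Z where "Z = {..m} \<times> {..<T}"
  define A where "A r = {p \<in> Z. form (C r) (int (y (fst p) (snd p)))}" for r
  have C1: "q + 1 \<le> C r" "1 \<le> C r" for r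
  proof -
    have "(q + 1) * 1 \<le> (q + 1) * (3 * T + 3) ^ r" by (intro mult_le_mono) auto
    then show "q + 1 \<le> C r" "1 \<le> C r" by (auto simp: C_def)
  qed
  have CS: "C (Suc r) = (3 * T + 3) * C r" for r unfolding C_def power_Suc by (rule mult.left_commute)
  have finZ: "finite Z" by (simp add: Z_def)
  have le: "y j t \<le> n t" if "j \<le> m" "t < T" for j t using y(1) that by (auto simp: ok_def state_def)
  have rows: "(\<Sum>t<T. y j t) = k" if "j \<le> m" for j using y(1) that by (auto simp: ok_def state_def)
  have step: "A r \<noteq> A (Suc r)" if ne: "A r \<noteq> Z" for r
  proof
    assume stable: "A r = A (Suc r)"
    \<comment> \<open>The entries that are no forms of level \<open>r\<close>; by stability they are
      none of the next level either. These are to be shifted.\<close>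
    define U where "U = Z - A r"
    have UZ: "(j, t) \<in> U \<longleftrightarrow> j \<le> m \<and> t < T \<and> \<not> form (C r) (int (y j t))" for j t
      by (auto simp: U_def A_def Z_def)
    have UZ': "(j, t) \<in> U \<longleftrightarrow> j \<le> m \<and> t < T \<and> \<not> form (C (Suc r)) (int (y j t))" for j t
      using UZ stable by (auto simp: U_def A_def Z_def)
    \<comment> \<open>The end rows consist of entries 0 and \<open>n t\<close>, which are forms, so
      the shift leaves them alone.\<close>
    have end0: "j \<noteq> 0 \<and> j \<noteq> m" if "(j, t) \<in> U" for j t
    proof -
      have t: "t < T" using that UZ by blast
      have "form (C r) (int (s t))" "form (C r) (int (s' t))"
        using s[OF t] form_n[OF t, of 0 "C r"] form_const[of 0 "C r"] C1[of r] by auto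
      moreover have "y 0 t = s t" "y m t = s' t" using y(1) t by (auto simp: ok_def)
      ultimately show ?thesis using that UZ[of j t] by (metis)
    qed
    \<comment> \<open>Values up to \<open>q\<close>, or within \<open>q\<close> of
      \<open>n t\<close>, are forms. So an entry of \<open>U\<close> can move by one either way
      without leaving its range or changing its truncations.\<close>
    have mid: "q < y j t \<and> y j t + q < n t" if "(j, t) \<in> U" for j t
    proof -
      have j: "j \<le> m" and t: "t < T" and nf: "\<not> form (C r) (int (y j t))" using that UZ by auto
      have "\<not> y j t \<le> q" using nf form_const[of "int (y j t)" "C r"] C1(1)[of r] by auto
      moreover have "\<not> n t - y j t \<le> q"
        using nf form_n[OF t, of "n t - y j t" "C r"] C1(1)[of r] le[OF j t] by (auto simp: of_nat_diff)
      ultimately show ?thesis by auto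
    qed
    \<comment> \<open>A gap of at least 2 between rows \<open>g - 1\<close> and \<open>g\<close>
      lets the two entries move independently; a smaller gap is at the kink of the cost, and they
      must move together.\<close>
    define cut where "cut g t \<longleftrightarrow> 2 \<le> ndist (y (g - 1) t) (y g t)" for g t
    \<comment> \<open>Each entry \<open>(j, t)\<close> is an edge from gap \<open>j\<close> to gap
      \<open>Suc j\<close>. At a gap the cut columns share the hub \<open>(g, T)\<close> and every
      other column has its own node. Conservation at an own node ties two neighbours together; at
      the hub it preserves the row sum of the shift.\<close>
    define node where "node g t = (g, if cut g t then T else t)" for g t
    define src where "src p = node (fst p) (snd p)" for p :: "nat \<times> nat"
    define tgt where "tgt p = node (Suc (fst p)) (snd p)" for p :: "nat \<times> nat"
    \<comment> \<open>Neighbours that differ by at most 1 are forms together, up to one level;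
      stability removes that level.\<close>
    have rigid: "(g, t) \<in> U \<longleftrightarrow> (g - 1, t) \<in> U" if "\<not> cut g t" "1 \<le> g" "g \<le> m" for g t
    proof -
      have d: "\<bar>int (y g t) - int (y (g - 1) t)\<bar> \<le> 1"
        using that(1) int_ndist[of "y (g - 1) t" "y g t"] by (auto simp: cut_def)
      have "form (C r + 1) (int (y g t))" if "form (C r) (int (y (g - 1) t))"
        using form_add[OF that form_const[of "int (y g t) - int (y (g - 1) t)" 1]] d by simp
      moreover have "form (C r + 1) (int (y (g - 1) t))" if "form (C r) (int (y g t))"
        using form_add[OF that form_const[of "int (y (g - 1) t) - int (y g t)" 1]] d by simp
      moreover have "2 * C r \<le> (3 * T + 3) * C r" by (intro mult_le_mono1) simp
      then have "C r + 1 \<le> C (Suc r)" using C1(2)[of r] unfolding CS by linarith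
      ultimately have "form (C r) (int (y (g - 1) t)) \<Longrightarrow> form (C (Suc r)) (int (y g t))"
        "form (C r) (int (y g t)) \<Longrightarrow> form (C (Suc r)) (int (y (g - 1) t))" using form_mono by blast+
      then show ?thesis using UZ[of g t] UZ[of "g - 1" t] UZ'[of g t] UZ'[of "g - 1" t] that(3) by auto
    qed
    \<comment> \<open>If an entry were alone at a hub, all other entries of cut columns in the two
      rows would be forms of level \<open>r\<close>, and uncut pairs differ by at most 1. Equality
      of the row sums would then make this entry a form of level \<open>Suc r\<close>.\<close>
    have hub: "\<exists>p\<in>U. p \<noteq> (i, t) \<and> (fst p = g \<or> fst p = g - 1) \<and> cut g (snd p)"
      if it: "(i, t) \<in> U" "i = g \<or> i = g - 1" and g: "cut g t" "1 \<le> g" "g \<le> m" for i t g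
    proof (rule ccontr)
      assume no: "\<not> ?thesis"
      have t: "t < T" using it UZ by blast
      define i' where "i' = (if i = g then g - 1 else g)"
      have i': "i' \<le> m" "i \<le> m" "i' = g \<or> i' = g - 1" "i' \<noteq> i" using it g by (auto simp: i'_def)
      have f1: "form (C r) (int (y i' t))" using no i' UZ[of i' t] t g by force
      have f2: "form (2 * C r) (int (y i' u) - int (y i u))" if u: "u \<in> {..<T} - {t}" for u
      proof (cases "cut g u")
        case True
        have "form (C r) (int (y i' u))" "form (C r) (int (y i u))"
          using no i' UZ[of i' u] UZ[of i u] u True it g by force+
        then show ?thesis using form_diff[of "C r" _ "C r"] by (simp add: mult_2)
      next
        case False
        then have "\<bar>int (y i' u) - int (y i u)\<bar> \<le> 1"
          using int_ndist[of "y (g - 1) u" "y g u"] it i' by (auto simp: cut_def)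
        then show ?thesis using C1(2)[of r] by (intro form_const) linarith
      qed
      have "(\<Sum>u<T. int (y i' u)) = (\<Sum>u<T. int (y i u))"
        using rows[OF i'(1)] rows[OF i'(2)] by (metis of_nat_sum)
      then have "int (y i t) = int (y i' t) + (\<Sum>u\<in>{..<T} - {t}. int (y i' u) - int (y i u))"
        using sum.remove[of "{..<T}" t "\<lambda>u. int (y i' u)"] sum.remove[of "{..<T}" t "\<lambda>u. int (y i u)"] t
        by (simp add: sum_subtractf)
      then have "form (C r + card ({..<T} - {t}) * (2 * C r)) (int (y i t))"
        using form_add[OF f1 form_sum[of "{..<T} - {t}", OF _ f2]] by simp
      moreover have "C r + card ({..<T} - {t}) * (2 * C r) \<le> C (Suc r)"
        using t by (simp add: CS algebra_simps)
      ultimately have "form (C (Suc r)) (int (y i t))" using form_mono by blast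
      then show False using UZ' it by blast
    qed
    obtain d :: "nat \<times> nat \<Rightarrow> int" where d: "\<exists>p\<in>U. d p \<noteq> 0" "\<And>p. p \<notin> U \<Longrightarrow> d p = 0" "\<And>p. \<bar>d p\<bar> \<le> 1"
      "\<And>v. (\<Sum>p | p \<in> U \<and> src p = v. d p) = (\<Sum>p | p \<in> U \<and> tgt p = v. d p)"
    proof -
      have "\<exists>d :: nat \<times> nat \<Rightarrow> int. (\<exists>p\<in>U. d p \<noteq> 0) \<and> (\<forall>p. p \<notin> U \<longrightarrow> d p = 0) \<and> (\<forall>p. \<bar>d p\<bar> \<le> 1) \<and>
        (\<forall>v. (\<Sum>p | p \<in> U \<and> src p = v. d p) = (\<Sum>p | p \<in> U \<and> tgt p = v. d p))"
      proof (rule ex_circulation)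
        show "finite U" using finZ by (simp add: U_def)
        show "U \<noteq> {}" using ne by (auto simp: U_def A_def)
        show "src p \<noteq> tgt p" for p by (simp add: src_def tgt_def node_def)
        fix p v assume p: "p \<in> U" "v \<in> {src p, tgt p}"
        obtain j t where jt: "p = (j, t)" by (cases p)
        have j: "1 \<le> j" "j < m" "t < T" using p(1) end0[of j t] UZ[of j t] jt by auto
        define g where "g = (if v = src p then j else Suc j)"
        have g: "v = node g t" "1 \<le> g" "g \<le> m" "j = g \<or> j = g - 1" using p(2) j by (auto simp: g_def jt src_def tgt_def)
        show "\<exists>p'\<in>U. p' \<noteq> p \<and> v \<in> {src p', tgt p'}"
        proof (cases "cut g t")
          case True
          from hub[OF _ g(4) True g(2,3)] p(1) jt obtain p' where
            p': "p' \<in> U" "p' \<noteq> p" "fst p' = g \<or> fst p' = g - 1" "cut g (snd p')" by blast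
          then have "v \<in> {src p', tgt p'}" using g(1,2) True by (auto simp: src_def tgt_def node_def)
          then show ?thesis using p' by blast
        next
          case False
          let ?p = "(if j = g then g - 1 else g, t)"
          have "?p \<in> U" using rigid[OF False g(2,3)] p(1) jt g(4) by auto
          moreover have "?p \<noteq> p" using g(2,4) jt by auto
          moreover have "v \<in> {src ?p, tgt ?p}" using g(1,2) by (auto simp: src_def tgt_def)
          ultimately show ?thesis by blast
        qed
      qed
      then show thesis using that by blast
    qed
    have U0: "(j, t) \<in> U \<Longrightarrow> t < T" for j t using UZ by blast
    have drigid: "d (g, t) = d (g - 1, t)" if "\<not> cut g t" "1 \<le> g" "t < T" for g t
    proof -
      have "{p. p \<in> U \<and> src p = (g, t)} = U \<inter> {(g, t)}"
        using that by (auto simp: src_def node_def split: if_splits)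
      moreover have "{p. p \<in> U \<and> tgt p = (g, t)} = U \<inter> {(g - 1, t)}"
        using that by (auto simp: tgt_def node_def split: if_splits)
      ultimately show ?thesis using d(4)[of "(g, t)"] d(2)
        by (cases "(g, t) \<in> U"; cases "(g - 1, t) \<in> U") auto
    qed
    have dhub: "(\<Sum>t | t < T \<and> cut g t. d (g, t)) = (\<Sum>t | t < T \<and> cut g t. d (g - 1, t))" if "1 \<le> g" for g
    proof -
      have "(\<Sum>t | t < T \<and> cut g t. d (g, t)) = (\<Sum>p\<in>Pair g ` {t. t < T \<and> cut g t}. d p)"
        by (subst sum.reindex) (auto simp: inj_on_def)
      also have "\<dots> = (\<Sum>p | p \<in> U \<and> src p = (g, T). d p)"
        using d(2) by (intro sum.mono_neutral_right) (auto simp: src_def node_def split: if_splits dest: U0)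
      also have "\<dots> = (\<Sum>p | p \<in> U \<and> tgt p = (g, T). d p)" by (rule d(4))
      also have "\<dots> = (\<Sum>p\<in>Pair (g - 1) ` {t. t < T \<and> cut g t}. d p)"
        using d(2) that by (intro sum.mono_neutral_left) (auto simp: tgt_def node_def image_iff split: if_splits dest: U0)
      also have "\<dots> = (\<Sum>t | t < T \<and> cut g t. d (g - 1, t))"
        by (subst sum.reindex) (auto simp: inj_on_def)
      finally show ?thesis .
    qed
    \<comment> \<open>The shift vanishes on row 0, and conservation carries its row sum from each
      row to the next.\<close>
    have drow: "(\<Sum>t<T. d (j, t)) = 0" for j
    proof (induction j)
      case 0
      have "d (0, t) = 0" for t using d(2) end0 by blast
      then show ?case by simp
    next
      case (Suc j)
      have split: "(\<Sum>t<T. f t) = (\<Sum>t | t < T \<and> cut (Suc j) t. f t) + (\<Sum>t | t < T \<and> \<not> cut (Suc j) t. f t)" for f :: "nat \<Rightarrow> int"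
        by (subst sum.union_disjoint[symmetric]) (auto intro: sum.cong)
      have "(\<Sum>t<T. d (Suc j, t)) = (\<Sum>t<T. d (j, t))"
        unfolding split[of "\<lambda>t. d (Suc j, t)"] split[of "\<lambda>t. d (j, t)"]
        using dhub[of "Suc j"] drigid[of "Suc j"] by (auto intro!: arg_cong2[where f = "(+)"] sum.cong)
      then show ?case using Suc by simp
    qed
    define z where "z \<epsilon> j t = nat (int (y j t) + \<epsilon> * d (j, t))" for \<epsilon> :: int and j t
    have iz: "int (z \<epsilon> j t) = int (y j t) + \<epsilon> * d (j, t)" if "\<bar>\<epsilon>\<bar> = 1" for \<epsilon> j t
    proof (cases "(j, t) \<in> U")
      case True
      have "\<bar>\<epsilon> * d (j, t)\<bar> \<le> 1" using d(3)[of "(j, t)"] that by (simp add: abs_mult)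
      then have "0 \<le> int (y j t) + \<epsilon> * d (j, t)" using mid[OF True] by linarith
      then show ?thesis by (simp add: z_def)
    qed (simp add: z_def d(2))
    have okz: "ok m (z \<epsilon>)" if \<epsilon>: "\<bar>\<epsilon>\<bar> = 1" for \<epsilon>
    proof -
      have same: "min (z \<epsilon> j t) q = min (y j t) q \<and> min (n t - z \<epsilon> j t) q = min (n t - y j t) q \<and> (t < T \<longrightarrow> j \<le> m \<longrightarrow> z \<epsilon> j t \<le> n t)" for j t
      proof (cases "(j, t) \<in> U")
        case True
        have "\<bar>\<epsilon> * d (j, t)\<bar> \<le> 1" using d(3)[of "(j, t)"] that by (simp add: abs_mult)
        then have "q \<le> z \<epsilon> j t" "z \<epsilon> j t + q \<le> n t" using mid[OF True] iz[OF \<epsilon>, of j t] by linarith+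
        then show ?thesis using mid[OF True] by auto
      next
        case False
        then have "z \<epsilon> j t = y j t" using iz[OF \<epsilon>, of j t] d(2) by simp
        then show ?thesis using le by simp
      qed
      have clz: "cl (z \<epsilon> j) = cl (y j)" for j using same by (intro cl_eqI) auto
      show ?thesis unfolding ok_def
      proof (intro conjI allI impI)
        fix t assume t: "t < T"
        have "d (0, t) = 0" "d (m, t) = 0" using d(2) end0 by blast+
        then have "z \<epsilon> 0 t = y 0 t" "z \<epsilon> m t = y m t" using iz[OF \<epsilon>, of 0 t] iz[OF \<epsilon>, of m t] by auto
        then show "z \<epsilon> 0 t = s t" "z \<epsilon> m t = s' t" using y(1) t by (auto simp: ok_def)
      next
        fix j assume j: "j \<le> m"
        have "int (\<Sum>t<T. z \<epsilon> j t) = int (\<Sum>t<T. y j t) + \<epsilon> * (\<Sum>t<T. d (j, t))"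
          by (simp add: iz[OF \<epsilon>] sum.distrib sum_distrib_left)
        then have "int (\<Sum>t<T. z \<epsilon> j t) = int (\<Sum>t<T. y j t)" unfolding drow[of j] by linarith
        then have "(\<Sum>t<T. z \<epsilon> j t) = k" unfolding of_nat_eq_iff rows[OF j] .
        then show "state (z \<epsilon> j)" using same clz j y(1) by (auto simp: state_def ok_def)
      next
        fix j assume j: "j < m"
        then have "linked (y j) (y (Suc j))" using y(1) by (auto simp: ok_def)
        then consider "cl (y j) = cl (y (Suc j))" | "\<forall>t<T. ndist (y j t) (y (Suc j) t) \<le> 1" "rdist (y j) (y (Suc j)) \<le> 2"
          by (auto simp: linked_def)
        then show "linked (z \<epsilon> j) (z \<epsilon> (Suc j))"
        proof cases
          case 1 then show ?thesis by (simp add: linked_def clz)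
        next
          case 2
          have "ndist (z \<epsilon> j t) (z \<epsilon> (Suc j) t) = ndist (y j t) (y (Suc j) t)" if "t < T" for t
          proof -
            have "\<not> cut (Suc j) t" using 2(1) that by (auto simp: cut_def not_le)
            then have "d (Suc j, t) = d (j, t)" using drigid[of "Suc j" t] that by simp
            then have "int (ndist (z \<epsilon> j t) (z \<epsilon> (Suc j) t)) = int (ndist (y j t) (y (Suc j) t))"
              unfolding int_ndist iz[OF \<epsilon>] by simp
            then show ?thesis by simp
          qed
          then show ?thesis using 2 by (simp add: linked_def rdist_def)
        qed
      qed
    qed
    have dd: "ndist (z 1 j t) (z 1 (Suc j) t) + ndist (z (-1) j t) (z (-1) (Suc j) t) = 2 * ndist (y j t) (y (Suc j) t)"
      if "t < T" for j t
    proof -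
      have "int (ndist (z 1 j t) (z 1 (Suc j) t)) + int (ndist (z (-1) j t) (z (-1) (Suc j) t)) = 2 * int (ndist (y j t) (y (Suc j) t))"
      proof (cases "cut (Suc j) t")
        case True
        then have far: "2 \<le> \<bar>int (y j t) - int (y (Suc j) t)\<bar>"
          using int_ndist[of "y j t" "y (Suc j) t"] by (simp add: cut_def)
        have near: "\<bar>d (j, t) - d (Suc j, t)\<bar> \<le> 2" using d(3)[of "(j, t)"] d(3)[of "(Suc j, t)"] by linarith
        from abs_shift[OF far near] show ?thesis unfolding int_ndist using iz[of 1 j t] iz[of 1 "Suc j" t] iz[of "-1" j t] iz[of "-1" "Suc j" t] by simp
      next
        case False
        then have "d (Suc j, t) = d (j, t)" using drigid[of "Suc j" t] that by simp
        then show ?thesis unfolding int_ndist using iz[of 1 j t] iz[of 1 "Suc j" t] iz[of "-1" j t] iz[of "-1" "Suc j" t] by simp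
      qed
      then show ?thesis by linarith
    qed
    have "cost m (z 1) + cost m (z (-1)) = (\<Sum>j<m. \<Sum>t<T. 2 * ndist (y j t) (y (Suc j) t))"
      unfolding cost_def rdist_def sum.distrib[symmetric] by (intro sum.cong refl) (use dd in auto)
    then have "cost m (z 1) + cost m (z (-1)) = 2 * cost m y"
      by (simp add: cost_def rdist_def sum_distrib_left)
    \<comment> \<open>Both shifts are admissible and neither beats the optimum, while their costs
      average to it.\<close>
    then have "cost m (z 1) = cost m y" "cost m (z (-1)) = cost m y"
      using opt[OF okz[of 1]] opt[OF okz[of "-1"]] by auto
    then have le2: "sq (z 1) \<le> sq y" "sq (z (-1)) \<le> sq y" using ymax okz[of 1] okz[of "-1"] y(2) by auto
    \<comment> \<open>The parallelogram identity: with \<open>sq y\<close> maximal, the shift would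
      have to vanish.\<close>
    have "int (sq (z 1)) + int (sq (z (-1))) = (\<Sum>j\<le>m. \<Sum>t<T. 2 * (int (y j t))\<^sup>2 + 2 * (d (j, t))\<^sup>2)"
      unfolding sq_def of_nat_sum of_nat_power sum.distrib[symmetric]
      by (intro sum.cong refl) (simp add: iz power2_eq_square algebra_simps)
    also have "\<dots> = 2 * int (sq y) + 2 * (\<Sum>j\<le>m. \<Sum>t<T. (d (j, t))\<^sup>2)"
      by (simp add: sq_def sum.distrib sum_distrib_left)
    finally have "(\<Sum>j\<le>m. \<Sum>t<T. (d (j, t))\<^sup>2) \<le> 0" using le2 by linarith
    moreover have "(\<Sum>j\<le>m. \<Sum>t<T. (d (j, t))\<^sup>2) > 0"
    proof -
      obtain j t where jt: "(j, t) \<in> U" "d (j, t) \<noteq> 0" using d(1) by auto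
      then have b: "j \<le> m" "t < T" using UZ by auto
      have "0 < (d (j, t))\<^sup>2" using jt by simp
      also have "\<dots> \<le> (\<Sum>t<T. (d (j, t))\<^sup>2)" using b by (intro member_le_sum) auto
      also have "\<dots> \<le> (\<Sum>j\<le>m. \<Sum>t<T. (d (j, t))\<^sup>2)"
        using b by (intro member_le_sum[of j _ "\<lambda>j. \<Sum>t<T. (d (j, t))\<^sup>2"]) (auto intro: sum_nonneg)
      finally show ?thesis .
    qed
    ultimately show False by simp
  qed
  have sub: "A r \<subseteq> A (Suc r)" for r
  proof -
    have "C r \<le> C (Suc r)" by (simp add: CS)
    then show ?thesis unfolding A_def using form_mono by blast
  qed
  have AZ: "A r \<subseteq> Z" "finite (A r)" for r
    using finZ finite_subset[of "A r" Z] by (auto simp: A_def)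
  have big: "A r = Z \<or> r \<le> card (A r)" for r
  proof (induction r)
    case (Suc r)
    show ?case
    proof (cases "A r = Z")
      case True then show ?thesis using sub[of r] AZ[of "Suc r"] by blast
    next
      case False
      then have "A r \<subset> A (Suc r)" using step sub by blast
      then have "card (A r) < card (A (Suc r))" using AZ by (intro psubset_card_mono)
      then show ?thesis using Suc False by linarith
    qed
  qed simp
  have "A ((m + 1) * T) = Z"
    using big[of "(m + 1) * T"]
  proof
    assume "(m + 1) * T \<le> card (A ((m + 1) * T))"
    moreover have "card Z = (m + 1) * T" by (simp add: Z_def)
    ultimately show ?thesis by (intro card_seteq[OF finZ AZ(1)]) simp
  qed
  then have "(j, t) \<in> A ((m + 1) * T)" if "j \<le> m" "t < T" for j t using that by (simp add: Z_def)
  then have "form ((q + 1) * (3 * T + 3) ^ ((m + 1) * T)) (int (y j t))" if "j \<le> m" "t < T" for j t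
    unfolding A_def C_def using that by fastforce
  then show ?thesis using y(1) opt[OF assms(1)] by blast
qed

text \<open>The length is bounded first, since the bound on the coefficients depends on the number
  of rows.\<close>

theorem normal_form:
  assumes "ok m x" "\<And>t. t < T \<Longrightarrow> s t \<in> {0, n t}" "\<And>t. t < T \<Longrightarrow> s' t \<in> {0, n t}"
    and "M = 2 * ((q + 1) * (q + 1)) ^ T"
  shows "\<exists>y. ok M y \<and> cost M y \<le> cost m x \<and>
    (\<forall>j\<le>M. \<forall>t<T. form ((q + 1) * (3 * T + 3) ^ ((M + 1) * T)) (int (y j t)))"
proof -
  obtain z where z: "ok M z" "cost M z \<le> cost m x" using ok_bounded_length[OF assms(1)] unfolding assms(4) by blast
  from ok_forms[OF z(1) assms(2,3)] obtain y where y: "ok M y" "cost M y \<le> cost M z"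
    "\<forall>j\<le>M. \<forall>t<T. form ((q + 1) * (3 * T + 3) ^ ((M + 1) * T)) (int (y j t))" by blast
  show ?thesis by (rule exI[of _ y], intro conjI y(1) y(3) le_trans[OF y(2) z(2)])
qed

end


section \<open>Locality of MSO on labelled structures\<close>

text \<open>Satisfaction over arbitrary universes and predicates, which covers truncated models that
  are not given as colored graphs.\<close>

primrec msat :: "'w set \<Rightarrow> ('w \<Rightarrow> 'w \<Rightarrow> bool) \<Rightarrow> (nat \<Rightarrow> 'w \<Rightarrow> bool) \<Rightarrow> mso1 \<Rightarrow> (nat \<Rightarrow> 'w) \<Rightarrow> (nat \<Rightarrow> 'w set) \<Rightarrow> bool" where
  "msat U E C (VEq x y) \<alpha> \<beta> \<longleftrightarrow> \<alpha> x = \<alpha> y"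
| "msat U E C (Adj x y) \<alpha> \<beta> \<longleftrightarrow> E (\<alpha> x) (\<alpha> y)"
| "msat U E C (Color i x) \<alpha> \<beta> \<longleftrightarrow> C i (\<alpha> x)"
| "msat U E C (Mem X x) \<alpha> \<beta> \<longleftrightarrow> \<alpha> x \<in> \<beta> X"
| "msat U E C (Neg p) \<alpha> \<beta> \<longleftrightarrow> \<not> msat U E C p \<alpha> \<beta>"
| "msat U E C (Conj p q) \<alpha> \<beta> \<longleftrightarrow> msat U E C p \<alpha> \<beta> \<and> msat U E C q \<alpha> \<beta>"
| "msat U E C (Disj p q) \<alpha> \<beta> \<longleftrightarrow> msat U E C p \<alpha> \<beta> \<or> msat U E C q \<alpha> \<beta>"
| "msat U E C (Imp p q) \<alpha> \<beta> \<longleftrightarrow> (msat U E C p \<alpha> \<beta> \<longrightarrow> msat U E C q \<alpha> \<beta>)"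
| "msat U E C (Iff p q) \<alpha> \<beta> \<longleftrightarrow> (msat U E C p \<alpha> \<beta> \<longleftrightarrow> msat U E C q \<alpha> \<beta>)"
| "msat U E C (ExV x p) \<alpha> \<beta> \<longleftrightarrow> (\<exists>v\<in>U. msat U E C p (\<alpha>(x := v)) \<beta>)"
| "msat U E C (AllV x p) \<alpha> \<beta> \<longleftrightarrow> (\<forall>v\<in>U. msat U E C p (\<alpha>(x := v)) \<beta>)"
| "msat U E C (ExS X p) \<alpha> \<beta> \<longleftrightarrow> (\<exists>A\<subseteq>U. msat U E C p \<alpha> (\<beta>(X := A)))"
| "msat U E C (AllS X p) \<alpha> \<beta> \<longleftrightarrow> (\<forall>A\<subseteq>U. msat U E C p \<alpha> (\<beta>(X := A)))"

lemma sat_msat: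
  "sat G p \<alpha> \<beta> \<longleftrightarrow> msat (verts G) (\<lambda>u v. {u, v} \<in> edges G) (\<lambda>i v. i < length (colors G) \<and> v \<in> colors G ! i) p \<alpha> \<beta>"
  by (induction p arbitrary: \<alpha> \<beta>) auto

text \<open>Postfix code; the fields of an instruction are the operation tag and the variable (or color) names.\<close>

primrec code :: "mso1 \<Rightarrow> (tree \<times> tree \<times> tree) list" where
  "code (VEq x y) = [(enc_nat 0, enc_nat x, enc_nat y)]"
| "code (Adj x y) = [(enc_nat 1, enc_nat x, enc_nat y)]"
| "code (Color i x) = [(enc_nat 2, enc_nat i, enc_nat x)]"
| "code (Mem X x) = [(enc_nat 3, enc_nat X, enc_nat x)]"
| "code (Neg p) = code p @ [(enc_nat 4, Leaf, Leaf)]"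
| "code (Conj p q) = code p @ code q @ [(enc_nat 5, Leaf, Leaf)]"
| "code (Disj p q) = code p @ code q @ [(enc_nat 6, Leaf, Leaf)]"
| "code (Imp p q) = code p @ code q @ [(enc_nat 7, Leaf, Leaf)]"
| "code (Iff p q) = code p @ code q @ [(enc_nat 8, Leaf, Leaf)]"
| "code (ExV x p) = code p @ [(enc_nat 9, enc_nat x, Leaf)]"
| "code (AllV x p) = code p @ [(enc_nat 10, enc_nat x, Leaf)]"
| "code (ExS X p) = code p @ [(enc_nat 11, enc_nat X, Leaf)]"
| "code (AllS X p) = code p @ [(enc_nat 12, enc_nat X, Leaf)]"

section \<open>Counting labels up to a threshold\<close>

definition agree :: "nat \<Rightarrow> nat \<Rightarrow> nat \<Rightarrow> bool" where
  "agree N a b \<longleftrightarrow> a = b \<or> N \<le> a \<and> N \<le> b"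

text \<open>Labels carry what is known about a vertex, and \<open>refine\<close> adds one bit for
  each quantified set or vertex. Label counts equal up to a threshold are the invariant of the
  back-and-forth game.\<close>

definition cards_match :: "nat \<Rightarrow> 'v set \<Rightarrow> ('v \<Rightarrow> nat list) \<Rightarrow> 'w set \<Rightarrow> ('w \<Rightarrow> nat list) \<Rightarrow> bool" where
  "cards_match N V l W m \<longleftrightarrow> finite V \<and> finite W \<and> (\<forall>c. agree N (card {v\<in>V. l v = c}) (card {w\<in>W. m w = c}))"

abbreviation refine :: "'v set \<Rightarrow> ('v \<Rightarrow> nat list) \<Rightarrow> 'v \<Rightarrow> nat list" where
  "refine A l v \<equiv> (if v \<in> A then 1 else 0) # l v"

lemma agree_sym: "agree N a b \<longleftrightarrow> agree N b a"
  by (auto simp: agree_def)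

lemma agree_mono: "agree N a b \<Longrightarrow> M \<le> N \<Longrightarrow> agree M a b"
  by (auto simp: agree_def)

lemma cards_match_symD: "cards_match N V l W m \<Longrightarrow> cards_match N W m V l"
  unfolding cards_match_def by (simp add: agree_sym)

lemma cards_match_mono: "cards_match N V l W m \<Longrightarrow> M \<le> N \<Longrightarrow> cards_match M V l W m"
  unfolding cards_match_def using agree_mono by blast

lemma cards_match_refineI:
  assumes "finite V" "finite W"
    and "\<And>c. agree N (card ({v\<in>V. l v = c} \<inter> A)) (card ({w\<in>W. m w = c} \<inter> A'))"
    and "\<And>c. agree N (card ({v\<in>V. l v = c} - A)) (card ({w\<in>W. m w = c} - A'))"
  shows "cards_match N V (refine A l) W (refine A' m)"
  unfolding cards_match_def
proof (intro conjI allI assms(1,2))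
  fix c show "agree N (card {v\<in>V. refine A l v = c}) (card {w\<in>W. refine A' m w = c})"
  proof (cases c)
    case Nil then show ?thesis by (simp add: agree_def)
  next
    case (Cons b c')
    consider "b = 1" | "b = 0" | "b \<noteq> 0" "b \<noteq> 1" by blast
    then show ?thesis
    proof cases
      case 1
      then have "{v\<in>V. refine A l v = c} = {v\<in>V. l v = c'} \<inter> A" "{w\<in>W. refine A' m w = c} = {w\<in>W. m w = c'} \<inter> A'"
        using Cons by auto
      then show ?thesis using assms(3)[of c'] by (simp only:)
    next
      case 2
      then have "{v\<in>V. refine A l v = c} = {v\<in>V. l v = c'} - A" "{w\<in>W. refine A' m w = c} = {w\<in>W. m w = c'} - A'"
        using Cons by auto
      then show ?thesis using assms(4)[of c'] by (simp only:)
    next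
      case 3
      then have "{v\<in>V. refine A l v = c} = {}" "{w\<in>W. refine A' m w = c} = {}" using Cons by auto
      then show ?thesis by (simp only: card.empty agree_def simp_thms)
    qed
  qed
qed

text \<open>A part below \<open>N\<close> is copied exactly, which leaves at least \<open>N\<close>
  for the other part; if both parts reach \<open>N\<close>, take \<open>N\<close> itself. Hence
  twice the threshold pays for one split.\<close>

lemma split_number:
  fixes a b n' N :: nat
  assumes "agree (2 * N) (a + b) n'"
  shows "\<exists>a'\<le>n'. agree N a a' \<and> agree N b (n' - a')"
proof -
  consider "a + b = n'" | "2 * N \<le> a + b" "2 * N \<le> n'" "a < N" | "2 * N \<le> a + b" "2 * N \<le> n'" "b < N"
    | "2 * N \<le> n'" "N \<le> a" "N \<le> b" using assms unfolding agree_def by linarith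
  then show ?thesis
  proof cases
    case 1 then show ?thesis by (intro exI[of _ a]) (auto simp: agree_def)
  next
    case 2 then show ?thesis by (intro exI[of _ a]) (auto simp: agree_def)
  next
    case 3 then show ?thesis by (intro exI[of _ "n' - b"]) (auto simp: agree_def)
  next
    case 4 then show ?thesis by (intro exI[of _ N]) (auto simp: agree_def)
  qed
qed

text \<open>The answer to a set move: each label class is split separately, and the pieces are
  united.\<close>

lemma cards_match_split:
  assumes match: "cards_match (2 * N) V l W m"
  shows "\<exists>A'\<subseteq>W. cards_match N V (refine A l) W (refine A' m)"
proof -
  have fin: "finite V" "finite W" using match by (auto simp: cards_match_def)
  have "\<exists>D. D \<subseteq> {w\<in>W. m w = c} \<and> agree N (card ({v\<in>V. l v = c} \<inter> A)) (card D) \<and>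
     agree N (card ({v\<in>V. l v = c} - A)) (card ({w\<in>W. m w = c} - D))" for c
  proof -
    let ?X = "{v\<in>V. l v = c}" and ?Y = "{w\<in>W. m w = c}"
    have finX: "finite ?X" "finite ?Y" using fin by auto
    have "agree (2 * N) (card (?X \<inter> A) + card (?X - A)) (card ?Y)"
      using match unfolding cards_match_def card_Int_Diff[OF finX(1), of A, symmetric] by blast
    from split_number[OF this] obtain a' where a': "a' \<le> card ?Y" "agree N (card (?X \<inter> A)) a'"
      "agree N (card (?X - A)) (card ?Y - a')" by blast
    obtain D where D: "D \<subseteq> ?Y" "card D = a'" using obtain_subset_with_card_n[OF a'(1)] by blast
    then have "card (?Y - D) = card ?Y - a'" using card_Diff_subset[OF finite_subset[OF D(1) finX(2)] D(1)] by simp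
    then show ?thesis using D a'(2,3) by (intro exI[of _ D]) simp
  qed
  then have "\<forall>c. \<exists>D. D \<subseteq> {w\<in>W. m w = c} \<and> agree N (card ({v\<in>V. l v = c} \<inter> A)) (card D) \<and>
     agree N (card ({v\<in>V. l v = c} - A)) (card ({w\<in>W. m w = c} - D))" ..
  from choice[OF this] obtain D where "\<forall>c. D c \<subseteq> {w\<in>W. m w = c} \<and> agree N (card ({v\<in>V. l v = c} \<inter> A)) (card (D c)) \<and>
     agree N (card ({v\<in>V. l v = c} - A)) (card ({w\<in>W. m w = c} - D c))" ..
  then have D: "D c \<subseteq> {w\<in>W. m w = c}" "agree N (card ({v\<in>V. l v = c} \<inter> A)) (card (D c))"
     "agree N (card ({v\<in>V. l v = c} - A)) (card ({w\<in>W. m w = c} - D c))" for c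
    by simp_all
  let ?A' = "{w\<in>W. w \<in> D (m w)}"
  have eq: "{w\<in>W. m w = c} \<inter> ?A' = D c" "{w\<in>W. m w = c} - ?A' = {w\<in>W. m w = c} - D c" for c
    using D(1)[of c] by auto
  have "cards_match N V (refine A l) W (refine ?A' m)"
  proof (rule cards_match_refineI[OF fin])
    fix c
    show "agree N (card ({v\<in>V. l v = c} \<inter> A)) (card ({w\<in>W. m w = c} \<inter> ?A'))"
      by (subst eq(1)) (rule D(2))
    show "agree N (card ({v\<in>V. l v = c} - A)) (card ({w\<in>W. m w = c} - ?A'))"
      by (subst eq(2)) (rule D(3))
  qed
  then show ?thesis by (intro exI[of _ ?A'] conjI) (rule Collect_restrict)
qed

text \<open>The answer to a vertex move: the label occurs on both sides, and taking one vertex out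
  of each class lowers the threshold by at most one.\<close>

lemma cards_match_pick:
  assumes match: "cards_match (2 * N) V l W m" and v: "v \<in> V" and N: "1 \<le> N"
  shows "\<exists>w\<in>W. m w = l v \<and> cards_match N V (refine {v} l) W (refine {w} m)"
proof -
  have fin: "finite V" "finite W" using match by (auto simp: cards_match_def)
  let ?X = "{u\<in>V. l u = l v}" and ?Y = "{w\<in>W. m w = l v}"
  have cXY: "card ?X = card ?Y \<or> 2 * N \<le> card ?X \<and> 2 * N \<le> card ?Y" using match by (simp add: cards_match_def agree_def)
  have X1: "0 < card ?X" using v fin by (auto simp: card_gt_0_iff)
  then have "0 < card ?Y" using cXY N by linarith
  then obtain w where w: "w \<in> W" "m w = l v" using fin by (auto simp: card_gt_0_iff)
  have "cards_match N V (refine {v} l) W (refine {w} m)"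
  proof (rule cards_match_refineI[OF fin])
    fix c
    have *: "agree N (card {u\<in>V. l u = c}) (card {u\<in>W. m u = c})"
      using cards_match_mono[OF match, of N] by (simp add: cards_match_def)
    have e: "{u\<in>V. l u = c} \<inter> {v} = (if c = l v then {v} else {})" "{u\<in>W. m u = c} \<inter> {w} = (if c = l v then {w} else {})"
      using v w by auto
    show "agree N (card ({u\<in>V. l u = c} \<inter> {v})) (card ({u\<in>W. m u = c} \<inter> {w}))"
      unfolding e by (simp add: agree_def)
    show "agree N (card ({u\<in>V. l u = c} - {v})) (card ({u\<in>W. m u = c} - {w}))"
    proof (cases "c = l v")
      case True
      have "card (?X - {v}) = card ?X - 1" "card (?Y - {w}) = card ?Y - 1" using v w by simp_all
      then show ?thesis unfolding True agree_def using cXY N by linarith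
    next
      case False
      then have "{u\<in>V. l u = c} - {v} = {u\<in>V. l u = c}" "{u\<in>W. m u = c} - {w} = {u\<in>W. m u = c}" using w by auto
      then show ?thesis using * by simp
    qed
  qed
  from conjI[OF w(2) this] show ?thesis by (rule bexI) (rule w(1))
qed

text \<open>Adjacency is a function of labels only up to equality: vertices of one label may be
  adjacent, but no vertex is adjacent to itself.\<close>

definition structs_match :: "'v set \<Rightarrow> ('v \<Rightarrow> 'v \<Rightarrow> bool) \<Rightarrow> (nat \<Rightarrow> 'v \<Rightarrow> bool) \<Rightarrow> ('v \<Rightarrow> nat list) \<Rightarrow>
    'w set \<Rightarrow> ('w \<Rightarrow> 'w \<Rightarrow> bool) \<Rightarrow> (nat \<Rightarrow> 'w \<Rightarrow> bool) \<Rightarrow> ('w \<Rightarrow> nat list) \<Rightarrow> nat set \<Rightarrow> bool" where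
  "structs_match V E C l W F D m I \<longleftrightarrow>
     (\<forall>u\<in>V. \<forall>v\<in>V. \<forall>u'\<in>W. \<forall>v'\<in>W. l u = m u' \<longrightarrow> l v = m v' \<longrightarrow> (u = v \<longleftrightarrow> u' = v') \<longrightarrow> (E u v \<longleftrightarrow> F u' v')) \<and>
     (\<forall>i\<in>I. \<forall>u\<in>V. \<forall>u'\<in>W. l u = m u' \<longrightarrow> (C i u \<longleftrightarrow> D i u'))"

text \<open>On both sides the value of a free vertex variable is alone in its label class, so labels
  decide the equality of variables.\<close>

definition vvals_match :: "'v set \<Rightarrow> ('v \<Rightarrow> nat list) \<Rightarrow> (nat \<Rightarrow> 'v) \<Rightarrow> 'w set \<Rightarrow> ('w \<Rightarrow> nat list) \<Rightarrow> (nat \<Rightarrow> 'w) \<Rightarrow> nat set \<Rightarrow> bool" where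
  "vvals_match V l \<alpha> W m \<alpha>' J \<longleftrightarrow> (\<forall>x\<in>J. \<alpha> x \<in> V \<and> \<alpha>' x \<in> W \<and> l (\<alpha> x) = m (\<alpha>' x) \<and>
     (\<forall>v\<in>V. l v = l (\<alpha> x) \<longrightarrow> v = \<alpha> x) \<and> (\<forall>w\<in>W. m w = m (\<alpha>' x) \<longrightarrow> w = \<alpha>' x))"

definition svals_match :: "'v set \<Rightarrow> ('v \<Rightarrow> nat list) \<Rightarrow> (nat \<Rightarrow> 'v set) \<Rightarrow> 'w set \<Rightarrow> ('w \<Rightarrow> nat list) \<Rightarrow> (nat \<Rightarrow> 'w set) \<Rightarrow> nat set \<Rightarrow> bool" where
  "svals_match V l \<beta> W m \<beta>' J \<longleftrightarrow> (\<forall>X\<in>J. \<forall>v\<in>V. \<forall>w\<in>W. l v = m w \<longrightarrow> (v \<in> \<beta> X \<longleftrightarrow> w \<in> \<beta>' X))"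

definition all_match where
  "all_match N V E C l \<alpha> \<beta> W F D m \<alpha>' \<beta>' p \<longleftrightarrow> cards_match N V l W m \<and>
     structs_match V E C l W F D m (color_indices p) \<and>
     vvals_match V l \<alpha> W m \<alpha>' (free_vvars p) \<and> svals_match V l \<beta> W m \<beta>' (free_svars p)"

lemma all_match_sym:
  assumes "all_match N V E C l \<alpha> \<beta> W F D m \<alpha>' \<beta>' p"
  shows "all_match N W F D m \<alpha>' \<beta>' V E C l \<alpha> \<beta> p"
  unfolding all_match_def
proof (intro conjI)
  show "cards_match N W m V l" using assms by (simp add: all_match_def cards_match_symD)
  show "structs_match W F D m V E C l (color_indices p)"
    using assms by (simp add: all_match_def structs_match_def eq_commute)
  show "vvals_match W m \<alpha>' V l \<alpha> (free_vvars p)"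
    using assms by (simp add: all_match_def vvals_match_def)
  show "svals_match W m \<beta>' V l \<beta> (free_svars p)"
    using assms unfolding all_match_def svals_match_def by (metis (no_types))
qed

lemma all_match_sub:
  assumes "all_match N V E C l \<alpha> \<beta> W F D m \<alpha>' \<beta>' p" "M \<le> N"
    "color_indices r \<subseteq> color_indices p" "free_vvars r \<subseteq> free_vvars p" "free_svars r \<subseteq> free_svars p"
  shows "all_match M V E C l \<alpha> \<beta> W F D m \<alpha>' \<beta>' r"
  using assms cards_match_mono[of N V l W m M]
  unfolding all_match_def structs_match_def vvals_match_def svals_match_def by blast

lemma all_match_ExV:
  assumes "all_match (2 * N) V E C l \<alpha> \<beta> W F D m \<alpha>' \<beta>' (ExV x p)" "v \<in> V" "1 \<le> N"
  shows "\<exists>w\<in>W. \<exists>l' m'. all_match N V E C l' (\<alpha>(x := v)) \<beta> W F D m' (\<alpha>'(x := w)) \<beta>' p"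
proof -
  have "cards_match (2 * N) V l W m" using assms(1) by (simp add: all_match_def)
  from cards_match_pick[OF this assms(2,3)] obtain w where w: "w \<in> W" "m w = l v"
    "cards_match N V (refine {v} l) W (refine {w} m)" by (elim bexE conjE)
  have "all_match N V E C (refine {v} l) (\<alpha>(x := v)) \<beta> W F D (refine {w} m) (\<alpha>'(x := w)) \<beta>' p"
    unfolding all_match_def
  proof (intro conjI w(3))
    show "structs_match V E C (refine {v} l) W F D (refine {w} m) (color_indices p)"
      using assms(1) by (auto simp: all_match_def structs_match_def split: if_splits)
    have old: "\<And>y. y \<in> free_vvars p \<Longrightarrow> y \<noteq> x \<Longrightarrow> \<alpha> y \<in> V \<and> \<alpha>' y \<in> W \<and> l (\<alpha> y) = m (\<alpha>' y) \<and>
       (\<forall>v\<in>V. l v = l (\<alpha> y) \<longrightarrow> v = \<alpha> y) \<and> (\<forall>w\<in>W. m w = m (\<alpha>' y) \<longrightarrow> w = \<alpha>' y)"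
      using assms(1) by (auto simp: all_match_def vvals_match_def)
    show "vvals_match V (refine {v} l) (\<alpha>(x := v)) W (refine {w} m) (\<alpha>'(x := w)) (free_vvars p)"
      unfolding vvals_match_def
    proof
      fix y assume y: "y \<in> free_vvars p"
      let ?a = "(\<alpha>(x := v)) y" and ?b = "(\<alpha>'(x := w)) y"
      show "?a \<in> V \<and> ?b \<in> W \<and> refine {v} l ?a = refine {w} m ?b \<and>
         (\<forall>u\<in>V. refine {v} l u = refine {v} l ?a \<longrightarrow> u = ?a) \<and> (\<forall>u\<in>W. refine {w} m u = refine {w} m ?b \<longrightarrow> u = ?b)"
      proof (cases "y = x")
        case True then show ?thesis using w assms(2) by auto
      next
        case False
        note o = old[OF y False]
        have "\<alpha> y = v \<longleftrightarrow> \<alpha>' y = w" using o w(1,2) assms(2) by metis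
        then show ?thesis using o False by auto
      qed
    qed
    show "svals_match V (refine {v} l) \<beta> W (refine {w} m) \<beta>' (free_svars p)"
      using assms(1) by (auto simp: all_match_def svals_match_def split: if_splits)
  qed
  then show ?thesis by (intro bexI[OF _ w(1)] exI)
qed

lemma all_match_ExS:
  assumes "all_match (2 * N) V E C l \<alpha> \<beta> W F D m \<alpha>' \<beta>' (ExS X p)" "A \<subseteq> V" "1 \<le> N"
  shows "\<exists>A'\<subseteq>W. \<exists>l' m'. all_match N V E C l' \<alpha> (\<beta>(X := A)) W F D m' \<alpha>' (\<beta>'(X := A')) p"
proof -
  have "cards_match (2 * N) V l W m" using assms(1) by (simp add: all_match_def)
  from cards_match_split[OF this, of A] obtain A' where A': "A' \<subseteq> W"
    "cards_match N V (refine A l) W (refine A' m)" by (elim exE conjE)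
  have "all_match N V E C (refine A l) \<alpha> (\<beta>(X := A)) W F D (refine A' m) \<alpha>' (\<beta>'(X := A')) p"
    unfolding all_match_def
  proof (intro conjI A'(2))
    show "structs_match V E C (refine A l) W F D (refine A' m) (color_indices p)"
      using assms(1) by (auto simp: all_match_def structs_match_def split: if_splits)
    have sv: "\<And>Y v w. Y \<in> free_svars p \<Longrightarrow> Y \<noteq> X \<Longrightarrow> v \<in> V \<Longrightarrow> w \<in> W \<Longrightarrow> l v = m w \<Longrightarrow> v \<in> \<beta> Y \<longleftrightarrow> w \<in> \<beta>' Y"
      using assms(1) by (auto simp: all_match_def svals_match_def)
    then show "svals_match V (refine A l) (\<beta>(X := A)) W (refine A' m) (\<beta>'(X := A')) (free_svars p)"
      by (auto simp: svals_match_def split: if_splits)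
    show "vvals_match V (refine A l) \<alpha> W (refine A' m) \<alpha>' (free_vvars p)"
      unfolding vvals_match_def
    proof
      fix y assume y: "y \<in> free_vvars p"
      then have o: "\<alpha> y \<in> V \<and> \<alpha>' y \<in> W \<and> l (\<alpha> y) = m (\<alpha>' y) \<and>
         (\<forall>v\<in>V. l v = l (\<alpha> y) \<longrightarrow> v = \<alpha> y) \<and> (\<forall>w\<in>W. m w = m (\<alpha>' y) \<longrightarrow> w = \<alpha>' y)"
        using assms(1) by (auto simp: all_match_def vvals_match_def)
      have "{v \<in> V. refine A l v = 1 # l (\<alpha> y)} = (if \<alpha> y \<in> A then {\<alpha> y} else {})"
        "{w \<in> W. refine A' m w = 1 # l (\<alpha> y)} = (if \<alpha>' y \<in> A' then {\<alpha>' y} else {})" using o by auto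
      \<comment> \<open>The value of \<open>y\<close> is alone in its class, so the refined counts
        are 0 or 1, and a threshold of at least 1 distinguishes these.\<close>
      moreover have "card {v \<in> V. refine A l v = 1 # l (\<alpha> y)} = card {w \<in> W. refine A' m w = 1 # l (\<alpha> y)} \<or>
          1 \<le> card {v \<in> V. refine A l v = 1 # l (\<alpha> y)} \<and> 1 \<le> card {w \<in> W. refine A' m w = 1 # l (\<alpha> y)}"
        using cards_match_mono[OF A'(2) assms(3)] unfolding cards_match_def agree_def by blast
      ultimately have "\<alpha> y \<in> A \<longleftrightarrow> \<alpha>' y \<in> A'" by (auto split: if_splits)
      then show "\<alpha> y \<in> V \<and> \<alpha>' y \<in> W \<and> refine A l (\<alpha> y) = refine A' m (\<alpha>' y) \<and>
         (\<forall>u\<in>V. refine A l u = refine A l (\<alpha> y) \<longrightarrow> u = \<alpha> y) \<and> (\<forall>u\<in>W. refine A' m u = refine A' m (\<alpha>' y) \<longrightarrow> u = \<alpha>' y)"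
        using o by auto
    qed
  qed
  then show ?thesis by (intro exI[of _ A'] conjI A'(1) exI)
qed

lemma vvals_matchD:
  assumes "vvals_match V l \<alpha> W m \<alpha>' J" "x \<in> J"
  shows "\<alpha> x \<in> V" "\<alpha>' x \<in> W" "l (\<alpha> x) = m (\<alpha>' x)"
    "\<And>y. y \<in> J \<Longrightarrow> \<alpha> x = \<alpha> y \<longleftrightarrow> \<alpha>' x = \<alpha>' y"
proof -
  show 1: "\<alpha> x \<in> V" "\<alpha>' x \<in> W" "l (\<alpha> x) = m (\<alpha>' x)" using assms by (auto simp: vvals_match_def)
  fix y assume "y \<in> J"
  then show "\<alpha> x = \<alpha> y \<longleftrightarrow> \<alpha>' x = \<alpha>' y" using assms 1 unfolding vvals_match_def by metis
qed

text \<open>Each quantifier halves the threshold, and the number of instructions bounds the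
  quantifier depth.\<close>

theorem msat_match:
  assumes "all_match N V E C l \<alpha> \<beta> W F D m \<alpha>' \<beta>' p" "2 ^ length (code p) \<le> N"
  shows "msat V E C p \<alpha> \<beta> \<longleftrightarrow> msat W F D p \<alpha>' \<beta>'"
  using assms
proof (induction p arbitrary: N l m \<alpha> \<beta> \<alpha>' \<beta>')
  case (VEq x y)
  then have v: "vvals_match V l \<alpha> W m \<alpha>' {x, y}" by (simp add: all_match_def)
  show ?case using vvals_matchD(4)[OF v, of x y] by simp
next
  case (Adj x y)
  then have v: "vvals_match V l \<alpha> W m \<alpha>' {x, y}" and s: "structs_match V E C l W F D m {}" by (auto simp: all_match_def)
  have x: "x \<in> {x, y}" and y: "y \<in> {x, y}" by auto
  note vx = vvals_matchD[OF v x] and vy = vvals_matchD[OF v y]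
  show ?case using s[unfolded structs_match_def, THEN conjunct1, rule_format, OF vx(1) vy(1) vx(2) vy(2) vx(3) vy(3) vx(4)[OF y]]
    by simp
next
  case (Color i x)
  then have v: "vvals_match V l \<alpha> W m \<alpha>' {x}" and s: "structs_match V E C l W F D m {i}" by (auto simp: all_match_def)
  have x: "x \<in> {x}" and i: "i \<in> {i}" by auto
  note vx = vvals_matchD[OF v x]
  show ?case using s[unfolded structs_match_def, THEN conjunct2, rule_format, OF i vx(1) vx(2) vx(3)] by simp
next
  case (Mem X x)
  then have v: "vvals_match V l \<alpha> W m \<alpha>' {x}" and s: "svals_match V l \<beta> W m \<beta>' {X}" by (auto simp: all_match_def)
  have x: "x \<in> {x}" and X: "X \<in> {X}" by auto
  note vx = vvals_matchD[OF v x]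
  show ?case using s[unfolded svals_match_def, rule_format, OF X vx(1) vx(2) vx(3)] by simp
next
  case (Neg p)
  have n: "2 ^ length (code p) \<le> N" by (rule order_trans[OF power_increasing Neg.prems(2)]; simp)
  have a: "all_match N V E C l \<alpha> \<beta> W F D m \<alpha>' \<beta>' p" by (rule all_match_sub[OF Neg.prems(1)]; simp)
  show ?case unfolding msat.simps Neg.IH[OF a n] ..
next
  case (Conj p r)
  have n: "2 ^ length (code p) \<le> N" "2 ^ length (code r) \<le> N"
    by (rule order_trans[OF power_increasing Conj.prems(2)]; simp)+
  have a: "all_match N V E C l \<alpha> \<beta> W F D m \<alpha>' \<beta>' p" "all_match N V E C l \<alpha> \<beta> W F D m \<alpha>' \<beta>' r"
    by (rule all_match_sub[OF Conj.prems(1)]; simp)+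
  show ?case unfolding msat.simps Conj.IH(1)[OF a(1) n(1)] Conj.IH(2)[OF a(2) n(2)] ..
next
  case (Disj p r)
  have n: "2 ^ length (code p) \<le> N" "2 ^ length (code r) \<le> N"
    by (rule order_trans[OF power_increasing Disj.prems(2)]; simp)+
  have a: "all_match N V E C l \<alpha> \<beta> W F D m \<alpha>' \<beta>' p" "all_match N V E C l \<alpha> \<beta> W F D m \<alpha>' \<beta>' r"
    by (rule all_match_sub[OF Disj.prems(1)]; simp)+
  show ?case unfolding msat.simps Disj.IH(1)[OF a(1) n(1)] Disj.IH(2)[OF a(2) n(2)] ..
next
  case (Imp p r)
  have n: "2 ^ length (code p) \<le> N" "2 ^ length (code r) \<le> N"
    by (rule order_trans[OF power_increasing Imp.prems(2)]; simp)+
  have a: "all_match N V E C l \<alpha> \<beta> W F D m \<alpha>' \<beta>' p" "all_match N V E C l \<alpha> \<beta> W F D m \<alpha>' \<beta>' r"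
    by (rule all_match_sub[OF Imp.prems(1)]; simp)+
  show ?case unfolding msat.simps Imp.IH(1)[OF a(1) n(1)] Imp.IH(2)[OF a(2) n(2)] ..
next
  case (Iff p r)
  have n: "2 ^ length (code p) \<le> N" "2 ^ length (code r) \<le> N"
    by (rule order_trans[OF power_increasing Iff.prems(2)]; simp)+
  have a: "all_match N V E C l \<alpha> \<beta> W F D m \<alpha>' \<beta>' p" "all_match N V E C l \<alpha> \<beta> W F D m \<alpha>' \<beta>' r"
    by (rule all_match_sub[OF Iff.prems(1)]; simp)+
  show ?case unfolding msat.simps Iff.IH(1)[OF a(1) n(1)] Iff.IH(2)[OF a(2) n(2)] ..
next
  case (ExV x p)
  let ?M = "2 ^ length (code p) :: nat"
  have M: "all_match (2 * ?M) V E C l \<alpha> \<beta> W F D m \<alpha>' \<beta>' (ExV x p)"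
    by (rule all_match_sub[OF ExV.prems(1)]) (use ExV.prems(2) in auto)
  have iff1: "msat V E C p (\<alpha>(x := v)) \<beta> \<longleftrightarrow> msat W F D p (\<alpha>'(x := w)) \<beta>'"
    if "all_match ?M V E C l' (\<alpha>(x := v)) \<beta> W F D m' (\<alpha>'(x := w)) \<beta>' p" for v w l' m'
    by (rule ExV.IH[OF that order_refl])
  have 1: "1 \<le> ?M" by simp
  note f = all_match_ExV[OF M _ 1] and b = all_match_ExV[OF all_match_sym[OF M] _ 1]
  show ?case
  proof
    assume "msat V E C (ExV x p) \<alpha> \<beta>"
    then obtain v where v: "v \<in> V" "msat V E C p (\<alpha>(x := v)) \<beta>" by auto
    from f[OF v(1)] obtain w l' m' where w: "w \<in> W" and *: "all_match ?M V E C l' (\<alpha>(x := v)) \<beta> W F D m' (\<alpha>'(x := w)) \<beta>' p" by blast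
    show "msat W F D (ExV x p) \<alpha>' \<beta>'" 
      using v(2) w unfolding msat.simps iff1[OF *] by blast
  next
    assume "msat W F D (ExV x p) \<alpha>' \<beta>'"
    then obtain w where w: "w \<in> W" "msat W F D p (\<alpha>'(x := w)) \<beta>'" by auto
    from b[OF w(1)] obtain v l' m' where v: "v \<in> V" and *: "all_match ?M W F D l' (\<alpha>'(x := w)) \<beta>' V E C m' (\<alpha>(x := v)) \<beta> p" by blast
    show "msat V E C (ExV x p) \<alpha> \<beta>" 
      using w(2) v unfolding msat.simps iff1[OF all_match_sym[OF *], symmetric] by blast
  qed
next
  case (AllV x p)
  let ?M = "2 ^ length (code p) :: nat"
  \<comment> \<open>The matching conditions see only free variables and colors, in which
    \<open>AllV x p\<close> and \<open>ExV x p\<close> agree.\<close>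
  have M: "all_match (2 * ?M) V E C l \<alpha> \<beta> W F D m \<alpha>' \<beta>' (ExV x p)"
    using all_match_sub[OF AllV.prems(1), of "2 * ?M" "AllV x p"] AllV.prems(2) by (simp add: all_match_def)
  have iff1: "msat V E C p (\<alpha>(x := v)) \<beta> \<longleftrightarrow> msat W F D p (\<alpha>'(x := w)) \<beta>'"
    if "all_match ?M V E C l' (\<alpha>(x := v)) \<beta> W F D m' (\<alpha>'(x := w)) \<beta>' p" for v w l' m'
    by (rule AllV.IH[OF that order_refl])
  have 1: "1 \<le> ?M" by simp
  note f = all_match_ExV[OF M _ 1] and b = all_match_ExV[OF all_match_sym[OF M] _ 1]
  show ?case
  proof
    assume *: "msat V E C (AllV x p) \<alpha> \<beta>"
    have "msat W F D p (\<alpha>'(x := w)) \<beta>'" if w: "w \<in> W" for w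
    proof -
      from b[OF w] obtain v l' m' where v: "v \<in> V" and a: "all_match ?M W F D l' (\<alpha>'(x := w)) \<beta>' V E C m' (\<alpha>(x := v)) \<beta> p" by blast
      show ?thesis using * v unfolding msat.simps iff1[OF all_match_sym[OF a], symmetric] by blast
    qed
    then show "msat W F D (AllV x p) \<alpha>' \<beta>'" by simp
  next
    assume *: "msat W F D (AllV x p) \<alpha>' \<beta>'"
    have "msat V E C p (\<alpha>(x := v)) \<beta>" if v: "v \<in> V" for v
    proof -
      from f[OF v] obtain w l' m' where w: "w \<in> W" and a: "all_match ?M V E C l' (\<alpha>(x := v)) \<beta> W F D m' (\<alpha>'(x := w)) \<beta>' p" by blast
      show ?thesis using * w unfolding msat.simps iff1[OF a] by blast
    qed
    then show "msat V E C (AllV x p) \<alpha> \<beta>" by simp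
  qed
next
  case (ExS X p)
  let ?M = "2 ^ length (code p) :: nat"
  have M: "all_match (2 * ?M) V E C l \<alpha> \<beta> W F D m \<alpha>' \<beta>' (ExS X p)"
    by (rule all_match_sub[OF ExS.prems(1)]) (use ExS.prems(2) in auto)
  have iff2: "msat V E C p \<alpha> (\<beta>(X := A)) \<longleftrightarrow> msat W F D p \<alpha>' (\<beta>'(X := A'))"
    if "all_match ?M V E C l' \<alpha> (\<beta>(X := A)) W F D m' \<alpha>' (\<beta>'(X := A')) p" for A A' l' m'
    by (rule ExS.IH[OF that order_refl])
  have 1: "1 \<le> ?M" by simp
  note f = all_match_ExS[OF M _ 1] and b = all_match_ExS[OF all_match_sym[OF M] _ 1]
  show ?case
  proof
    assume "msat V E C (ExS X p) \<alpha> \<beta>"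
    then obtain A where A: "A \<subseteq> V" "msat V E C p \<alpha> (\<beta>(X := A))" by auto
    from f[OF A(1)] obtain A' l' m' where A': "A' \<subseteq> W" and *: "all_match ?M V E C l' \<alpha> (\<beta>(X := A)) W F D m' \<alpha>' (\<beta>'(X := A')) p" by blast
    show "msat W F D (ExS X p) \<alpha>' \<beta>'" 
      using A(2) A' unfolding msat.simps iff2[OF *] by blast
  next
    assume "msat W F D (ExS X p) \<alpha>' \<beta>'"
    then obtain A where A: "A \<subseteq> W" "msat W F D p \<alpha>' (\<beta>'(X := A))" by auto
    from b[OF A(1)] obtain A' l' m' where A': "A' \<subseteq> V" and *: "all_match ?M W F D l' \<alpha>' (\<beta>'(X := A)) V E C m' \<alpha> (\<beta>(X := A')) p" by blast
    show "msat V E C (ExS X p) \<alpha> \<beta>" 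
      using A(2) A' unfolding msat.simps iff2[OF all_match_sym[OF *], symmetric] by blast
  qed
next
  case (AllS X p)
  let ?M = "2 ^ length (code p) :: nat"
  have M: "all_match (2 * ?M) V E C l \<alpha> \<beta> W F D m \<alpha>' \<beta>' (ExS X p)"
    using all_match_sub[OF AllS.prems(1), of "2 * ?M" "AllS X p"] AllS.prems(2) by (simp add: all_match_def)
  have iff2: "msat V E C p \<alpha> (\<beta>(X := A)) \<longleftrightarrow> msat W F D p \<alpha>' (\<beta>'(X := A'))"
    if "all_match ?M V E C l' \<alpha> (\<beta>(X := A)) W F D m' \<alpha>' (\<beta>'(X := A')) p" for A A' l' m'
    by (rule AllS.IH[OF that order_refl])
  have 1: "1 \<le> ?M" by simp
  note f = all_match_ExS[OF M _ 1] and b = all_match_ExS[OF all_match_sym[OF M] _ 1]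
  show ?case
  proof
    assume *: "msat V E C (AllS X p) \<alpha> \<beta>"
    have "msat W F D p \<alpha>' (\<beta>'(X := A))" if A: "A \<subseteq> W" for A
    proof -
      from b[OF A] obtain A' l' m' where A': "A' \<subseteq> V" and a: "all_match ?M W F D l' \<alpha>' (\<beta>'(X := A)) V E C m' \<alpha> (\<beta>(X := A')) p" by blast
      show ?thesis using * A' unfolding msat.simps iff2[OF all_match_sym[OF a], symmetric] by blast
    qed
    then show "msat W F D (AllS X p) \<alpha>' \<beta>'" by simp
  next
    assume *: "msat W F D (AllS X p) \<alpha>' \<beta>'"
    have "msat V E C p \<alpha> (\<beta>(X := A))" if A: "A \<subseteq> V" for A
    proof -
      from f[OF A] obtain A' l' m' where A': "A' \<subseteq> W" and a: "all_match ?M V E C l' \<alpha> (\<beta>(X := A)) W F D m' \<alpha>' (\<beta>'(X := A')) p" by blast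
      show ?thesis using * A' unfolding msat.simps iff2[OF a] by blast
    qed
    then show "msat V E C (AllS X p) \<alpha> \<beta>" by simp
  qed
qed


section \<open>The algorithm\<close>

type_synonym inst = "tree \<times> tree \<times> ((tree \<times> tree list) list \<times> tree list list) \<times> tree list \<times> tree list"

definition inst_of :: "msor1 \<Rightarrow> inst" where
  "inst_of I = (enc_mso1 (formula I), enc_nat (free_var I),
     (map (\<lambda>u. (enc_nat u, map enc_nat (sorted_list_of_set (nbhd (graph I) u)))) (sorted_list_of_set (verts (graph I))),
      map (\<lambda>C. map enc_nat (sorted_list_of_set C)) (colors (graph I))),
     map enc_nat (sorted_list_of_set (source I)), map enc_nat (sorted_list_of_set (target I)))"

lemma encode_map: "encode (map f xs) = enc_list (\<lambda>x. encode (f x)) xs"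
  by (induction xs) auto

lemma encode_inst_of: "encode (inst_of I) = enc_msor1 I"
  by (simp add: inst_of_def enc_msor1_def enc_cgraph_def enc_vset_def[abs_def] encode_map encode_tree_def)

definition flat_step :: "tree \<Rightarrow> tree \<Rightarrow> (tree \<times> tree \<times> tree) list \<times> (tree \<times> tree \<times> tree) list \<times> (tree \<times> tree \<times> tree) list
    \<Rightarrow> (tree \<times> tree \<times> tree) list \<times> (tree \<times> tree \<times> tree) list \<times> (tree \<times> tree \<times> tree) list
    \<Rightarrow> (tree \<times> tree \<times> tree) list \<times> (tree \<times> tree \<times> tree) list \<times> (tree \<times> tree \<times> tree) list" where
  "flat_step a b ra rb =
    (if a \<in> set [enc_nat 0, enc_nat 1, enc_nat 2, enc_nat 3] then [(a, tree_left b, tree_right b)]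
     else if a = enc_nat 4 then fst rb @ [(a, Leaf, Leaf)]
     else if a \<in> set [enc_nat 5, enc_nat 6, enc_nat 7, enc_nat 8] then fst (snd rb) @ snd (snd rb) @ [(a, Leaf, Leaf)]
     else snd (snd rb) @ [(a, tree_left b, Leaf)],
     fst ra, fst rb)"

text \<open>The two further components hold the code of the left and right subtree: whether a subtree is to be
  read as a formula or as a pair of operands is only known to its parent.\<close>

definition flat :: "tree \<Rightarrow> (tree \<times> tree \<times> tree) list \<times> (tree \<times> tree \<times> tree) list \<times> (tree \<times> tree \<times> tree) list" where
  "flat t = tree_foldr ([], [], []) flat_step t"

lemma enc_nat_inject: "enc_nat m = enc_nat n \<longleftrightarrow> m = n"
  using bin_val_enc_nat by metis

lemma flat_Node: "flat (Node a b) = flat_step a b (flat a) (flat b)"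
  by (simp add: flat_def)

lemma fst_flat_code: "fst (flat (enc_mso1 p)) = code p"
  by (induction p) (simp_all add: flat_Node flat_step_def enc_nat_inject)

lemma sz_list_le: "(\<And>x. x \<in> set xs \<Longrightarrow> sz x \<le> b) \<Longrightarrow> sz xs \<le> length xs * (b + 1) + 1"
proof (induction xs)
  case (Cons x xs)
  have "sz x \<le> b" "sz xs \<le> length xs * (b + 1) + 1" using Cons by auto
  then show ?case by simp
qed simp

lemma tree_size_left: "tree_size (tree_left t) \<le> tree_size t" and tree_size_right: "tree_size (tree_right t) \<le> tree_size t"
  by (cases t; simp)+

lemma set_op_cases: "set (if c1 then [x] else if c2 then A @ [y] else if c3 then B @ D @ [y] else D @ [z]) \<subseteq>
    {x, y, z} \<union> (set A \<union> set B \<union> set D)"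
  by (cases c1; cases c2; cases c3) auto

lemma length_op_cases: "length A \<le> s \<Longrightarrow> length B + length D \<le> s \<Longrightarrow>
    length (if c1 then [x] else if c2 then A @ [y] else if c3 then B @ D @ [y] else D @ [z]) \<le> Suc s"
  by (cases c1; cases c2; cases c3) auto

text \<open>Stated for every tree, since \<open>fc\<close> bounds a function on all inputs. The
  lengths of the two operand codes are bounded jointly because a binary connective concatenates
  them; separate bounds would double at each level.\<close>

lemma flat_bounds:
  "length (fst (flat t)) \<le> tree_size t \<and> length (fst (snd (flat t))) + length (snd (snd (flat t))) \<le> tree_size t \<and>
   (\<forall>x\<in>set (fst (flat t)) \<union> set (fst (snd (flat t))) \<union> set (snd (snd (flat t))). sz x \<le> 3 * tree_size t + 4)"
proof (induction t)
  case Leaf show ?case by (simp add: flat_def)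
next
  case (Node a b)
  have l: "tree_size (tree_left b) \<le> tree_size b" "tree_size (tree_right b) \<le> tree_size b"
    by (rule tree_size_left tree_size_right)+
  have new: "sz (a, tree_left b, tree_right b) \<le> 3 * tree_size (Node a b) + 4" "sz (a, Leaf, Leaf) \<le> 3 * tree_size (Node a b) + 4"
    "sz (a, tree_left b, Leaf) \<le> 3 * tree_size (Node a b) + 4"
    using l by (simp_all add: encode_tree_def)
  have mem: "set (fst (flat (Node a b))) \<union> set (fst (snd (flat (Node a b)))) \<union> set (snd (snd (flat (Node a b)))) \<subseteq>
     {(a, tree_left b, tree_right b), (a, Leaf, Leaf), (a, tree_left b, Leaf)} \<union> set (fst (flat a)) \<union>
     (set (fst (flat b)) \<union> set (fst (snd (flat b))) \<union> set (snd (snd (flat b))))"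
  proof -
    have "set (fst (flat (Node a b))) \<subseteq> {(a, tree_left b, tree_right b), (a, Leaf, Leaf), (a, tree_left b, Leaf)} \<union>
       (set (fst (flat b)) \<union> set (fst (snd (flat b))) \<union> set (snd (snd (flat b))))"
      unfolding flat_Node flat_step_def fst_conv by (rule set_op_cases)
    moreover have e: "fst (snd (flat (Node a b))) = fst (flat a)" "snd (snd (flat (Node a b))) = fst (flat b)"
      unfolding flat_Node flat_step_def by simp_all
    ultimately show ?thesis unfolding e by auto
  qed
  have "sz x \<le> 3 * tree_size (Node a b) + 4"
    if "x \<in> set (fst (flat (Node a b))) \<union> set (fst (snd (flat (Node a b)))) \<union> set (snd (snd (flat (Node a b))))" for x
  proof -
    from that mem have "x \<in> {(a, tree_left b, tree_right b), (a, Leaf, Leaf), (a, tree_left b, Leaf)} \<or> x \<in> set (fst (flat a)) \<or>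
      x \<in> set (fst (flat b)) \<union> set (fst (snd (flat b))) \<union> set (snd (snd (flat b)))" by blast
    then show ?thesis
    proof (elim disjE)
      assume "x \<in> {(a, tree_left b, tree_right b), (a, Leaf, Leaf), (a, tree_left b, Leaf)}"
      then show ?thesis using new by (elim insertE emptyE) (simp_all only:)
    next
      assume "x \<in> set (fst (flat a))"
      then have "sz x \<le> 3 * tree_size a + 4" using Node.IH(1) by blast
      then show ?thesis by simp
    next
      assume "x \<in> set (fst (flat b)) \<union> set (fst (snd (flat b))) \<union> set (snd (snd (flat b)))"
      then have "sz x \<le> 3 * tree_size b + 4" using Node.IH(2) by blast
      then show ?thesis by simp
    qed
  qed
  moreover have "length (fst (flat (Node a b))) \<le> tree_size (Node a b)"
  proof -
    have "length (fst (flat (Node a b))) \<le> Suc (tree_size b)"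
      unfolding flat_Node flat_step_def fst_conv by (rule length_op_cases) (use Node.IH(2) in blast)+
    then show ?thesis by simp
  qed
  moreover have "length (fst (snd (flat (Node a b)))) + length (snd (snd (flat (Node a b)))) \<le> tree_size (Node a b)"
  proof -
    have "fst (snd (flat (Node a b))) = fst (flat a)" "snd (snd (flat (Node a b))) = fst (flat b)"
      unfolding flat_Node flat_step_def by simp_all
    moreover have "length (fst (flat a)) \<le> tree_size a" "length (fst (flat b)) \<le> tree_size b" using Node.IH by blast+
    ultimately show ?thesis by simp
  qed
  ultimately show ?case by blast
qed

section \<open>Cells of the input, and the kernel\<close>

definition names :: "tree \<Rightarrow> (tree \<times> tree \<times> tree) list \<Rightarrow> tree list" where
  "names X cd = remdups (X # concat (map (\<lambda>i. [fst (snd i), snd (snd i)]) cd))"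

definition idx :: "tree list \<Rightarrow> tree \<Rightarrow> nat" where
  "idx nms x = foldr (\<lambda>y k. if y = x then 0 else Suc k) nms 0"

definition nbrs :: "inst \<Rightarrow> tree \<Rightarrow> tree list" where
  "nbrs i u = concat (map snd (filter (\<lambda>p. fst p = u) (fst (fst (snd (snd i))))))"

definition vlist :: "inst \<Rightarrow> tree list" where
  "vlist i = map fst (fst (fst (snd (snd i))))"

definition cols :: "inst \<Rightarrow> tree list list" where
  "cols i = snd (fst (snd (snd i)))"

definition src :: "inst \<Rightarrow> tree list" where
  "src i = fst (snd (snd (snd i)))"

definition tgt :: "inst \<Rightarrow> tree list" where
  "tgt i = snd (snd (snd (snd i)))"

definition incol :: "inst \<Rightarrow> tree \<Rightarrow> tree \<Rightarrow> bool" where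
  "incol i c u \<longleftrightarrow> (\<exists>p\<in>set (zip (map (\<lambda>k. (bin_inc ^^ k) Leaf) [0..<length (cols i)]) (cols i)). fst p = c \<and> u \<in> set (snd p))"

definition seteq :: "tree list \<Rightarrow> tree list \<Rightarrow> bool" where
  "seteq xs ys \<longleftrightarrow> (\<forall>x\<in>set xs. x \<in> set ys) \<and> (\<forall>y\<in>set ys. y \<in> set xs)"

text \<open>Variables of both sorts and colors share one list of names, so every name is tried as a
  color index. The number of cells is then bounded through the length of this list
  (\<open>T_le\<close>).\<close>

definition same :: "inst \<Rightarrow> tree list \<Rightarrow> tree \<Rightarrow> tree \<Rightarrow> bool" where
  "same i nms u v \<longleftrightarrow> (\<forall>c\<in>set nms. incol i c u = incol i c v) \<and>
     (u \<in> set (src i)) = (v \<in> set (src i)) \<and> (u \<in> set (tgt i)) = (v \<in> set (tgt i)) \<and>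
     (seteq (nbrs i u) (nbrs i v) \<or> seteq (u # nbrs i u) (v # nbrs i v))"

definition icode :: "inst \<Rightarrow> (tree \<times> tree \<times> tree) list" where
  "icode i = fst (flat (fst i))"

definition inames :: "inst \<Rightarrow> tree list" where
  "inames i = names (fst (snd i)) (icode i)"

definition classes :: "inst \<Rightarrow> tree list list" where
  "classes i = remdups (map (\<lambda>u. filter (\<lambda>v. same i (inames i) u v) (vlist i)) (vlist i))"

type_synonym kernel = "(tree \<times> nat \<times> nat) list \<times> nat \<times> nat \<times> bool list list \<times> bool list list"

text \<open>Cell sizes stay out, and names, being numerals of unbounded size, are replaced by
  positions. Tables over cells suffice because color membership, and adjacency of distinct vertices,
  do not depend on the representatives.\<close>

definition kern :: "inst \<Rightarrow> kernel" where
  "kern i = (map (\<lambda>c. (fst c, idx (inames i) (fst (snd c)), idx (inames i) (snd (snd c)))) (icode i),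
     idx (inames i) (fst (snd i)), length (inames i),
     map (\<lambda>A. map (\<lambda>c. \<exists>a\<in>set A. incol i c a) (inames i)) (classes i),
     map (\<lambda>A. map (\<lambda>B. \<exists>a\<in>set A. \<exists>b\<in>set B. a \<noteq> b \<and> b \<in> set (nbrs i a)) (classes i)) (classes i))"

context resource
begin

lemma fc_flat [fc_intros]: "fc B a \<Longrightarrow> fc B (\<lambda>e. flat (a e))"
proof (erule fc_comp[rotated, where f = flat])
  show "fc B flat" unfolding flat_def
  proof (rule fc_tree_foldr_bounded)
    show "fc B (\<lambda>p. flat_step (fst (fst p)) (snd (fst p)) (fst (snd p)) (snd (snd p)))"
      unfolding flat_step_def by (intro fc_intros)
    show "bd (\<lambda>n. 3 * (n * (3 * n + 4 + 1) + 1) + 2)" by (intro bd_intros)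
    fix t
    define b where "b = tree_size t * (3 * tree_size t + 4 + 1)"
    have *: "sz L \<le> b + 1"
      if "length L \<le> tree_size t" "\<forall>x\<in>set L. sz x \<le> 3 * tree_size t + 4" for L :: "(tree \<times> tree \<times> tree) list"
    proof -
      have "sz L \<le> length L * (3 * tree_size t + 4 + 1) + 1" by (rule sz_list_le) (use that(2) in blast)
      also have "\<dots> \<le> b + 1" unfolding b_def using that(1) by (intro add_le_mono1 mult_le_mono1)
      finally show ?thesis .
    qed
    note fb = flat_bounds[of t]
    have "sz (fst (flat t)) \<le> b + 1" by (rule *) (use fb in blast)+
    moreover have l: "length (fst (snd (flat t))) \<le> tree_size t" "length (snd (snd (flat t))) \<le> tree_size t" using fb by linarith+
    have "sz (fst (snd (flat t))) \<le> b + 1" by (rule *[OF l(1)]) (use fb in blast)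
    moreover have "sz (snd (snd (flat t))) \<le> b + 1" by (rule *[OF l(2)]) (use fb in blast)
    ultimately have "sz (flat t) \<le> 3 * (b + 1) + 2" by (cases "flat t") simp
    then show "sz (tree_foldr ([], [], []) flat_step t) \<le> 3 * (tree_size t * (3 * tree_size t + 4 + 1) + 1) + 2"
      unfolding flat_def[symmetric] b_def .
  qed
qed

lemma fc_names [fc_intros]: "fc B a \<Longrightarrow> fc B b \<Longrightarrow> fc B (\<lambda>e. names (a e) (b e))"
  unfolding names_def by (intro fc_intros)

lemma fc_idx [fc_intros]: "fc B a \<Longrightarrow> fc B b \<Longrightarrow> fc B (\<lambda>e. idx (a e) (b e))"
proof -
  have "fc B (\<lambda>p. idx (fst p) (snd p))"
    unfolding idx_def by (rule fc_foldr_additive[OF _ _ _ bd_const[of 2]]) ((intro fc_intros)+, simp)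
  then show "fc B a \<Longrightarrow> fc B b \<Longrightarrow> fc B (\<lambda>e. idx (a e) (b e))" by (rule fc_comp2)
qed

lemma fc_binnat [fc_intros]: "fc B a \<Longrightarrow> fc B (\<lambda>e. (bin_inc ^^ a e) Leaf)"
proof (rule fc_funpow_additive[OF _ _ _ bd_const[of 4]])
  fix t
  have "tree_size (bin_inc t) \<le> tree_size t + 4" unfolding bin_inc_def
  proof (induction t)
    case (Node a b) then show ?case using tree_size_pos[of a] by (simp del: tree_size_pos tree_size_neq)
  qed simp
  then show "sz (bin_inc t) \<le> sz t + 4" by (simp add: encode_tree_def)
qed (intro fc_intros | assumption)+

lemma fc_inst_parts [fc_intros]:
  "fc B a \<Longrightarrow> fc B (\<lambda>e. vlist (a e))" "fc B a \<Longrightarrow> fc B (\<lambda>e. cols (a e))"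
  "fc B a \<Longrightarrow> fc B (\<lambda>e. src (a e))" "fc B a \<Longrightarrow> fc B (\<lambda>e. tgt (a e))" "fc B a \<Longrightarrow> fc B (\<lambda>e. icode (a e))"
  "fc B a \<Longrightarrow> fc B (\<lambda>e. inames (a e))"
  unfolding vlist_def cols_def src_def tgt_def inames_def icode_def by (intro fc_intros; assumption)+

lemma fc_nbrs [fc_intros]: "fc B a \<Longrightarrow> fc B b \<Longrightarrow> fc B (\<lambda>e. nbrs (a e) (b e))"
proof -
  have "fc B (\<lambda>p. nbrs (fst p) (snd p))" unfolding nbrs_def by (intro fc_intros)
  then show "fc B a \<Longrightarrow> fc B b \<Longrightarrow> fc B (\<lambda>e. nbrs (a e) (b e))" by (rule fc_comp2)
qed

lemma fc_incol [fc_intros]: "fc B a \<Longrightarrow> fc B b \<Longrightarrow> fc B c \<Longrightarrow> fc B (\<lambda>e. incol (a e) (b e) (c e))"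
proof -
  have "fc B (\<lambda>p. incol (fst p) (fst (snd p)) (snd (snd p)))" unfolding incol_def by (intro fc_intros)
  then show "fc B a \<Longrightarrow> fc B b \<Longrightarrow> fc B c \<Longrightarrow> fc B (\<lambda>e. incol (a e) (b e) (c e))" by (rule fc_comp3)
qed

lemma fc_seteq [fc_intros]: "fc B a \<Longrightarrow> fc B b \<Longrightarrow> fc B (\<lambda>e. seteq (a e) (b e))"
proof -
  have "fc B (\<lambda>p. seteq (fst p) (snd p))" unfolding seteq_def by (intro fc_intros)
  then show "fc B a \<Longrightarrow> fc B b \<Longrightarrow> fc B (\<lambda>e. seteq (a e) (b e))" by (rule fc_comp2)
qed

lemma fc_classes [fc_intros]: "fc B a \<Longrightarrow> fc B (\<lambda>e. classes (a e))"
proof -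
  have "fc B (\<lambda>i. classes i)" unfolding classes_def same_def by (intro fc_intros)
  then show "fc B a \<Longrightarrow> fc B (\<lambda>e. classes (a e))" by (rule fc_comp)
qed

lemma fc_kern: "fc B kern"
  unfolding kern_def by (intro fc_intros)

end

section \<open>Model checking on truncated models\<close>

type_synonym kvertex = "nat \<times> bool \<times> nat"
type_synonym assignment = "kvertex list \<times> kvertex list list"

text \<open>A vertex of the truncated model consists of its cell, a bit for membership in the free
  set, and a copy number below the truncated count.\<close>

definition univ :: "(nat \<times> nat) list \<Rightarrow> kvertex list" where
  "univ c = concat (map (\<lambda>p. map (\<lambda>i. (fst p, True, i)) [0..<fst (snd p)] @ map (\<lambda>i. (fst p, False, i)) [0..<snd (snd p)])
     (zip [0..<length c] c))"

text \<open>A value outside the universe, so that assignments exist even if the universe is empty.\<close>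

definition dummy :: "(nat \<times> nat) list \<Rightarrow> kvertex" where
  "dummy c = (length c, False, 0)"

definition get :: "'a list \<Rightarrow> nat \<Rightarrow> 'a" where
  "get xs i = hd (drop i xs)"

definition kadj :: "kernel \<Rightarrow> kvertex \<Rightarrow> kvertex \<Rightarrow> bool" where
  "kadj K u v \<longleftrightarrow> u \<noteq> v \<and> get (get (snd (snd (snd (snd K)))) (fst u)) (fst v)"

definition kcol :: "kernel \<Rightarrow> nat \<Rightarrow> kvertex \<Rightarrow> bool" where
  "kcol K i u \<longleftrightarrow> get (get (fst (snd (snd (snd K)))) (fst u)) i"

definition knum :: "kernel \<Rightarrow> nat" where
  "knum K = fst (snd (snd K))"

definition asgs :: "kernel \<Rightarrow> (nat \<times> nat) list \<Rightarrow> assignment list" where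
  "asgs K c = concat (map (\<lambda>\<alpha>. map (\<lambda>\<beta>. (\<alpha>, \<beta>)) (product_lists (replicate (knum K) (subseqs (univ c)))))
     (product_lists (replicate (knum K) (dummy c # univ c))))"

text \<open>The stack holds, for each pending subformula, the table of all its satisfying
  assignments; the right operand lies on top. Whole tables turn the evaluation of a formula into one
  fold over its code.\<close>

definition exec :: "kernel \<Rightarrow> (nat \<times> nat) list \<Rightarrow> tree \<times> nat \<times> nat \<Rightarrow> assignment list list \<Rightarrow> assignment list list" where
  "exec K c ins st =
    (if fst ins = enc_nat 0 then filter (\<lambda>a. get (fst a) (fst (snd ins)) = get (fst a) (snd (snd ins))) (asgs K c) # st
     else if fst ins = enc_nat 1 then filter (\<lambda>a. kadj K (get (fst a) (fst (snd ins))) (get (fst a) (snd (snd ins)))) (asgs K c) # st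
     else if fst ins = enc_nat 2 then filter (\<lambda>a. kcol K (fst (snd ins)) (get (fst a) (snd (snd ins)))) (asgs K c) # st
     else if fst ins = enc_nat 3 then filter (\<lambda>a. get (fst a) (snd (snd ins)) \<in> set (get (snd a) (fst (snd ins)))) (asgs K c) # st
     else if fst ins = enc_nat 4 then filter (\<lambda>a. a \<notin> set (hd st)) (asgs K c) # tl st
     else if fst ins = enc_nat 5 then filter (\<lambda>a. a \<in> set (hd (tl st)) \<and> a \<in> set (hd st)) (asgs K c) # tl (tl st)
     else if fst ins = enc_nat 6 then filter (\<lambda>a. a \<in> set (hd (tl st)) \<or> a \<in> set (hd st)) (asgs K c) # tl (tl st)
     else if fst ins = enc_nat 7 then filter (\<lambda>a. a \<in> set (hd (tl st)) \<longrightarrow> a \<in> set (hd st)) (asgs K c) # tl (tl st)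
     else if fst ins = enc_nat 8 then filter (\<lambda>a. (a \<in> set (hd (tl st))) = (a \<in> set (hd st))) (asgs K c) # tl (tl st)
     else if fst ins = enc_nat 9 then filter (\<lambda>a. \<exists>v\<in>set (univ c). ((fst a)[fst (snd ins) := v], snd a) \<in> set (hd st)) (asgs K c) # tl st
     else if fst ins = enc_nat 10 then filter (\<lambda>a. \<forall>v\<in>set (univ c). ((fst a)[fst (snd ins) := v], snd a) \<in> set (hd st)) (asgs K c) # tl st
     else if fst ins = enc_nat 11 then filter (\<lambda>a. \<exists>A\<in>set (subseqs (univ c)). (fst a, (snd a)[fst (snd ins) := A]) \<in> set (hd st)) (asgs K c) # tl st
     else filter (\<lambda>a. \<forall>A\<in>set (subseqs (univ c)). (fst a, (snd a)[fst (snd ins) := A]) \<in> set (hd st)) (asgs K c) # tl st)"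

definition feasible :: "kernel \<Rightarrow> (nat \<times> nat) list \<Rightarrow> bool" where
  "feasible K c \<longleftrightarrow> (replicate (knum K) (dummy c), (replicate (knum K) [])[fst (snd K) := filter (\<lambda>u. fst (snd u)) (univ c)])
     \<in> set (hd (fold (exec K c) (fst K) []))"

text \<open>The threshold demanded by \<open>msat_match\<close>.\<close>

definition threshold :: "kernel \<Rightarrow> nat" where
  "threshold K = 2 ^ length (fst K)"

definition tnum :: "kernel \<Rightarrow> nat" where
  "tnum K = length (fst (snd (snd (snd K))))"

text \<open>The \<open>M\<close> of \<open>normal_form\<close>; \<open>fbound\<close> is its bound
  on coefficients. Row \<open>M\<close> is included, so a candidate has \<open>Suc (rnum K)\<close>
  rows.\<close>

definition rnum :: "kernel \<Rightarrow> nat" where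
  "rnum K = 2 * ((threshold K + 1) * (threshold K + 1)) ^ tnum K"

definition fbound :: "kernel \<Rightarrow> nat" where
  "fbound K = (threshold K + 1) * (3 * tnum K + 3) ^ ((rnum K + 1) * tnum K)"

definition pairs :: "nat \<Rightarrow> (nat \<times> nat) list" where
  "pairs q = concat (map (\<lambda>a. map (\<lambda>b. (a, b)) [0..<Suc q]) [0..<Suc q])"

definition forms :: "kernel \<Rightarrow> nat list list" where
  "forms K = product_lists (replicate (Suc (tnum K)) [0..<Suc (fbound K)])"

text \<open>An integer linear form is represented as the difference of two forms with natural
  coefficients.\<close>

definition fpairs :: "kernel \<Rightarrow> (nat list \<times> nat list) list" where
  "fpairs K = concat (map (\<lambda>a. map (\<lambda>b. (a, b)) (forms K)) (forms K))"

type_synonym outp = "nat \<times> (nat \<times> nat) list list \<times> (nat list \<times> nat list) list list list"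

definition solve :: "kernel \<Rightarrow> outp" where
  "solve K = (threshold K, filter (\<lambda>c. feasible K c) (product_lists (replicate (tnum K) (pairs (threshold K)))),
     product_lists (replicate (Suc (rnum K)) (product_lists (replicate (tnum K) (fpairs K)))))"

lemma fc_univ: "fc fast univ"
  unfolding univ_def by (intro fc_intros)

lemma fc_kparts [fc_intros]:
  "fc fast a \<Longrightarrow> fc fast (\<lambda>e. univ (a e))"
  "fc fast a \<Longrightarrow> fc fast (\<lambda>e. dummy (a e))"
  "fc fast k \<Longrightarrow> fc fast (\<lambda>e. knum (k e))"
  "fc fast k \<Longrightarrow> fc fast (\<lambda>e. tnum (k e))"
  "fc fast k \<Longrightarrow> fc fast (\<lambda>e. threshold (k e))"
  "fc fast l \<Longrightarrow> fc fast n \<Longrightarrow> fc fast (\<lambda>e. get (l e) (n e))"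
proof -
  show "fc fast a \<Longrightarrow> fc fast (\<lambda>e. univ (a e))" by (rule cf.fc_comp[OF fc_univ])
qed (unfold dummy_def knum_def tnum_def threshold_def get_def, intro fc_intros; assumption)+

lemma fc_asgs: "fc fast (\<lambda>p. asgs (fst p) (snd p))"
  unfolding asgs_def by (intro fc_intros)

lemma fc_asgs' [fc_intros]: "fc fast k \<Longrightarrow> fc fast a \<Longrightarrow> fc fast (\<lambda>e. asgs (k e) (a e))"
  by (rule cf.fc_comp2[OF fc_asgs])

lemma fc_kadj: "fc fast (\<lambda>p. kadj (fst p) (fst (snd p)) (snd (snd p)))"
  unfolding kadj_def by (intro fc_intros)

lemma fc_kcol: "fc fast (\<lambda>p. kcol (fst p) (fst (snd p)) (snd (snd p)))"
  unfolding kcol_def by (intro fc_intros)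

lemmas fc_katoms [fc_intros] = cf.fc_comp3[OF fc_kadj] cf.fc_comp3[OF fc_kcol]

lemma fc_exec: "fc fast (\<lambda>p. exec (fst (fst p)) (snd (fst p)) (fst (snd p)) (snd (snd p)))"
  unfolding exec_def by (intro fc_intros)

lemma fc_feasible: "fc fast (\<lambda>p. feasible (fst p) (snd p))"
proof -
  show ?thesis unfolding feasible_def by (intro fc_intros fc_exec)
qed

lemmas fc_feasible' [fc_intros] = cf.fc_comp2[OF fc_feasible]

lemma fc_knums [fc_intros]:
  "fc fast k \<Longrightarrow> fc fast (\<lambda>e. rnum (k e))" "fc fast k \<Longrightarrow> fc fast (\<lambda>e. fbound (k e))"
proof -
  have r: "fc fast (\<lambda>k. rnum k)" unfolding rnum_def by (intro fc_intros)
  have f: "fc fast (\<lambda>k. fbound k)" unfolding fbound_def by (intro fc_intros cf.fc_comp[OF r])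
  show "fc fast k \<Longrightarrow> fc fast (\<lambda>e. rnum (k e))" "fc fast k \<Longrightarrow> fc fast (\<lambda>e. fbound (k e))"
    by (rule cf.fc_comp[OF r] cf.fc_comp[OF f]; assumption)+
qed

lemma fc_solve: "fc fast solve"
  unfolding solve_def pairs_def fpairs_def forms_def by (intro fc_intros)

section \<open>Evaluation of the candidates and expansion of the best one\<close>

definition evalf :: "nat list \<Rightarrow> nat list \<Rightarrow> nat" where
  "evalf ns f = sum_list (map (\<lambda>p. fst p * snd p) (zip f (1 # ns)))"

definition sizes :: "inst \<Rightarrow> nat list" where
  "sizes i = map length (classes i)"

text \<open>One vertex decides for its cell, since no cell crosses the source or the target.\<close>

definition svec :: "inst \<Rightarrow> tree list \<Rightarrow> nat list" where
  "svec i S = map (\<lambda>A. if hd A \<in> set S then length A else 0) (classes i)"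

definition lcl :: "nat \<Rightarrow> nat list \<Rightarrow> nat list \<Rightarrow> (nat \<times> nat) list" where
  "lcl q ns x = map (\<lambda>p. (min (fst p) q, min (snd p - fst p) q)) (zip x ns)"

definition ldist :: "nat list \<Rightarrow> nat list \<Rightarrow> nat" where
  "ldist x y = sum_list (map (\<lambda>p. (fst p - snd p) + (snd p - fst p)) (zip x y))"

definition llinked :: "nat \<Rightarrow> nat list \<Rightarrow> nat list \<Rightarrow> nat list \<Rightarrow> bool" where
  "llinked q ns x y \<longleftrightarrow> lcl q ns x = lcl q ns y \<or>
     (\<forall>p\<in>set (zip x y). (fst p - snd p) + (snd p - fst p) \<le> 1) \<and> ldist x y \<le> 2"

definition valid :: "inst \<Rightarrow> outp \<Rightarrow> nat list list \<Rightarrow> bool" where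
  "valid i r rows \<longleftrightarrow> hd rows = svec i (src i) \<and> hd (rev rows) = svec i (tgt i) \<and>
     (\<forall>x\<in>set rows. (\<forall>p\<in>set (zip x (sizes i)). fst p \<le> snd p) \<and> lcl (fst r) (sizes i) x \<in> set (fst (snd r)) \<and>
        sum_list x = sum_list (svec i (src i))) \<and>
     (\<forall>p\<in>set (zip rows (tl rows)). llinked (fst r) (sizes i) (fst p) (snd p))"

definition lcost :: "nat list list \<Rightarrow> nat" where
  "lcost rows = sum_list (map (\<lambda>p. ldist (fst p) (snd p)) (zip rows (tl rows)))"

text \<open>A negative value is truncated to 0 by the subtraction. This is harmless, as
  \<open>valid\<close> judges the resulting vectors and not the forms.\<close>

definition valids :: "inst \<Rightarrow> outp \<Rightarrow> nat list list list" where
  "valids i r = filter (\<lambda>rows. valid i r rows)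
     (map (\<lambda>rows. map (\<lambda>row. map (\<lambda>f. evalf (sizes i) (fst f) - evalf (sizes i) (snd f)) row) rows) (snd (snd r)))"

definition best :: "inst \<Rightarrow> outp \<Rightarrow> nat list list" where
  "best i r = hd (filter (\<lambda>x. \<forall>y\<in>set (valids i r). lcost x \<le> lcost y) (valids i r))"

definition inc1 :: "nat list \<Rightarrow> nat list \<Rightarrow> nat list" where
  "inc1 y x = (let J = filter (\<lambda>p. fst (snd p) < snd (snd p)) (zip [0..<length x] (zip x y)) in
     if J = [] then x else x[fst (hd J) := Suc (fst (snd (hd J)))])"

definition dec1 :: "nat list \<Rightarrow> nat list \<Rightarrow> nat list" where
  "dec1 y x = (let J = filter (\<lambda>p. snd (snd p) < fst (snd p)) (zip [0..<length x] (zip x y)) in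
     if J = [] then x else x[fst (hd J) := fst (snd (hd J)) - 1])"

text \<open>Begins with \<open>x\<close> and ends one move before \<open>y\<close>, so segments
  concatenate without repetition and \<open>expand\<close> has to append the last row. The number of
  moves is the total excess of \<open>x\<close> over \<open>y\<close>.\<close>

definition seg :: "nat list \<Rightarrow> nat list \<Rightarrow> nat list list" where
  "seg x y = map (\<lambda>i. ((\<lambda>z. dec1 y (inc1 y z)) ^^ i) x) [0..<sum_list (map (\<lambda>p. fst p - snd p) (zip x y))]"

definition expand :: "nat list list \<Rightarrow> nat list list" where
  "expand rows = concat (map (\<lambda>p. seg (fst p) (snd p)) (zip rows (tl rows))) @ [hd (rev rows)]"

text \<open>Initial segments of the cells: raising a count by one adds exactly one vertex. Filtering
  \<open>vlist\<close> yields the sorted order used by \<open>enc_vset\<close>.\<close>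

definition canon :: "inst \<Rightarrow> nat list \<Rightarrow> tree list" where
  "canon i x = filter (\<lambda>u. \<exists>p\<in>set (zip x (classes i)). u \<in> set (take (fst p) (snd p))) (vlist i)"

definition decide :: "inst \<Rightarrow> outp \<Rightarrow> bool" where
  "decide i r \<longleftrightarrow> valids i r \<noteq> []"

definition search :: "inst \<Rightarrow> outp \<Rightarrow> tree list list" where
  "search i r = map (\<lambda>x. canon i x) (expand (best i r))"

lemma sz_list_update: "i < length xs \<Longrightarrow> sz (xs[i := v]) + sz (xs ! i) = sz xs + sz v"
proof (induction xs arbitrary: i)
  case (Cons x xs) then show ?case by (cases i) auto
qed simp

lemma sz_update_le: "(j, a, b) \<in> set (zip [0..<length x] (zip x y)) \<Longrightarrow> v \<le> Suc a \<Longrightarrow> sz (x[j := v]) \<le> sz x + 2"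
  for x :: "nat list"
proof -
  assume "(j, a, b) \<in> set (zip [0..<length x] (zip x y))" and v: "v \<le> Suc a"
  then have j: "j < length x" "a = x ! j" by (auto simp: set_zip)
  show ?thesis using sz_list_update[OF j(1), of v] v j(2) by simp
qed

text \<open>Growth by a constant per step keeps the iteration in \<open>seg\<close> within
  polynomial bounds.\<close>

lemma sz_inc1: "sz (inc1 y x) \<le> sz x + 2" and sz_dec1: "sz (dec1 y x) \<le> sz x + 2"
proof -
  have *: "sz (if filter P L = [] then x else x[fst (hd (filter P L)) := f (hd (filter P L))]) \<le> sz x + 2"
    if L: "L = zip [0..<length x] (zip x y)" and f: "\<And>p. f p \<le> Suc (fst (snd p))" for L P f
  proof (cases "filter P L = []")
    case False
    then have "hd (filter P L) \<in> set L" by (meson filter_is_subset hd_in_set subsetD)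
    moreover obtain j a b where h: "hd (filter P L) = (j, a, b)" by (cases "hd (filter P L)") auto
    ultimately have "sz (x[j := f (j, a, b)]) \<le> sz x + 2"
      using f[of "(j, a, b)"] by (intro sz_update_le[of j a b x y]) (simp_all add: L)
    then show ?thesis using False by (simp add: h)
  qed simp
  show "sz (inc1 y x) \<le> sz x + 2" unfolding inc1_def Let_def by (rule *[OF refl]) simp
  show "sz (dec1 y x) \<le> sz x + 2" unfolding dec1_def Let_def by (rule *[OF refl]) simp
qed

context resource
begin

lemma fc_lists [fc_intros]:
  "fc B a \<Longrightarrow> fc B (\<lambda>e. sizes (a e))"
  "fc B a \<Longrightarrow> fc B b \<Longrightarrow> fc B (\<lambda>e. svec (a e) (b e))"
  "fc B u \<Longrightarrow> fc B v \<Longrightarrow> fc B (\<lambda>e. evalf (u e) (v e))"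
  "fc B q \<Longrightarrow> fc B u \<Longrightarrow> fc B v \<Longrightarrow> fc B (\<lambda>e. lcl (q e) (u e) (v e))"
  "fc B u \<Longrightarrow> fc B v \<Longrightarrow> fc B (\<lambda>e. ldist (u e) (v e))"
proof -
  have 1: "fc B (\<lambda>i. sizes i)" unfolding sizes_def by (intro fc_intros)
  have 2: "fc B (\<lambda>p. svec (fst p) (snd p))" unfolding svec_def by (intro fc_intros)
  have 3: "fc B (\<lambda>p. evalf (fst p) (snd p))" unfolding evalf_def by (intro fc_intros)
  have 4: "fc B (\<lambda>p. lcl (fst p) (fst (snd p)) (snd (snd p)))" unfolding lcl_def by (intro fc_intros)
  have 5: "fc B (\<lambda>p. ldist (fst p) (snd p))" unfolding ldist_def by (intro fc_intros)
  show "fc B a \<Longrightarrow> fc B (\<lambda>e. sizes (a e))" by (rule fc_comp[OF 1])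
  show "fc B a \<Longrightarrow> fc B b \<Longrightarrow> fc B (\<lambda>e. svec (a e) (b e))" by (rule fc_comp2[OF 2])
  show "fc B u \<Longrightarrow> fc B v \<Longrightarrow> fc B (\<lambda>e. evalf (u e) (v e))" by (rule fc_comp2[OF 3])
  show "fc B q \<Longrightarrow> fc B u \<Longrightarrow> fc B v \<Longrightarrow> fc B (\<lambda>e. lcl (q e) (u e) (v e))" by (rule fc_comp3[OF 4])
  show "fc B u \<Longrightarrow> fc B v \<Longrightarrow> fc B (\<lambda>e. ldist (u e) (v e))" by (rule fc_comp2[OF 5])
qed

lemma fc_lcost [fc_intros]: "fc B a \<Longrightarrow> fc B (\<lambda>e. lcost (a e))"
proof -
  have 1: "fc B (\<lambda>i. lcost i)" unfolding lcost_def by (intro fc_intros)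
  show "fc B a \<Longrightarrow> fc B (\<lambda>e. lcost (a e))" by (rule fc_comp[OF 1])
qed

lemma fc_valids [fc_intros]: "fc B a \<Longrightarrow> fc B b \<Longrightarrow> fc B (\<lambda>e. valids (a e) (b e))"
proof -
  have v: "fc B (\<lambda>p. valid (fst p) (fst (snd p)) (snd (snd p)))"
    unfolding valid_def llinked_def by (intro fc_intros)
  have 1: "fc B (\<lambda>p. valids (fst p) (snd p))" unfolding valids_def
    by (intro fc_intros fc_comp3[OF v])
  show "fc B a \<Longrightarrow> fc B b \<Longrightarrow> fc B (\<lambda>e. valids (a e) (b e))" by (rule fc_comp2[OF 1])
qed

lemma fc_seg [fc_intros]: "fc B a \<Longrightarrow> fc B b \<Longrightarrow> fc B (\<lambda>e. seg (a e) (b e))"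
proof -
  have i: "fc B (\<lambda>p. inc1 (fst p) (snd p))" unfolding inc1_def by (intro fc_intros)
  have d: "fc B (\<lambda>p. dec1 (fst p) (snd p))" unfolding dec1_def by (intro fc_intros fc_diff)
  have st: "fc B (\<lambda>p. ((\<lambda>z. dec1 (fst p) (inc1 (fst p) z)) ^^ snd (snd p)) (fst (snd p)))"
  proof (rule fc_funpow_additive[OF _ _ _ bd_const[of 4]])
    show "fc B (\<lambda>p. dec1 (fst (fst p)) (inc1 (fst (fst p)) (snd p)))"
      by (rule fc_comp2[OF d] fc_comp2[OF i] | intro fc_intros)+
    show "sz (dec1 (fst p) (inc1 (fst p) z)) \<le> sz z + 4" for p :: "nat list \<times> nat list \<times> nat" and z
      using sz_dec1[of "fst p" "inc1 (fst p) z"] sz_inc1[of "fst p" z] by linarith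
  qed (intro fc_intros)+
  have 1: "fc B (\<lambda>p. seg (fst p) (snd p))" unfolding seg_def
    by (intro fc_intros fc_comp3[OF st])
  show "fc B a \<Longrightarrow> fc B b \<Longrightarrow> fc B (\<lambda>e. seg (a e) (b e))" by (rule fc_comp2[OF 1])
qed

lemma fc_decide: "fc B (\<lambda>p. decide (fst p) (snd p))"
  unfolding decide_def by (intro fc_intros)

lemma fc_search: "fc B (\<lambda>p. search (fst p) (snd p))"
  unfolding search_def expand_def best_def canon_def by (intro fc_intros)

end


section \<open>Correctness of the model checker\<close>

lemma idx_length: "idx nms x \<le> length nms"
  unfolding idx_def by (induction nms) auto

lemma idx_less: "x \<in> set nms \<Longrightarrow> idx nms x < length nms \<and> nms ! idx nms x = x"
  unfolding idx_def by (induction nms) auto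

lemma idx_notin: "x \<notin> set nms \<Longrightarrow> idx nms x = length nms"
  unfolding idx_def by (induction nms) auto

lemma idx_eq_iff: "x \<in> set nms \<Longrightarrow> idx nms y = idx nms x \<longleftrightarrow> y = x"
  using idx_less[of x nms] idx_less[of y nms] idx_notin[of y nms] by (cases "y \<in> set nms") auto

lemma get_nth: "i < length xs \<Longrightarrow> get xs i = xs ! i"
  by (simp add: get_def hd_drop_conv_nth)

lemma get_update: "get (xs[i := v]) j = (if j = i \<and> i < length xs then v else get xs j)"
proof (cases "j < length xs")
  case True then show ?thesis by (simp add: get_nth nth_list_update)
next
  case False then show ?thesis by (auto simp: get_def)
qed

lemma set_product_replicate: "set (product_lists (replicate n xs)) = {ys. length ys = n \<and> set ys \<subseteq> set xs}"
proof (induction n)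
  case (Suc n)
  have "set (product_lists (replicate (Suc n) xs)) = {y # ys |y ys. y \<in> set xs \<and> ys \<in> set (product_lists (replicate n xs))}"
    by auto
  also have "\<dots> = {ys. length ys = Suc n \<and> set ys \<subseteq> set xs}"
    unfolding Suc by (auto simp: length_Suc_conv)
  finally show ?case .
qed auto

lemma set_asgs: "set (asgs K c) = {a. length (fst a) = knum K \<and> set (fst a) \<subseteq> set (dummy c # univ c) \<and>
    length (snd a) = knum K \<and> set (snd a) \<subseteq> set (subseqs (univ c))}"
  unfolding asgs_def by (auto simp: set_product_replicate image_iff)

definition kmsat :: "kernel \<Rightarrow> (nat \<times> nat) list \<Rightarrow> tree list \<Rightarrow> mso1 \<Rightarrow> assignment \<Rightarrow> bool" where
  "kmsat K c nms p a \<longleftrightarrow> msat (set (univ c)) (kadj K) (\<lambda>i. kcol K (idx nms (enc_nat i))) p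
     (\<lambda>x. get (fst a) (idx nms (enc_nat x))) (\<lambda>X. set (get (snd a) (idx nms (enc_nat X))))"

definition rename :: "tree list \<Rightarrow> tree \<times> tree \<times> tree \<Rightarrow> tree \<times> nat \<times> nat" where
  "rename nms c = (fst c, idx nms (fst (snd c)), idx nms (snd (snd c)))"

definition cnames :: "(tree \<times> tree \<times> tree) list \<Rightarrow> tree set" where
  "cnames cd = (\<Union>c\<in>set cd. {fst (snd c), snd (snd c)})"

lemma cnames_simps [simp]: "cnames [] = {}" "cnames (c # cd) = {fst (snd c), snd (snd c)} \<union> cnames cd"
  "cnames (cd @ cd') = cnames cd \<union> cnames cd'"
  by (auto simp: cnames_def)

abbreviation tab where "tab K c nms p \<equiv> filter (kmsat K c nms p) (asgs K c)"

lemma kmsat_upd_vertex: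
  assumes "knum K = length nms" "enc_nat x \<in> set nms" "a \<in> set (asgs K c)" "v \<in> set (univ c)"
  shows "((fst a)[idx nms (enc_nat x) := v], snd a) \<in> set (tab K c nms p) \<longleftrightarrow>
    msat (set (univ c)) (kadj K) (\<lambda>i. kcol K (idx nms (enc_nat i))) p
      ((\<lambda>x. get (fst a) (idx nms (enc_nat x)))(x := v)) (\<lambda>X. set (get (snd a) (idx nms (enc_nat X))))"
proof -
  have l: "length (fst a) = length nms" using assms(1,3) by (simp add: set_asgs)
  have "((fst a)[idx nms (enc_nat x) := v], snd a) \<in> set (asgs K c)"
    using assms(3,4) set_update_subset_insert[of "fst a" "idx nms (enc_nat x)" v] by (auto simp: set_asgs)
  moreover have "(\<lambda>y. get ((fst a)[idx nms (enc_nat x) := v]) (idx nms (enc_nat y))) = (\<lambda>x. get (fst a) (idx nms (enc_nat x)))(x := v)"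
    by (rule ext) (simp add: get_update l idx_less[OF assms(2)] idx_eq_iff[OF assms(2)] enc_nat_inject)
  ultimately show ?thesis by (simp add: kmsat_def)
qed

lemma kmsat_upd_set:
  assumes "knum K = length nms" "enc_nat X \<in> set nms" "a \<in> set (asgs K c)" "A \<in> set (subseqs (univ c))"
  shows "(fst a, (snd a)[idx nms (enc_nat X) := A]) \<in> set (tab K c nms p) \<longleftrightarrow>
    msat (set (univ c)) (kadj K) (\<lambda>i. kcol K (idx nms (enc_nat i))) p
      (\<lambda>x. get (fst a) (idx nms (enc_nat x))) ((\<lambda>X. set (get (snd a) (idx nms (enc_nat X))))(X := set A))"
proof -
  have l: "length (snd a) = length nms" using assms(1,3) by (simp add: set_asgs)
  have "(fst a, (snd a)[idx nms (enc_nat X) := A]) \<in> set (asgs K c)"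
    using assms(3,4) set_update_subset_insert[of "snd a" "idx nms (enc_nat X)" A] by (auto simp: set_asgs)
  moreover have "(\<lambda>Y. set (get ((snd a)[idx nms (enc_nat X) := A]) (idx nms (enc_nat Y)))) =
      (\<lambda>X. set (get (snd a) (idx nms (enc_nat X))))(X := set A)"
    by (rule ext) (simp add: get_update l idx_less[OF assms(2)] idx_eq_iff[OF assms(2)] enc_nat_inject)
  ultimately show ?thesis by (simp add: kmsat_def)
qed

lemma ex_subseqs: "(\<exists>A\<in>set (subseqs U). P (set A)) \<longleftrightarrow> (\<exists>A\<subseteq>set U. P A)"
proof -
  have "(\<exists>A\<in>set (subseqs U). P (set A)) \<longleftrightarrow> (\<exists>A\<in>set ` set (subseqs U). P A)" by simp
  then show ?thesis unfolding subseqs_powset by (auto simp: Pow_def)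
qed

lemma all_subseqs: "(\<forall>A\<in>set (subseqs U). P (set A)) \<longleftrightarrow> (\<forall>A\<subseteq>set U. P A)"
proof -
  have "(\<forall>A\<in>set (subseqs U). P (set A)) \<longleftrightarrow> (\<forall>A\<in>set ` set (subseqs U). P A)" by simp
  then show ?thesis unfolding subseqs_powset by (auto simp: Pow_def)
qed

text \<open>The induction needs an arbitrary stack below: the second operand is executed on top of
  the table of the first.\<close>

lemma exec_code:
  assumes "knum K = length nms" "cnames (code p) \<subseteq> set nms"
  shows "fold (exec K c) (map (rename nms) (code p)) st = tab K c nms p # st"
  using assms(2)
proof (induction p arbitrary: st)
  case (VEq x y) show ?case by (simp add: exec_def rename_def enc_nat_inject kmsat_def)
next
  case (Adj x y) show ?case by (simp add: exec_def rename_def enc_nat_inject kmsat_def)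
next
  case (Color x y) show ?case by (simp add: exec_def rename_def enc_nat_inject kmsat_def)
next
  case (Mem x y) show ?case by (simp add: exec_def rename_def enc_nat_inject kmsat_def)
next
  case (Neg p)
  have "fold (exec K c) (map (rename nms) (code (Neg p))) st = exec K c (rename nms (enc_nat 4, Leaf, Leaf)) (tab K c nms p # st)"
    using Neg by simp
  also have "\<dots> = tab K c nms (Neg p) # st"
    by (simp add: exec_def rename_def enc_nat_inject kmsat_def cong: filter_cong)
  finally show ?case .
next
  case (Conj p q)
  have "fold (exec K c) (map (rename nms) (code (Conj p q))) st = exec K c (rename nms (enc_nat 5, Leaf, Leaf)) (tab K c nms q # tab K c nms p # st)"
    using Conj by simp
  also have "\<dots> = tab K c nms (Conj p q) # st"
    by (simp add: exec_def rename_def enc_nat_inject kmsat_def cong: filter_cong)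
  finally show ?case .
next
  case (Disj p q)
  have "fold (exec K c) (map (rename nms) (code (Disj p q))) st = exec K c (rename nms (enc_nat 6, Leaf, Leaf)) (tab K c nms q # tab K c nms p # st)"
    using Disj by simp
  also have "\<dots> = tab K c nms (Disj p q) # st"
    by (simp add: exec_def rename_def enc_nat_inject kmsat_def cong: filter_cong)
  finally show ?case .
next
  case (Imp p q)
  have "fold (exec K c) (map (rename nms) (code (Imp p q))) st = exec K c (rename nms (enc_nat 7, Leaf, Leaf)) (tab K c nms q # tab K c nms p # st)"
    using Imp by simp
  also have "\<dots> = tab K c nms (Imp p q) # st"
    by (simp add: exec_def rename_def enc_nat_inject kmsat_def cong: filter_cong)
  finally show ?case .
next
  case (Iff p q)
  have "fold (exec K c) (map (rename nms) (code (Iff p q))) st = exec K c (rename nms (enc_nat 8, Leaf, Leaf)) (tab K c nms q # tab K c nms p # st)"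
    using Iff by simp
  also have "\<dots> = tab K c nms (Iff p q) # st"
    by (simp add: exec_def rename_def enc_nat_inject kmsat_def cong: filter_cong)
  finally show ?case .
next
  case (ExV x p)
  have x: "enc_nat x \<in> set nms" using ExV.prems by simp
  have "fold (exec K c) (map (rename nms) (code (ExV x p))) st = exec K c (rename nms (enc_nat 9, enc_nat x, Leaf)) (tab K c nms p # st)"
    using ExV by simp
  also have "\<dots> = filter (\<lambda>a. \<exists>v\<in>set (univ c). ((fst a)[idx nms (enc_nat x) := v], snd a) \<in> set (tab K c nms p)) (asgs K c) # st"
    by (simp only: exec_def rename_def enc_nat_inject fst_conv snd_conv list.sel) simp
  also have "\<dots> = tab K c nms (ExV x p) # st"
  proof (rule arg_cong[where f = "\<lambda>L. L # st"], rule filter_cong[OF refl])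
    fix a assume a: "a \<in> set (asgs K c)"
    show "(\<exists>v\<in>set (univ c). ((fst a)[idx nms (enc_nat x) := v], snd a) \<in> set (tab K c nms p)) \<longleftrightarrow> kmsat K c nms (ExV x p) a"
      unfolding kmsat_def[of K c nms "ExV x p" a] msat.simps by (rule bex_cong[OF refl], rule kmsat_upd_vertex[OF assms(1) x a])
  qed
  finally show ?case .
next
  case (AllV x p)
  have x: "enc_nat x \<in> set nms" using AllV.prems by simp
  have "fold (exec K c) (map (rename nms) (code (AllV x p))) st = exec K c (rename nms (enc_nat 10, enc_nat x, Leaf)) (tab K c nms p # st)"
    using AllV by simp
  also have "\<dots> = filter (\<lambda>a. \<forall>v\<in>set (univ c). ((fst a)[idx nms (enc_nat x) := v], snd a) \<in> set (tab K c nms p)) (asgs K c) # st"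
    by (simp only: exec_def rename_def enc_nat_inject fst_conv snd_conv list.sel) simp
  also have "\<dots> = tab K c nms (AllV x p) # st"
  proof (rule arg_cong[where f = "\<lambda>L. L # st"], rule filter_cong[OF refl])
    fix a assume a: "a \<in> set (asgs K c)"
    show "(\<forall>v\<in>set (univ c). ((fst a)[idx nms (enc_nat x) := v], snd a) \<in> set (tab K c nms p)) \<longleftrightarrow> kmsat K c nms (AllV x p) a"
      unfolding kmsat_def[of K c nms "AllV x p" a] msat.simps by (rule ball_cong[OF refl], rule kmsat_upd_vertex[OF assms(1) x a])
  qed
  finally show ?case .
next
  case (ExS X p)
  have x: "enc_nat X \<in> set nms" using ExS.prems by simp
  have "fold (exec K c) (map (rename nms) (code (ExS X p))) st = exec K c (rename nms (enc_nat 11, enc_nat X, Leaf)) (tab K c nms p # st)"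
    using ExS by simp
  also have "\<dots> = filter (\<lambda>a. \<exists>A\<in>set (subseqs (univ c)). (fst a, (snd a)[idx nms (enc_nat X) := A]) \<in> set (tab K c nms p)) (asgs K c) # st"
    by (simp only: exec_def rename_def enc_nat_inject fst_conv snd_conv list.sel) simp
  also have "\<dots> = tab K c nms (ExS X p) # st"
  proof (rule arg_cong[where f = "\<lambda>L. L # st"], rule filter_cong[OF refl])
    fix a assume a: "a \<in> set (asgs K c)"
    show "(\<exists>A\<in>set (subseqs (univ c)). (fst a, (snd a)[idx nms (enc_nat X) := A]) \<in> set (tab K c nms p)) \<longleftrightarrow> kmsat K c nms (ExS X p) a"
      unfolding kmsat_def[of K c nms "ExS X p" a] msat.simps ex_subseqs[symmetric] by (rule bex_cong[OF refl], rule kmsat_upd_set[OF assms(1) x a])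
  qed
  finally show ?case .
next
  case (AllS X p)
  have x: "enc_nat X \<in> set nms" using AllS.prems by simp
  have "fold (exec K c) (map (rename nms) (code (AllS X p))) st = exec K c (rename nms (enc_nat 12, enc_nat X, Leaf)) (tab K c nms p # st)"
    using AllS by simp
  also have "\<dots> = filter (\<lambda>a. \<forall>A\<in>set (subseqs (univ c)). (fst a, (snd a)[idx nms (enc_nat X) := A]) \<in> set (tab K c nms p)) (asgs K c) # st"
    by (simp only: exec_def rename_def enc_nat_inject fst_conv snd_conv list.sel) simp
  also have "\<dots> = tab K c nms (AllS X p) # st"
  proof (rule arg_cong[where f = "\<lambda>L. L # st"], rule filter_cong[OF refl])
    fix a assume a: "a \<in> set (asgs K c)"
    show "(\<forall>A\<in>set (subseqs (univ c)). (fst a, (snd a)[idx nms (enc_nat X) := A]) \<in> set (tab K c nms p)) \<longleftrightarrow> kmsat K c nms (AllS X p) a"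
      unfolding kmsat_def[of K c nms "AllS X p" a] msat.simps all_subseqs[symmetric] by (rule ball_cong[OF refl], rule kmsat_upd_set[OF assms(1) x a])
  qed
  finally show ?case .
qed

lemma set_univ: "(t, b, i) \<in> set (univ c) \<longleftrightarrow> t < length c \<and> i < (if b then fst (c ! t) else snd (c ! t))"
proof -
  have "zip [0..<length c] c = map (\<lambda>k. (k, c ! k)) [0..<length c]" by (rule nth_equalityI) auto
  then have z: "set (zip [0..<length c] c) = (\<lambda>k. (k, c ! k)) ` {..<length c}" by (simp add: atLeast0LessThan)
  show ?thesis unfolding univ_def set_concat set_map z by (cases b) (auto intro!: bexI[of _ t])
qed

lemma filter_in_subseqs: "filter P xs \<in> set (subseqs xs)"
  by (induction xs) (auto simp: Let_def)

text \<open>Applied to a formula whose only free variable is \<open>X\<close>, where the other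
  values are irrelevant and can stay existential.\<close>

lemma feasible_iff:
  assumes K: "fst K = map (rename nms) (code p)" "fst (snd K) = idx nms (enc_nat X)" "knum K = length nms"
    and nms: "cnames (code p) \<subseteq> set nms" "enc_nat X \<in> set nms"
  shows "\<exists>\<alpha> \<beta>. \<beta> X = {u \<in> set (univ c). fst (snd u)} \<and>
    (feasible K c \<longleftrightarrow> msat (set (univ c)) (kadj K) (\<lambda>i. kcol K (idx nms (enc_nat i))) p \<alpha> \<beta>)"
proof -
  let ?a = "(replicate (knum K) (dummy c), (replicate (knum K) [])[fst (snd K) := filter (\<lambda>u. fst (snd u)) (univ c)])"
  have sub: "filter (\<lambda>u. fst (snd u)) (univ c) \<in> set (subseqs (univ c))" "[] \<in> set (subseqs (univ c))"
    using filter_in_subseqs[of "\<lambda>_. False" "univ c"] by (auto intro: filter_in_subseqs)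
  have "?a \<in> set (asgs K c)"
    using sub set_update_subset_insert[of "replicate (knum K) []" "fst (snd K)" "filter (\<lambda>u. fst (snd u)) (univ c)"]
    by (auto simp: set_asgs set_replicate_conv_if split: if_splits)
  moreover have "hd (fold (exec K c) (fst K) []) = tab K c nms p"
    unfolding K(1) exec_code[OF K(3) nms(1)] by simp
  ultimately have "feasible K c \<longleftrightarrow> kmsat K c nms p ?a" by (simp add: feasible_def)
  moreover have "set (get (snd ?a) (idx nms (enc_nat X))) = {u \<in> set (univ c). fst (snd u)}"
    using idx_less[OF nms(2)] K(2,3) by (simp add: get_update)
  ultimately show ?thesis unfolding kmsat_def by (intro exI conjI)
qed


section \<open>Types of vertices\<close>

lemma no_loop: "colored_graph G \<Longrightarrow> {u, u} \<notin> edges G"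
proof
  assume G: "colored_graph G" and e: "{u, u} \<in> edges G"
  have "\<forall>e\<in>edges G. \<exists>a\<in>verts G. \<exists>b\<in>verts G. a \<noteq> b \<and> e = {a, b}" using G by (simp add: colored_graph_def)
  from bspec[OF this e] show False by auto
qed

lemma mem_nbhd: "v \<in> verts G \<Longrightarrow> v \<in> nbhd G u \<longleftrightarrow> {u, v} \<in> edges G"
  by (simp add: nbhd_def)

lemma twins_sym: "twins G u v \<Longrightarrow> twins G v u"
  by (auto simp: twins_def)

lemma twins_swap:
  assumes "twins G a b" "c \<in> verts G" "c \<noteq> a" "c \<noteq> b"
  shows "{a, c} \<in> edges G \<longleftrightarrow> {b, c} \<in> edges G"
proof -
  have "c \<in> nbhd G a \<longleftrightarrow> c \<in> nbhd G b"
    using assms(1,3,4) unfolding twins_def closed_nbhd_def by blast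
  then show ?thesis using assms(2) by (simp add: mem_nbhd)
qed

text \<open>The endpoints are exchanged one at a time, and \<open>twins_swap\<close> wants the fixed
  endpoint to differ from both twins. For \<open>v = u'\<close> the exchange begins at the other
  endpoint, and if also \<open>u = v'\<close> the two pairs coincide.\<close>

lemma twins_adjacent:
  assumes "colored_graph G" "u \<in> verts G" "v \<in> verts G" "u' \<in> verts G" "v' \<in> verts G"
    and "twins G u u'" "twins G v v'" "u = v \<longleftrightarrow> u' = v'"
  shows "{u, v} \<in> edges G \<longleftrightarrow> {u', v'} \<in> edges G"
proof (cases "u = v")
  case True then show ?thesis using assms(8) no_loop[OF assms(1)] by simp
next
  case False
  then have ne: "u \<noteq> v" "u' \<noteq> v'" using assms(8) by auto
  show ?thesis
  proof (cases "v = u'")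
    case False
    have "{u, v} \<in> edges G \<longleftrightarrow> {u', v} \<in> edges G" by (rule twins_swap[OF assms(6,3)]) (use ne False in auto)
    also have "\<dots> \<longleftrightarrow> {v, u'} \<in> edges G" by (simp add: insert_commute)
    also have "\<dots> \<longleftrightarrow> {v', u'} \<in> edges G" by (rule twins_swap[OF assms(7,4)]) (use ne False in auto)
    finally show ?thesis by (simp add: insert_commute)
  next
    case True
    show ?thesis
    proof (cases "u = v'")
      case uv: True then show ?thesis using True by (simp add: insert_commute)
    next
      case uv: False
      have "{u, v} \<in> edges G \<longleftrightarrow> {v, u} \<in> edges G" by (simp add: insert_commute)
      also have "\<dots> \<longleftrightarrow> {v', u} \<in> edges G" by (rule twins_swap[OF assms(7,2)]) (use ne uv in auto)
      also have "\<dots> \<longleftrightarrow> {u, v'} \<in> edges G" by (simp add: insert_commute)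
      also have "\<dots> \<longleftrightarrow> {u', v'} \<in> edges G" by (rule twins_swap[OF assms(6,5)]) (use ne uv in auto)
      finally show ?thesis .
    qed
  qed
qed

text \<open>Otherwise \<open>w\<close> is adjacent to \<open>v\<close> and hence to
  \<open>u\<close>; then \<open>u\<close> lies in the closed neighborhood of \<open>w\<close>, which
  is that of \<open>v\<close>, so \<open>u\<close> is adjacent to \<open>v\<close> and therefore to
  itself.\<close>

lemma twins_mixed:
  assumes G: "colored_graph G" "v \<in> verts G" "w \<in> verts G" "u \<in> verts G"
    and "nbhd G u = nbhd G v" "closed_nbhd G v = closed_nbhd G w"
  shows "u = v \<or> v = w"
proof (rule ccontr)
  assume "\<not> ?thesis"
  then have ne: "u \<noteq> v" "v \<noteq> w" by auto
  have "w \<in> closed_nbhd G v" unfolding assms(6) by (simp add: closed_nbhd_def)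
  then have "w \<in> nbhd G v" using ne by (simp add: closed_nbhd_def)
  then have "w \<in> nbhd G u" using assms(5) by simp
  then have "{u, w} \<in> edges G" by (simp add: nbhd_def)
  then have "u \<in> nbhd G w" using G(4) by (simp add: nbhd_def insert_commute)
  then have "u \<in> closed_nbhd G v" unfolding assms(6) by (simp add: closed_nbhd_def)
  then have "u \<in> nbhd G v" using ne by (simp add: closed_nbhd_def)
  then have "u \<in> nbhd G u" using assms(5) by simp
  then show False using no_loop[OF G(1)] by (simp add: nbhd_def)
qed

lemma twins_trans:
  assumes G: "colored_graph G" "u \<in> verts G" "v \<in> verts G" "w \<in> verts G" and t: "twins G u v" "twins G v w"
  shows "twins G u w"
proof -
  consider "nbhd G u = nbhd G v" "nbhd G v = nbhd G w" | "closed_nbhd G u = closed_nbhd G v" "closed_nbhd G v = closed_nbhd G w"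
    | "nbhd G u = nbhd G v" "closed_nbhd G v = closed_nbhd G w" | "closed_nbhd G u = closed_nbhd G v" "nbhd G v = nbhd G w"
    using t unfolding twins_def by blast
  then show ?thesis
  proof cases
    case 3
    from twins_mixed[OF G(1,3,4,2) 3] show ?thesis using t by (elim disjE) simp_all
  next
    case 4
    from twins_mixed[OF G(1,3,2,4) 4(2)[symmetric] 4(1)[symmetric]] show ?thesis using t by (elim disjE) simp_all
  qed (simp_all add: twins_def)
qed

lemma agree_min: "agree q x (min x q)"
  by (auto simp: agree_def)

lemma bin_funpow: "(bin_inc ^^ k) Leaf = enc_nat k"
  by (induction k) (simp_all add: bin_inc_enc_nat enc_nat_0)

lemma inj_enc_nat: "inj enc_nat"
  by (simp add: inj_def enc_nat_inject)

lemma enc_nat_image_mem [simp]: "enc_nat u \<in> enc_nat ` A \<longleftrightarrow> u \<in> A"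
  by (rule inj_image_mem_iff[OF inj_enc_nat])

section \<open>The cells of an instance, and truncated models\<close>

locale msor1_inst =
  fixes I :: msor1
  assumes inst: "I \<in> msor1_instances"
begin

abbreviation "G \<equiv> graph I"
abbreviation "V \<equiv> verts (graph I)"
abbreviation "J \<equiv> inst_of I"
abbreviation "nms \<equiv> inames (inst_of I)"
abbreviation "cls \<equiv> classes (inst_of I)"
abbreviation "T \<equiv> length (classes (inst_of I))"
abbreviation "K \<equiv> kern (inst_of I)"

lemma graph: "colored_graph G" and finV: "finite V"
  and closed: "free_vvars (formula I) = {}" "free_svars (formula I) = {free_var I}"
  and src_sub: "source I \<subseteq> V" and tgt_sub: "target I \<subseteq> V" and card_eq: "card (source I) = card (target I)"
  and src_sat: "models_set G (formula I) (free_var I) (source I)" and tgt_sat: "models_set G (formula I) (free_var I) (target I)"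
  using inst by (auto simp: msor1_instances_def colored_graph_def)

lemma vlist: "vlist J = map enc_nat (sorted_list_of_set V)" "set (vlist J) = enc_nat ` V" "distinct (vlist J)"
proof -
  show 1: "vlist J = map enc_nat (sorted_list_of_set V)" by (simp add: vlist_def inst_of_def)
  show "set (vlist J) = enc_nat ` V" using finV by (simp add: 1)
  show "distinct (vlist J)" unfolding 1 distinct_map using finV inj_enc_nat by (auto intro: inj_on_subset)
qed

lemma set_src: "set (src J) = enc_nat ` source I" and set_tgt: "set (tgt J) = enc_nat ` target I"
  using finite_subset[OF src_sub finV] finite_subset[OF tgt_sub finV] by (simp_all add: src_def tgt_def inst_of_def)

lemma finite_nbhd: "finite (nbhd G u)"
  using finV by (simp add: nbhd_def)

lemma set_nbrs: "u \<in> V \<Longrightarrow> set (nbrs J (enc_nat u)) = enc_nat ` nbhd G u"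
  using finV finite_nbhd by (simp add: nbrs_def inst_of_def filter_map comp_def enc_nat_inject) (auto simp: enc_nat_inject)

lemma incol_iff: "incol J c (enc_nat u) \<longleftrightarrow> (\<exists>k<length (colors G). c = enc_nat k \<and> u \<in> colors G ! k)"
proof -
  let ?n = "length (colors G)"
  have c: "cols J = map (\<lambda>C. map enc_nat (sorted_list_of_set C)) (colors G)" by (simp add: cols_def inst_of_def)
  have fin: "finite (colors G ! k)" if "k < ?n" for k
    using graph finV that unfolding colored_graph_def by (meson finite_subset nth_mem)
  have "zip (map (\<lambda>k. (bin_inc ^^ k) Leaf) [0..<length (cols J)]) (cols J) = map (\<lambda>k. (enc_nat k, cols J ! k)) [0..<?n]"
    by (rule nth_equalityI) (auto simp: c bin_funpow)
  then have "incol J c (enc_nat u) \<longleftrightarrow> (\<exists>k<?n. enc_nat k = c \<and> enc_nat u \<in> set (cols J ! k))"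
    unfolding incol_def by auto
  also have "\<dots> \<longleftrightarrow> (\<exists>k<?n. c = enc_nat k \<and> u \<in> colors G ! k)"
    using fin by (auto simp: c)
  finally show ?thesis .
qed

lemma seteq_nbrs: "u \<in> V \<Longrightarrow> v \<in> V \<Longrightarrow>
    seteq (nbrs J (enc_nat u)) (nbrs J (enc_nat v)) \<or> seteq (enc_nat u # nbrs J (enc_nat u)) (enc_nat v # nbrs J (enc_nat v)) \<longleftrightarrow> twins G u v"
proof -
  assume u: "u \<in> V" and v: "v \<in> V"
  have s: "seteq xs ys \<longleftrightarrow> set xs = set ys" for xs ys unfolding seteq_def by blast
  have "set (enc_nat u # nbrs J (enc_nat u)) = enc_nat ` closed_nbhd G u"
    "set (enc_nat v # nbrs J (enc_nat v)) = enc_nat ` closed_nbhd G v"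
    using u v by (simp_all add: set_nbrs closed_nbhd_def)
  then show ?thesis unfolding s twins_def using u v by (simp add: set_nbrs inj_image_eq_iff[OF inj_enc_nat])
qed

definition rel :: "nat \<Rightarrow> nat \<Rightarrow> bool" where
  "rel u v \<longleftrightarrow> (\<forall>c\<in>set nms. incol J c (enc_nat u) = incol J c (enc_nat v)) \<and>
     (u \<in> source I) = (v \<in> source I) \<and> (u \<in> target I) = (v \<in> target I) \<and> twins G u v"

lemma same_iff: "u \<in> V \<Longrightarrow> v \<in> V \<Longrightarrow> same J nms (enc_nat u) (enc_nat v) \<longleftrightarrow> rel u v"
  unfolding same_def rel_def seteq_nbrs by (simp add: set_src set_tgt)

lemma rel_refl: "rel u u" and rel_sym: "rel u v \<Longrightarrow> rel v u"
  by (auto simp: rel_def twins_def)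

lemma rel_trans: "u \<in> V \<Longrightarrow> v \<in> V \<Longrightarrow> w \<in> V \<Longrightarrow> rel u v \<Longrightarrow> rel v w \<Longrightarrow> rel u w"
  unfolding rel_def using twins_trans[OF graph] by blast

definition cell :: "nat \<Rightarrow> nat set" where
  "cell t = {u \<in> V. enc_nat u \<in> set (cls ! t)}"

lemma distinct_cls: "distinct cls"
  by (simp add: classes_def)

lemma cls_nth:
  assumes "t < T"
  shows "\<exists>r\<in>V. cls ! t = filter (\<lambda>v. same J nms (enc_nat r) v) (vlist J) \<and> cell t = {v \<in> V. rel r v}"
proof -
  have "cls ! t \<in> set cls" using assms by simp
  then obtain r where r: "r \<in> V" "cls ! t = filter (\<lambda>v. same J nms (enc_nat r) v) (vlist J)"
    by (auto simp: classes_def vlist(2))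
  have "cell t = {v \<in> V. rel r v}" unfolding cell_def r(2) using same_iff[OF r(1)] by (auto simp: vlist(2))
  then show ?thesis using r by blast
qed

lemma cell_disjoint: "s < T \<Longrightarrow> t < T \<Longrightarrow> u \<in> cell s \<Longrightarrow> u \<in> cell t \<Longrightarrow> s = t"
proof -
  assume st: "s < T" "t < T" and u: "u \<in> cell s" "u \<in> cell t"
  obtain r where r: "r \<in> V" "cls ! s = filter (\<lambda>v. same J nms (enc_nat r) v) (vlist J)" "cell s = {v \<in> V. rel r v}" using cls_nth[OF st(1)] by blast
  obtain r' where r': "r' \<in> V" "cls ! t = filter (\<lambda>v. same J nms (enc_nat r') v) (vlist J)" "cell t = {v \<in> V. rel r' v}" using cls_nth[OF st(2)] by blast
  have uV: "u \<in> V" "rel r u" "rel r' u" using u r(3) r'(3) by auto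
  then have rr: "rel r r'" using rel_trans[OF r(1) uV(1) r'(1)] rel_sym by blast
  have "same J nms (enc_nat r) x = same J nms (enc_nat r') x" if x: "x \<in> set (vlist J)" for x
  proof -
    obtain w where w: "w \<in> V" "x = enc_nat w" using x unfolding vlist(2) by (elim imageE)
    show ?thesis unfolding w(2) same_iff[OF r(1) w(1)] same_iff[OF r'(1) w(1)]
      using rel_trans[OF r(1) r'(1) w(1)] rel_trans[OF r'(1) r(1) w(1)] rr rel_sym by blast
  qed
  then have "cls ! s = cls ! t" unfolding r(2) r'(2) by (intro filter_cong) auto
  then show "s = t" using distinct_cls st by (simp add: nth_eq_iff_index_eq)
qed

lemma cell_ex: "u \<in> V \<Longrightarrow> \<exists>t<T. u \<in> cell t"
proof -
  assume u: "u \<in> V"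
  have "filter (\<lambda>v. same J nms (enc_nat u) v) (vlist J) \<in> set cls" using u by (auto simp: classes_def vlist(2))
  then obtain t where t: "t < T" "cls ! t = filter (\<lambda>v. same J nms (enc_nat u) v) (vlist J)" by (auto simp: in_set_conv_nth)
  have "u \<in> cell t" unfolding cell_def t(2) using u same_iff[OF u u] rel_refl by (simp add: vlist(2))
  then show ?thesis using t(1) by blast
qed

lemma cell_rel: "t < T \<Longrightarrow> u \<in> cell t \<Longrightarrow> v \<in> cell t \<Longrightarrow> rel u v"
proof -
  assume t: "t < T" and uv: "u \<in> cell t" "v \<in> cell t"
  obtain r where r: "r \<in> V" "cell t = {v \<in> V. rel r v}" using cls_nth[OF t] by blast
  show "rel u v" using uv r rel_trans[of u r v] rel_sym by auto
qed

lemma cell_sub: "cell t \<subseteq> V" and fin_cell: "finite (cell t)"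
  using finV by (auto simp: cell_def)

lemma set_cls: "t < T \<Longrightarrow> set (cls ! t) = enc_nat ` cell t" and distinct_cls_nth: "t < T \<Longrightarrow> distinct (cls ! t)"
  and length_cls: "t < T \<Longrightarrow> length (cls ! t) = card (cell t)"
proof -
  assume t: "t < T"
  obtain r where r: "cls ! t = filter (\<lambda>v. same J nms (enc_nat r) v) (vlist J)" using cls_nth[OF t] by blast
  have "set (cls ! t) \<subseteq> enc_nat ` V" unfolding r vlist(2)[symmetric] by auto
  then show s: "set (cls ! t) = enc_nat ` cell t" unfolding cell_def by auto
  show d: "distinct (cls ! t)" unfolding r using vlist(3) by simp
  show "length (cls ! t) = card (cell t)"
    unfolding distinct_card[OF d, symmetric] s by (rule card_image) (meson inj_enc_nat inj_on_subset subset_UNIV)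
qed

definition ty :: "nat \<Rightarrow> nat" where
  "ty u = (SOME t. t < T \<and> u \<in> cell t)"

lemma ty: "u \<in> V \<Longrightarrow> ty u < T \<and> u \<in> cell (ty u)"
  unfolding ty_def by (rule someI_ex) (rule cell_ex)

lemma ty_iff: "t < T \<Longrightarrow> u \<in> V \<Longrightarrow> ty u = t \<longleftrightarrow> u \<in> cell t"
  using ty cell_disjoint by blast

definition cnt :: "nat set \<Rightarrow> nat list" where
  "cnt A = map (\<lambda>t. card (A \<inter> cell t)) [0..<T]"

lemma sizes_eq: "sizes J = cnt V"
  unfolding sizes_def cnt_def
  by (rule nth_equalityI) (simp_all add: length_cls Int_absorb1 cell_sub)

lemma icode_eq: "icode J = code (formula I)"
  by (simp add: icode_def inst_of_def fst_flat_code)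

lemma nms_props: "set nms = insert (enc_nat (free_var I)) (cnames (code (formula I)))" "distinct nms"
proof -
  have "fst (snd J) = enc_nat (free_var I)" by (simp add: inst_of_def)
  then show "set nms = insert (enc_nat (free_var I)) (cnames (code (formula I)))" "distinct nms"
    unfolding inames_def names_def icode_eq cnames_def by auto
qed

lemma color_names: "k \<in> color_indices p \<Longrightarrow> enc_nat k \<in> cnames (code p)"
  by (induction p) auto

lemma kern_parts: "fst K = map (rename nms) (code (formula I))" "fst (snd K) = idx nms (enc_nat (free_var I))"
  "knum K = length nms" "tnum K = T" "threshold K = 2 ^ length (code (formula I))"
proof -
  have X: "fst (snd J) = enc_nat (free_var I)" by (simp add: inst_of_def)
  show "fst K = map (rename nms) (code (formula I))" "fst (snd K) = idx nms (enc_nat (free_var I))"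
    "knum K = length nms" "tnum K = T" "threshold K = 2 ^ length (code (formula I))"
    by (simp_all add: kern_def icode_eq rename_def[abs_def] knum_def tnum_def threshold_def X)
qed

lemma kadj_iff: "s < T \<Longrightarrow> t < T \<Longrightarrow> kadj K (s, x) (t, y) \<longleftrightarrow> (s, x) \<noteq> (t, y) \<and>
    (\<exists>a\<in>cell s. \<exists>b\<in>cell t. a \<noteq> b \<and> {a, b} \<in> edges G)"
proof -
  assume st: "s < T" "t < T"
  have "get (get (snd (snd (snd (snd K)))) s) t \<longleftrightarrow> (\<exists>a\<in>set (cls ! s). \<exists>b\<in>set (cls ! t). a \<noteq> b \<and> b \<in> set (nbrs J a))"
    using st by (simp add: kern_def get_nth)
  also have "\<dots> \<longleftrightarrow> (\<exists>a\<in>cell s. \<exists>b\<in>cell t. enc_nat a \<noteq> enc_nat b \<and> enc_nat b \<in> set (nbrs J (enc_nat a)))"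
    using st by (simp add: set_cls)
  also have "\<dots> \<longleftrightarrow> (\<exists>a\<in>cell s. \<exists>b\<in>cell t. a \<noteq> b \<and> {a, b} \<in> edges G)"
  proof (intro bex_cong refl)
    fix a b assume "a \<in> cell s" "b \<in> cell t"
    then have "a \<in> V" "b \<in> V" using cell_sub by auto
    then show "enc_nat a \<noteq> enc_nat b \<and> enc_nat b \<in> set (nbrs J (enc_nat a)) \<longleftrightarrow> a \<noteq> b \<and> {a, b} \<in> edges G"
      by (simp add: set_nbrs enc_nat_inject mem_nbhd)
  qed
  finally show ?thesis by (simp add: kadj_def)
qed

lemma kcol_iff: "t < T \<Longrightarrow> c \<in> set nms \<Longrightarrow> kcol K (idx nms c) (t, y) \<longleftrightarrow> (\<exists>a\<in>cell t. incol J c (enc_nat a))"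
proof -
  assume t: "t < T" and c: "c \<in> set nms"
  have "kcol K (idx nms c) (t, y) \<longleftrightarrow> (\<exists>a\<in>set (cls ! t). incol J c a)"
    using t idx_less[OF c] by (simp add: kcol_def kern_def get_nth)
  then show ?thesis using t by (simp add: set_cls)
qed

lemma lcl_nth: "t < T \<Longrightarrow> length x = T \<Longrightarrow>
    lcl q (sizes J) x ! t = (min (x ! t) q, min (card (cell t) - x ! t) q)"
  by (simp add: lcl_def sizes_eq cnt_def Int_absorb1 cell_sub)

text \<open>Label the vertices of the graph and of the truncated model by cell and membership in the
  set. The label counts agree up to the threshold, twins make adjacency depend on the cells only,
  and there are no free vertex variables to match; so \<open>msat_match\<close> applies.\<close>

theorem models_iff_feasible:
  assumes A: "A \<subseteq> V"
  shows "models_set G (formula I) (free_var I) A \<longleftrightarrow> feasible K (lcl (threshold K) (sizes J) (cnt A))"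
proof -
  let ?q = "threshold K" let ?c = "lcl ?q (sizes J) (cnt A)" let ?p = "formula I"
  let ?C = "\<lambda>k v. k < length (colors G) \<and> v \<in> colors G ! k"
  let ?D = "\<lambda>k. kcol K (idx nms (enc_nat k))"
  have len: "length ?c = T" by (simp add: lcl_def sizes_eq cnt_def)
  have nms: "cnames (code ?p) \<subseteq> set nms" "enc_nat (free_var I) \<in> set nms" by (auto simp: nms_props)
  obtain \<alpha> \<beta> where \<beta>: "\<beta> (free_var I) = {u \<in> set (univ ?c). fst (snd u)}"
    and f: "feasible K ?c \<longleftrightarrow> msat (set (univ ?c)) (kadj K) ?D ?p \<alpha> \<beta>"
    using feasible_iff[OF kern_parts(1-3) nms, of ?c] by (elim exE conjE)
  let ?l = "\<lambda>u. [ty u, if u \<in> A then 1 else 0]"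
  let ?m = "\<lambda>w :: kvertex. [fst w, if fst (snd w) then 1 else 0]"
  have cnt: "cnt A ! t = card (A \<inter> cell t)" if "t < T" for t using that by (simp add: cnt_def)
  have ct: "?c ! t = (min (card (A \<inter> cell t)) ?q, min (card (cell t - A)) ?q)" if "t < T" for t
  proof -
    have "card (cell t) - card (A \<inter> cell t) = card (cell t - A)"
      using card_Diff_subset_Int[of "cell t" A] fin_cell by (simp add: Int_commute)
    then show ?thesis using that lcl_nth[of t "cnt A" ?q] by (simp add: cnt) (simp add: cnt_def)
  qed
  have "cards_match ?q V ?l (set (univ ?c)) ?m"
    unfolding cards_match_def
  proof (intro conjI allI finV)
    fix z :: "nat list"
    consider (a) t b where "z = [t, b]" "t < T" "b = 1" | (b) t b where "z = [t, b]" "t < T" "b = 0"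
      | (c) "\<And>t b. t < T \<Longrightarrow> b \<in> {0, 1} \<Longrightarrow> z \<noteq> [t, b]" by (cases "\<exists>t b. t < T \<and> b \<in> {0, 1} \<and> z = [t, b]") auto
    then show "agree ?q (card {v\<in>V. ?l v = z}) (card {w\<in>set (univ ?c). ?m w = z})"
    proof cases
      case a
      have "?l v = z \<longleftrightarrow> v \<in> A \<and> v \<in> cell t" if "v \<in> V" for v using a ty_iff[OF a(2) that] by simp
      then have "{v\<in>V. ?l v = z} = A \<inter> cell t" using A by blast
      moreover have "{w\<in>set (univ ?c). ?m w = z} = (\<lambda>i. (t, True, i)) ` {..<min (card (A \<inter> cell t)) ?q}"
        using a ct[OF a(2)] by (auto simp: set_univ len image_iff split: if_splits)
      moreover have "card ((\<lambda>i. (t, True, i)) ` {..<min (card (A \<inter> cell t)) ?q}) = min (card (A \<inter> cell t)) ?q"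
        by (subst card_image) (auto simp: inj_on_def)
      ultimately show ?thesis by (simp only: agree_min)
    next
      case b
      have "?l v = z \<longleftrightarrow> v \<notin> A \<and> v \<in> cell t" if "v \<in> V" for v using b ty_iff[OF b(2) that] by simp
      then have "{v\<in>V. ?l v = z} = cell t - A" using cell_sub by blast
      moreover have "{w\<in>set (univ ?c). ?m w = z} = (\<lambda>i. (t, False, i)) ` {..<min (card (cell t - A)) ?q}"
        using b ct[OF b(2)] by (auto simp: set_univ len image_iff split: if_splits)
      moreover have "card ((\<lambda>i. (t, False, i)) ` {..<min (card (cell t - A)) ?q}) = min (card (cell t - A)) ?q"
        by (subst card_image) (auto simp: inj_on_def)
      ultimately show ?thesis by (simp only: agree_min)
    next
      case c
      have 1: "?l v \<noteq> z" if "v \<in> V" for v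
        using c[of "ty v" "if v \<in> A then 1 else 0"] ty[OF that] by (cases "v \<in> A") simp_all
      have 2: "?m w \<noteq> z" if "w \<in> set (univ ?c)" for w
      proof -
        have "fst w < T" using that set_univ[of "fst w" "fst (snd w)" "snd (snd w)" ?c] len by simp
        then show ?thesis using c[of "fst w" "if fst (snd w) then 1 else 0"] by (cases "fst (snd w)") simp_all
      qed
      have e: "{v\<in>V. ?l v = z} = {}" by (rule equals0I) (elim CollectE conjE, erule (1) notE[OF 1])
      have e': "{w\<in>set (univ ?c). ?m w = z} = {}" by (rule equals0I) (elim CollectE conjE, erule (1) notE[OF 2])
      show ?thesis unfolding e e' by (simp add: agree_def)
    qed
  qed simp
  moreover have "structs_match V (\<lambda>u v. {u, v} \<in> edges G) ?C ?l (set (univ ?c)) (kadj K) ?D ?m (color_indices ?p)"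
    unfolding structs_match_def
  proof (intro conjI ballI impI)
    fix u v u' v' assume uv: "u \<in> V" "v \<in> V" and uv': "u' \<in> set (univ ?c)" "v' \<in> set (univ ?c)"
      and lu: "?l u = ?m u'" and lv: "?l v = ?m v'" and eq: "u = v \<longleftrightarrow> u' = v'"
    have u': "u' = (ty u, snd u')" "v' = (ty v, snd v')" using lu lv by (auto intro: prod_eqI)
    note tu = ty[OF uv(1)] and tv = ty[OF uv(2)]
    have "kadj K u' v' \<longleftrightarrow> u' \<noteq> v' \<and> (\<exists>a\<in>cell (ty u). \<exists>b\<in>cell (ty v). a \<noteq> b \<and> {a, b} \<in> edges G)"
      using kadj_iff[of "ty u" "ty v" "snd u'" "snd v'"] tu tv u' by simp
    also have "\<dots> \<longleftrightarrow> {u, v} \<in> edges G"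
    proof
      assume r: "u' \<noteq> v' \<and> (\<exists>a\<in>cell (ty u). \<exists>b\<in>cell (ty v). a \<noteq> b \<and> {a, b} \<in> edges G)"
      then obtain a b where ab: "a \<in> cell (ty u)" "b \<in> cell (ty v)" "a \<noteq> b" "{a, b} \<in> edges G" by (elim conjE bexE)
      have "twins G a u" "twins G b v" using cell_rel[of "ty u" a u] cell_rel[of "ty v" b v] ab tu tv by (auto simp: rel_def)
      moreover have "a \<in> V" "b \<in> V" using ab cell_sub by auto
      moreover have "a = b \<longleftrightarrow> u = v" using ab(3) eq r by simp
      ultimately have "{a, b} \<in> edges G \<longleftrightarrow> {u, v} \<in> edges G" using uv by (intro twins_adjacent[OF graph])
      then show "{u, v} \<in> edges G" using ab(4) by simp
    next
      show "{u, v} \<in> edges G \<Longrightarrow> u' \<noteq> v' \<and> (\<exists>a\<in>cell (ty u). \<exists>b\<in>cell (ty v). a \<noteq> b \<and> {a, b} \<in> edges G)"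
      proof -
        assume e: "{u, v} \<in> edges G"
        have "u \<noteq> v" using no_loop[OF graph, of u] e by (cases "u = v") simp_all
        then show ?thesis using eq e tu tv by (intro conjI bexI[of _ u] bexI[of _ v]) simp_all
      qed
    qed
    finally show "({u, v} \<in> edges G) = kadj K u' v'" by simp
  next
    fix k u u' assume k: "k \<in> color_indices ?p" and u: "u \<in> V" and u': "u' \<in> set (univ ?c)" and lu: "?l u = ?m u'"
    have u'': "u' = (ty u, snd u')" using lu by (auto intro: prod_eqI)
    have kn: "enc_nat k \<in> set nms" using color_names[OF k] nms(1) by blast
    note tu = ty[OF u]
    have "?D k u' \<longleftrightarrow> (\<exists>a\<in>cell (ty u). incol J (enc_nat k) (enc_nat a))"
      using kcol_iff[OF _ kn, of "ty u" "snd u'"] tu u'' by simp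
    also have "\<dots> \<longleftrightarrow> incol J (enc_nat k) (enc_nat u)"
    proof
      assume "\<exists>a\<in>cell (ty u). incol J (enc_nat k) (enc_nat a)"
      then obtain a where a: "a \<in> cell (ty u)" "incol J (enc_nat k) (enc_nat a)" by (elim bexE)
      have "rel a u" using cell_rel[of "ty u" a u] a tu by blast
      then show "incol J (enc_nat k) (enc_nat u)" using a(2) kn unfolding rel_def by blast
    qed (use tu in blast)
    also have "\<dots> \<longleftrightarrow> ?C k u" by (auto simp: incol_iff enc_nat_inject)
    finally show "?C k u = ?D k u'" by simp
  qed
  moreover have "svals_match V ?l ((\<lambda>_. {})(free_var I := A)) (set (univ ?c)) ?m \<beta> {free_var I}"
    unfolding svals_match_def
  proof (intro ballI impI)
    fix Y v w assume h: "Y \<in> {free_var I}" "v \<in> V" "w \<in> set (univ ?c)" "?l v = ?m w"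
    then have "v \<in> A \<longleftrightarrow> fst (snd w)" by (cases "v \<in> A"; cases "fst (snd w)") simp_all
    then show "v \<in> ((\<lambda>_. {})(free_var I := A)) Y \<longleftrightarrow> w \<in> \<beta> Y" using h(1,3) \<beta> by simp
  qed
  ultimately have am: "all_match ?q V (\<lambda>u v. {u, v} \<in> edges G) ?C ?l (\<lambda>_. undefined) ((\<lambda>_. {})(free_var I := A))
      (set (univ ?c)) (kadj K) ?D ?m \<alpha> \<beta> ?p"
    unfolding all_match_def by (simp add: closed vvals_match_def)
  have "models_set G ?p (free_var I) A \<longleftrightarrow> msat V (\<lambda>u v. {u, v} \<in> edges G) ?C ?p (\<lambda>_. undefined) ((\<lambda>_. {})(free_var I := A))"
    unfolding models_set_def by (rule sat_msat)
  also have "\<dots> \<longleftrightarrow> feasible K ?c" unfolding f by (rule msat_match[OF am]) (simp add: kern_parts)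
  finally show ?thesis .
qed

end


section \<open>Moving between states\<close>

lemma sum_list_zip:
  "length x = n \<Longrightarrow> length y = n \<Longrightarrow> sum_list (map f (zip x y)) = (\<Sum>t<n. f (x ! t, y ! t))"
  by (simp add: sum_list_sum_nth atLeast0LessThan)

lemma sum_list_nth: "length x = n \<Longrightarrow> sum_list x = (\<Sum>t<n. x ! t)" for x :: "nat list"
  by (simp add: sum_list_sum_nth atLeast0LessThan)

text \<open>For vectors of equal sum this is the number of moves from \<open>x\<close> to
  \<open>y\<close>, and half of \<open>ldist\<close>.\<close>

definition deficit :: "nat list \<Rightarrow> nat list \<Rightarrow> nat" where
  "deficit x y = (\<Sum>t<length x. x ! t - y ! t)"

definition mv :: "nat list \<Rightarrow> nat list \<Rightarrow> bool" where
  "mv x y \<longleftrightarrow> (\<exists>i j. i < length x \<and> j < length x \<and> i \<noteq> j \<and> 0 < x ! j \<and> y = x[i := Suc (x ! i), j := x ! j - 1])"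

lemma deficit_balance:
  assumes "length x = length y" "sum_list x = sum_list y"
  shows "deficit x y = deficit y x"
proof -
  have "(\<Sum>t<length y. x ! t) = (\<Sum>t<length y. y ! t)" using assms by (simp add: sum_list_nth[of _ "length y"])
  moreover have "(\<Sum>t<length y. x ! t) + (\<Sum>t<length y. y ! t - x ! t) = (\<Sum>t<length y. y ! t) + (\<Sum>t<length y. x ! t - y ! t)"
    unfolding sum.distrib[symmetric] by (rule sum.cong) auto
  ultimately show ?thesis using assms(1) by (simp add: deficit_def)
qed

lemma deficit_0: "length x = length y \<Longrightarrow> sum_list x = sum_list y \<Longrightarrow> deficit x y = 0 \<Longrightarrow> x = y"
proof -
  assume a: "length x = length y" "sum_list x = sum_list y" "deficit x y = 0"
  have "deficit y x = 0" using deficit_balance[OF a(1,2)] a(3) by simp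
  then have "\<forall>t<length x. x ! t - y ! t = 0 \<and> y ! t - x ! t = 0" using a(1,3) by (simp add: deficit_def)
  then show "x = y" using a(1) by (intro nth_equalityI) auto
qed

lemma deficit_pos_ex: "0 < deficit x y \<Longrightarrow> \<exists>t<length x. y ! t < x ! t"
proof (rule ccontr)
  assume d: "0 < deficit x y" and n: "\<not> (\<exists>t<length x. y ! t < x ! t)"
  have "deficit x y = 0" unfolding deficit_def by (rule sum.neutral) (use n in force)
  then show False using d by simp
qed

lemma hd_filter_zip3:
  assumes "length x = length y" "t < length x" "P (t, x ! t, y ! t)"
  defines "F \<equiv> filter P (zip [0..<length x] (zip x y))"
  shows "F \<noteq> [] \<and> (\<exists>i<length x. hd F = (i, x ! i, y ! i) \<and> P (i, x ! i, y ! i))"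
proof -
  have z: "zip [0..<length x] (zip x y) = map (\<lambda>i. (i, x ! i, y ! i)) [0..<length x]"
    by (rule nth_equalityI) (use assms(1) in auto)
  have "(t, x ! t, y ! t) \<in> set F" unfolding F_def z using assms(2,3) by auto
  then have ne: "F \<noteq> []" by auto
  then have "hd F \<in> set F" by simp
  then show ?thesis using ne unfolding F_def z by auto
qed

lemma step_move:
  assumes l: "length x = length y" and s: "sum_list x = sum_list y" and d: "0 < deficit x y"
  shows "\<exists>i j. i < length x \<and> j < length x \<and> i \<noteq> j \<and> x ! i < y ! i \<and> y ! j < x ! j \<and>
    dec1 y (inc1 y x) = x[i := Suc (x ! i), j := x ! j - 1]"
proof -
  obtain t where t: "t < length x" "y ! t < x ! t" using deficit_pos_ex[OF d] by blast
  have "0 < deficit y x" using d deficit_balance[OF l s] by simp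
  then obtain t' where t': "t' < length x" "x ! t' < y ! t'" using deficit_pos_ex[of y x] l by auto
  obtain i where i: "i < length x" "x ! i < y ! i" and inc: "inc1 y x = x[i := Suc (x ! i)]"
    using hd_filter_zip3[OF l t'(1), of "\<lambda>p. fst (snd p) < snd (snd p)"] t'(2)
    unfolding inc1_def Let_def by auto
  let ?x = "x[i := Suc (x ! i)]"
  have ti: "t \<noteq> i" using t i by auto
  have "\<exists>j<length ?x. y ! j < ?x ! j \<and> dec1 y ?x = ?x[j := ?x ! j - 1]"
    using hd_filter_zip3[of ?x y t "\<lambda>p. snd (snd p) < fst (snd p)"] t l ti
    unfolding dec1_def Let_def by auto
  then obtain j where j: "j < length ?x" "y ! j < ?x ! j" and dec: "dec1 y ?x = ?x[j := ?x ! j - 1]" by blast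
  have ij: "i \<noteq> j" using i j by (cases "i = j") auto
  then have "?x ! j = x ! j" by simp
  then show ?thesis using i j ij inc dec by (intro exI[of _ i] exI[of _ j]) simp
qed

lemma sum_list_move:
  "i < length x \<Longrightarrow> j < length x \<Longrightarrow> i \<noteq> j \<Longrightarrow> 0 < x ! j \<Longrightarrow> sum_list (x[i := Suc (x ! i), j := x ! j - 1]) = sum_list x"
  for x :: "nat list"
proof -
  assume a: "i < length x" "j < length x" "i \<noteq> j" "0 < x ! j"
  have m: "x ! j \<le> sum_list (x[i := Suc (x ! i)])" using a elem_le_sum_list[of j "x[i := Suc (x ! i)]"] by simp
  have "sum_list (x[i := Suc (x ! i)]) = Suc (sum_list x)"
    using a(1) elem_le_sum_list[of i x] by (simp add: sum_list_update)
  moreover have "sum_list (x[i := Suc (x ! i), j := x ! j - 1]) = sum_list (x[i := Suc (x ! i)]) + (x ! j - 1) - x ! j"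
    using a by (simp add: sum_list_update)
  ultimately show ?thesis using a(4) m by linarith
qed

lemma deficit_move:
  assumes "i < length x" "j < length x" "i \<noteq> j" "x ! i < y ! i" "y ! j < x ! j"
  shows "Suc (deficit (x[i := Suc (x ! i), j := x ! j - 1]) y) = deficit x y"
proof -
  let ?x = "x[i := Suc (x ! i), j := x ! j - 1]"
  have "deficit x y = (x ! j - y ! j) + (\<Sum>t\<in>{..<length x} - {j}. x ! t - y ! t)"
    unfolding deficit_def using assms(2) by (simp add: sum.remove)
  moreover have "deficit ?x y = (x ! j - 1 - y ! j) + (\<Sum>t\<in>{..<length x} - {j}. ?x ! t - y ! t)"
    unfolding deficit_def using assms(2) by (simp add: sum.remove)
  moreover have "(\<Sum>t\<in>{..<length x} - {j}. ?x ! t - y ! t) = (\<Sum>t\<in>{..<length x} - {j}. x ! t - y ! t)"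
    by (rule sum.cong) (use assms in \<open>auto simp: nth_list_update\<close>)
  ultimately show ?thesis using assms(5) by linarith
qed

definition between :: "nat list \<Rightarrow> nat list \<Rightarrow> nat list \<Rightarrow> bool" where
  "between x y z \<longleftrightarrow> length z = length x \<and> (\<forall>t<length x. min (x ! t) (y ! t) \<le> z ! t \<and> z ! t \<le> max (x ! t) (y ! t))"

text \<open>A step raises a coordinate below its target and lowers one above it, so the deficit
  drops by one. The intervals between current and target entries only shrink, which keeps the later
  vectors between the original ends.\<close>

lemma walk:
  assumes "length x = length y" "sum_list x = sum_list y" "deficit x y = D"
  shows "((\<lambda>z. dec1 y (inc1 y z)) ^^ D) x = y \<and>
    (\<forall>i<D. mv (((\<lambda>z. dec1 y (inc1 y z)) ^^ i) x) (((\<lambda>z. dec1 y (inc1 y z)) ^^ Suc i) x)) \<and>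
    (\<forall>i\<le>D. between x y (((\<lambda>z. dec1 y (inc1 y z)) ^^ i) x))"
  using assms
proof (induction D arbitrary: x)
  case 0
  then have "x = y" by (intro deficit_0)
  then show ?case by (simp add: between_def)
next
  case (Suc D)
  let ?f = "\<lambda>z. dec1 y (inc1 y z)"
  have "0 < deficit x y" using Suc.prems(3) by simp
  from step_move[OF Suc.prems(1,2) this] obtain i j where ij: "i < length x" "j < length x" "i \<noteq> j" "x ! i < y ! i" "y ! j < x ! j"
    and f: "?f x = x[i := Suc (x ! i), j := x ! j - 1]" by blast
  have len: "length (?f x) = length y" using f Suc.prems(1) by simp
  have sum: "sum_list (?f x) = sum_list y" unfolding f using sum_list_move[OF ij(1-3)] ij(5) Suc.prems(2) by simp
  have def: "deficit (?f x) y = D" unfolding f using deficit_move[OF ij] Suc.prems(3) by simp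
  note IH = Suc.IH[OF len sum def]
  have mv0: "mv x (?f x)" unfolding mv_def f using ij by (intro exI[of _ i] exI[of _ j]) auto
  have shift: "(?f ^^ Suc l) x = (?f ^^ l) (?f x)" for l by (simp only: funpow_Suc_right comp_def)
  have bx: "between x y x" by (simp add: between_def)
  have nth: "min (x ! t) (y ! t) \<le> min (?f x ! t) (y ! t)" "max (?f x ! t) (y ! t) \<le> max (x ! t) (y ! t)" if "t < length x" for t
    using that ij unfolding f by (auto simp: nth_list_update)
  have trans: "between x y z" if z: "between (?f x) y z" for z
    unfolding between_def
  proof (intro conjI allI impI)
    show "length z = length x" using z len Suc.prems(1) by (simp add: between_def)
    fix t assume t: "t < length x"
    have "min (?f x ! t) (y ! t) \<le> z ! t \<and> z ! t \<le> max (?f x ! t) (y ! t)"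
      using z t len Suc.prems(1) by (simp add: between_def)
    then show "min (x ! t) (y ! t) \<le> z ! t" "z ! t \<le> max (x ! t) (y ! t)" using nth[OF t] by linarith+
  qed
  show ?case
  proof (intro conjI allI impI)
    show "(?f ^^ Suc D) x = y" unfolding shift using IH by blast
    fix l assume "l < Suc D"
    then show "mv ((?f ^^ l) x) ((?f ^^ Suc l) x)"
    proof (cases l)
      case 0 then show ?thesis using mv0 by simp
    next
      case (Suc l') then show ?thesis using IH \<open>l < Suc D\<close> unfolding Suc shift by simp
    qed
  next
    fix l assume "l \<le> Suc D"
    then show "between x y ((?f ^^ l) x)"
    proof (cases l)
      case 0 then show ?thesis using bx by simp
    next
      case (Suc l') then show ?thesis using IH trans \<open>l \<le> Suc D\<close> unfolding Suc shift by simp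
    qed
  qed
qed

lemma deficit_zip: "length x = length y \<Longrightarrow> sum_list (map (\<lambda>p. fst p - snd p) (zip x y)) = deficit x y"
  by (simp add: sum_list_zip[of x "length y"] deficit_def)

lemma ldist_deficit:
  assumes "length x = length y" "sum_list x = sum_list y"
  shows "ldist x y = 2 * deficit x y"
proof -
  have "ldist x y = (\<Sum>t<length y. (x ! t - y ! t) + (y ! t - x ! t))"
    unfolding ldist_def using assms(1) by (simp add: sum_list_zip[of x "length y"])
  then have "ldist x y = deficit x y + deficit y x" using assms(1) by (simp add: deficit_def sum.distrib)
  then show ?thesis using deficit_balance[OF assms] by simp
qed

lemma seg_props:
  assumes "length x = length y" "sum_list x = sum_list y"
  shows "length (seg x y) = deficit x y" "successively mv (seg x y @ [y])" "hd (seg x y @ [y]) = x"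
    "\<And>z. z \<in> set (seg x y) \<Longrightarrow> between x y z"
proof -
  let ?f = "\<lambda>z. dec1 y (inc1 y z)"
  note w = walk[OF assms refl]
  have seg: "seg x y = map (\<lambda>i. (?f ^^ i) x) [0..<deficit x y]" unfolding seg_def deficit_zip[OF assms(1)] by simp
  show "length (seg x y) = deficit x y" by (simp add: seg)
  have all: "seg x y @ [y] = map (\<lambda>i. (?f ^^ i) x) [0..<Suc (deficit x y)]" using w by (simp add: seg)
  show "successively mv (seg x y @ [y])" unfolding all successively_conv_nth using w by (auto simp del: upt_Suc funpow.simps)
  show "hd (seg x y @ [y]) = x" unfolding all by (simp add: hd_map del: upt_Suc)
  show "between x y z" if "z \<in> set (seg x y)" for z using that w unfolding seg by auto
qed

lemma expand_Cons: "expand (x # y # rows) = seg x y @ expand (y # rows)"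
  unfolding expand_def hd_rev by simp

lemma expand_props:
  assumes "rows \<noteq> []" "\<And>x. x \<in> set rows \<Longrightarrow> length x = n \<and> sum_list x = k"
  shows "expand rows \<noteq> [] \<and> hd (expand rows) = hd rows \<and> last (expand rows) = last rows \<and> successively mv (expand rows) \<and>
    2 * length (expand rows) = lcost rows + 2 \<and>
    (\<forall>z\<in>set (expand rows). z \<in> set rows \<or> (\<exists>p\<in>set (zip rows (tl rows)). z \<in> set (seg (fst p) (snd p))))"
  using assms
proof (induction rows rule: induct_list012)
  case 1 then show ?case by simp
next
  case (2 x) then show ?case by (simp add: expand_def lcost_def)
next
  case (3 x y rows)
  let ?E = "expand (y # rows)"
  have xy: "length x = length y" "sum_list x = sum_list y" using 3(4)[of x] 3(4)[of y] by simp_all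
  note s = seg_props[OF xy]
  have "expand (y # rows) \<noteq> [] \<and> hd ?E = hd (y # rows) \<and> last ?E = last (y # rows) \<and> successively mv ?E \<and>
    2 * length ?E = lcost (y # rows) + 2 \<and>
    (\<forall>z\<in>set ?E. z \<in> set (y # rows) \<or> (\<exists>p\<in>set (zip (y # rows) (tl (y # rows))). z \<in> set (seg (fst p) (snd p))))"
    by (rule 3(2)) (use 3(4) in simp_all)
  then have IH: "?E \<noteq> []" "hd ?E = y" "last ?E = last (y # rows)" "successively mv ?E" "2 * length ?E = lcost (y # rows) + 2"
    "\<And>z. z \<in> set ?E \<Longrightarrow> z \<in> set (y # rows) \<or> (\<exists>p\<in>set (zip (y # rows) (tl (y # rows))). z \<in> set (seg (fst p) (snd p)))"
    by (elim conjE; simp)+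
  have hdE: "hd (seg x y @ ?E) = x" using s(3) IH(2) by (cases "seg x y = []") simp_all
  have succ: "successively mv (seg x y @ ?E)"
    using s(2) IH(1,2,4) unfolding successively_append_iff by auto
  have cost: "lcost (x # y # rows) = 2 * deficit x y + lcost (y # rows)"
    by (simp add: lcost_def ldist_deficit[OF xy])
  show ?case unfolding expand_Cons
  proof (intro conjI ballI)
    fix z assume "z \<in> set (seg x y @ ?E)"
    then consider "z \<in> set (seg x y)" | "z \<in> set ?E" by auto
    then show "z \<in> set (x # y # rows) \<or> (\<exists>p\<in>set (zip (x # y # rows) (tl (x # y # rows))). z \<in> set (seg (fst p) (snd p)))"
    proof cases
      case 1 then show ?thesis by simp
    next
      case 2 then show ?thesis using IH(6)[OF 2] by auto
    qed
  qed (use IH hdE succ cost s(1) in simp_all)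
qed

text \<open>Within a class the truncated counts agree at both ends of each coordinate interval and,
  being monotone, throughout it. Between different classes the distance is at most 2, so the segment
  consists of \<open>x\<close> alone.\<close>

lemma seg_cases:
  assumes "length x = length y" "sum_list x = sum_list y" "llinked q ns x y" "z \<in> set (seg x y)" "length ns = length x"
  shows "z = x \<or> lcl q ns z = lcl q ns x \<and> between x y z"
proof (cases "lcl q ns x = lcl q ns y")
  case True
  note b = seg_props(4)[OF assms(1,2,4)]
  have "lcl q ns z ! t = lcl q ns x ! t" if t: "t < length x" for t
  proof -
    have e: "lcl q ns w ! t = (min (w ! t) q, min (ns ! t - w ! t) q)" if "length w = length x" for w
      using that t assms(5) by (simp add: lcl_def)
    have m: "min (x ! t) q = min (y ! t) q" "min (ns ! t - x ! t) q = min (ns ! t - y ! t) q"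
      using arg_cong[OF True, of "\<lambda>l. l ! t"] e[of x] e[of y] assms(1) by simp_all
    have z: "length z = length x" "min (x ! t) (y ! t) \<le> z ! t" "z ! t \<le> max (x ! t) (y ! t)" using b t by (auto simp: between_def)
    have "min (z ! t) q = min (x ! t) q" "min (ns ! t - z ! t) q = min (ns ! t - x ! t) q"
      using m z(2,3) by linarith+
    then show ?thesis using e[OF z(1)] e[of x] by simp
  qed
  moreover have "length (lcl q ns z) = length x" "length (lcl q ns x) = length x" using b assms(5) by (auto simp: lcl_def between_def)
  ultimately show ?thesis using b by (intro disjI2 conjI nth_equalityI) simp_all
next
  case False
  then have "2 * deficit x y \<le> 2" using assms(3) ldist_deficit[OF assms(1,2)] by (simp add: llinked_def)
  then have "length (seg x y) \<le> 1" using seg_props(1)[OF assms(1,2)] by simp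
  then have "z = hd (seg x y)" "seg x y \<noteq> []" using assms(4) by (cases "seg x y"; simp)+
  then show ?thesis using seg_props(3)[OF assms(1,2)] by simp
qed


section \<open>Soundness and completeness\<close>

lemma set_pairs: "set (pairs q) = {..q} \<times> {..q}"
proof -
  have "set (pairs q) = (\<Union>a\<in>{..<Suc q}. Pair a ` {..<Suc q})" unfolding pairs_def by (simp del: upt_Suc add: atLeast0LessThan)
  then show ?thesis unfolding lessThan_Suc_atMost by auto
qed

context msor1_inst
begin

abbreviation "R \<equiv> solve (kern (inst_of I))"
abbreviation "q \<equiv> threshold (kern (inst_of I))"
abbreviation "ns \<equiv> sizes (inst_of I)"

lemma len_ns: "length ns = T" and ns_nth: "t < T \<Longrightarrow> ns ! t = card (cell t)"
  by (simp_all add: sizes_eq cnt_def Int_absorb1 cell_sub)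

lemma R_parts: "fst R = q" "snd (snd R) = product_lists (replicate (Suc (rnum K)) (product_lists (replicate T (fpairs K))))"
  by (simp_all add: solve_def kern_parts(4))

lemma feas_iff: "length x = T \<Longrightarrow> lcl q ns x \<in> set (fst (snd R)) \<longleftrightarrow> feasible K (lcl q ns x)"
proof -
  assume x: "length x = T"
  have "length (lcl q ns x) = T" "set (lcl q ns x) \<subseteq> set (pairs q)"
    using x len_ns by (auto simp: lcl_def set_pairs)
  then show ?thesis by (simp add: solve_def set_product_replicate kern_parts(4))
qed

lemma length_cnt: "length (cnt A) = T"
  by (simp add: cnt_def)

lemma feas_cnt: "A \<subseteq> V \<Longrightarrow> lcl q ns (cnt A) \<in> set (fst (snd R)) \<longleftrightarrow> models_set G (formula I) (free_var I) A"
  using models_iff_feasible[of A] feas_iff[of "cnt A"] by (simp add: length_cnt)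

lemma sum_cnt: "A \<subseteq> V \<Longrightarrow> sum_list (cnt A) = card A"
proof -
  assume A: "A \<subseteq> V"
  have "A = (\<Union>t<T. A \<inter> cell t)" using A cell_ex by auto
  then have "card A = card (\<Union>t\<in>{..<T}. A \<inter> cell t)" by simp
  also have "\<dots> = (\<Sum>t<T. card (A \<inter> cell t))"
    using fin_cell cell_disjoint by (intro card_UN_disjoint) auto
  finally show ?thesis unfolding sum_list_nth[OF length_cnt] by (simp add: cnt_def)
qed

lemma cell_nonempty: "t < T \<Longrightarrow> cell t \<noteq> {}"
  using cls_nth rel_refl by fastforce

text \<open>A set closed under \<open>rel\<close> is a union of cells, so its counts are 0 or full,
  as \<open>normal_form\<close> requires of the end vectors.\<close>

lemma svec_cnt:
  assumes "\<And>u v. rel u v \<Longrightarrow> u \<in> A \<longleftrightarrow> v \<in> A" "set L = enc_nat ` A" "A \<subseteq> V"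
  shows "svec J L = cnt A" "t < T \<Longrightarrow> cnt A ! t \<in> {0, ns ! t}" "t < T \<Longrightarrow> A \<inter> cell t = (if cnt A ! t = 0 then {} else cell t)"
proof -
  have dich: "A \<inter> cell t = {} \<or> A \<inter> cell t = cell t" if "t < T" for t
    using cell_rel[OF that] assms(1) by blast
  have hd: "\<exists>u\<in>cell t. hd (cls ! t) = enc_nat u" if "t < T" for t
  proof -
    have "cls ! t \<noteq> []" using set_cls[OF that] cell_nonempty[OF that] by auto
    then have "hd (cls ! t) \<in> enc_nat ` cell t" using set_cls[OF that] hd_in_set by blast
    then show ?thesis by (elim imageE) (rule bexI)
  qed
  show "svec J L = cnt A"
  proof (rule nth_equalityI)
    show "length (svec J L) = length (cnt A)" by (simp add: svec_def cnt_def)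
    fix t assume "t < length (svec J L)"
    then have t: "t < T" by (simp add: svec_def)
    obtain u where u: "u \<in> cell t" "hd (cls ! t) = enc_nat u" using hd[OF t] by (elim bexE)
    have "svec J L ! t = (if u \<in> A then card (cell t) else 0)" using t u(2) by (simp add: svec_def assms(2) length_cls)
    also have "\<dots> = card (A \<inter> cell t)" using dich[OF t] u(1) by auto
    finally show "svec J L ! t = cnt A ! t" using t by (simp add: cnt_def)
  qed
  assume t: "t < T"
  show "cnt A ! t \<in> {0, ns ! t}" using dich[OF t] t by (auto simp: cnt_def ns_nth)
  show "A \<inter> cell t = (if cnt A ! t = 0 then {} else cell t)"
    using dich[OF t] t fin_cell cell_nonempty[OF t] by (auto simp: cnt_def)
qed

lemma rel_source: "rel u v \<Longrightarrow> u \<in> source I \<longleftrightarrow> v \<in> source I" and rel_target: "rel u v \<Longrightarrow> u \<in> target I \<longleftrightarrow> v \<in> target I"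
  by (simp_all add: rel_def)

lemma svec_source: "svec J (src J) = cnt (source I)" "t < T \<Longrightarrow> cnt (source I) ! t \<in> {0, ns ! t}"
    "t < T \<Longrightarrow> source I \<inter> cell t = (if cnt (source I) ! t = 0 then {} else cell t)"
  by (rule svec_cnt[OF _ set_src src_sub], erule rel_source, assumption?)+

lemma svec_target: "svec J (tgt J) = cnt (target I)" "t < T \<Longrightarrow> cnt (target I) ! t \<in> {0, ns ! t}"
    "t < T \<Longrightarrow> target I \<inter> cell t = (if cnt (target I) ! t = 0 then {} else cell t)"
  by (rule svec_cnt[OF _ set_tgt tgt_sub], erule rel_target, assumption?)+

section \<open>Canonical sets of count vectors, and soundness\<close>

definition canonset :: "nat list \<Rightarrow> nat set" where
  "canonset x = {u \<in> V. \<exists>t<T. enc_nat u \<in> set (take (x ! t) (cls ! t))}"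

lemma canonset_cell: "t < T \<Longrightarrow> canonset x \<inter> cell t = {u \<in> V. enc_nat u \<in> set (take (x ! t) (cls ! t))}"
proof -
  assume t: "t < T"
  have "u \<in> cell s" if "s < T" "u \<in> V" "enc_nat u \<in> set (take (x ! s) (cls ! s))" for u s
    using that set_take_subset[of "x ! s" "cls ! s"] by (auto simp: cell_def)
  then show ?thesis using t cell_disjoint unfolding canonset_def by blast
qed

lemma card_canonset_cell: "t < T \<Longrightarrow> x ! t \<le> ns ! t \<Longrightarrow> card (canonset x \<inter> cell t) = x ! t"
proof -
  assume t: "t < T" and x: "x ! t \<le> ns ! t"
  let ?L = "take (x ! t) (cls ! t)"
  have sub: "set ?L \<subseteq> enc_nat ` V" using set_take_subset[of "x ! t" "cls ! t"] set_cls[OF t] cell_sub by blast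
  have "enc_nat ` (canonset x \<inter> cell t) = set ?L" unfolding canonset_cell[OF t] using sub by blast
  moreover have "card (enc_nat ` (canonset x \<inter> cell t)) = card (canonset x \<inter> cell t)"
    by (rule card_image) (meson inj_enc_nat inj_on_subset subset_UNIV)
  moreover have "card (set ?L) = x ! t"
    using distinct_card[of ?L] distinct_take[OF distinct_cls_nth[OF t]] x length_cls[OF t] ns_nth[OF t] by simp
  ultimately show ?thesis by simp
qed

definition bounded :: "nat list \<Rightarrow> bool" where
  "bounded x \<longleftrightarrow> length x = T \<and> (\<forall>t<T. x ! t \<le> ns ! t)"

lemma canonset_sub: "canonset x \<subseteq> V"
  by (auto simp: canonset_def)

lemma cnt_canonset: "bounded x \<Longrightarrow> cnt (canonset x) = x"
  by (rule nth_equalityI) (simp_all add: bounded_def cnt_def card_canonset_cell)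

lemma canonset_UN: "canonset x = (\<Union>t<T. canonset x \<inter> cell t)"
  using cell_ex canonset_sub by fastforce

text \<open>Empty and full cells leave no choice. This returns the source and the target themselves
  at the ends of the sequence.\<close>

lemma canonset_cnt:
  assumes "\<And>t. t < T \<Longrightarrow> A \<inter> cell t = (if cnt A ! t = 0 then {} else cell t)"
    "\<And>t. t < T \<Longrightarrow> cnt A ! t \<in> {0, ns ! t}" "A \<subseteq> V"
  shows "canonset (cnt A) = A"
proof -
  have "canonset (cnt A) \<inter> cell t = A \<inter> cell t" if t: "t < T" for t
  proof (cases "cnt A ! t = 0")
    case True then show ?thesis using assms(1)[OF t] canonset_cell[OF t] by simp
  next
    case False
    then have "cnt A ! t = length (cls ! t)" using assms(2)[OF t] length_cls[OF t] ns_nth[OF t] by auto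
    then have "canonset (cnt A) \<inter> cell t = cell t" unfolding canonset_cell[OF t] by (simp add: cell_def)
    then show ?thesis using assms(1)[OF t] False by simp
  qed
  moreover have "A = (\<Union>t<T. A \<inter> cell t)" using assms(3) cell_ex by auto
  ultimately show ?thesis using canonset_UN[of "cnt A"] by auto
qed

text \<open>Canonical sets meet a cell in initial segments of one list, which are nested; only the
  two cells of the move change, by one vertex each.\<close>

lemma canonset_move:
  assumes "bounded x" "bounded y" "mv x y"
  shows "card (canonset x - canonset y) = 1" "card (canonset y - canonset x) = 1"
proof -
  have lx: "length x = T" using assms(1) by (simp add: bounded_def)
  from assms(3) obtain i j where ij: "i < T" "j < T" "i \<noteq> j" "0 < x ! j" and y: "y = x[i := Suc (x ! i), j := x ! j - 1]"
    unfolding mv_def lx by (elim exE conjE)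
  have yi: "y ! i = Suc (x ! i)" "y ! j = x ! j - 1" "\<And>t. t \<noteq> i \<Longrightarrow> t \<noteq> j \<Longrightarrow> y ! t = x ! t" using ij lx by (simp_all add: y)
  have le: "canonset z \<inter> cell t \<subseteq> canonset w \<inter> cell t" if "z ! t \<le> w ! t" "t < T" for z w t
    unfolding canonset_cell[OF that(2)] using set_take_subset_set_take[OF that(1), of "cls ! t"] by blast
  have mem: "u \<in> canonset z \<Longrightarrow> \<exists>t<T. u \<in> canonset z \<inter> cell t" for u z using cell_ex canonset_sub by blast
  have fin: "finite (canonset z \<inter> cell t)" for z t using fin_cell by simp
  have d1: "canonset x - canonset y = (canonset x \<inter> cell j) - (canonset y \<inter> cell j)"
  proof
    show "canonset x - canonset y \<subseteq> (canonset x \<inter> cell j) - (canonset y \<inter> cell j)"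
    proof
      fix u assume u: "u \<in> canonset x - canonset y"
      then obtain t where t: "t < T" "u \<in> canonset x \<inter> cell t" using mem by blast
      have "t = j"
      proof (rule ccontr)
        assume "t \<noteq> j"
        then have "x ! t \<le> y ! t" using yi by (cases "t = i") auto
        from le[OF this t(1)] t(2) u show False by blast
      qed
      then show "u \<in> (canonset x \<inter> cell j) - (canonset y \<inter> cell j)" using t u by blast
    qed
  qed blast
  have d2: "canonset y - canonset x = (canonset y \<inter> cell i) - (canonset x \<inter> cell i)"
  proof
    show "canonset y - canonset x \<subseteq> (canonset y \<inter> cell i) - (canonset x \<inter> cell i)"
    proof
      fix u assume u: "u \<in> canonset y - canonset x"
      then obtain t where t: "t < T" "u \<in> canonset y \<inter> cell t" using mem by blast
      have "t = i"
      proof (rule ccontr)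
        assume "t \<noteq> i"
        then have "y ! t \<le> x ! t" using yi by (cases "t = j") auto
        from le[OF this t(1)] t(2) u show False by blast
      qed
      then show "u \<in> (canonset y \<inter> cell i) - (canonset x \<inter> cell i)" using t u by blast
    qed
  qed blast
  have b: "x ! t \<le> ns ! t" "y ! t \<le> ns ! t" if "t < T" for t using assms(1,2) that by (simp_all add: bounded_def)
  have "card (canonset x - canonset y) = x ! j - y ! j"
    unfolding d1 using card_Diff_subset[OF fin le[of y j x]] ij yi b[OF ij(2)] card_canonset_cell[OF ij(2)] by simp
  then show "card (canonset x - canonset y) = 1" using yi ij by simp
  have "card (canonset y - canonset x) = y ! i - x ! i"
    unfolding d2 using card_Diff_subset[OF fin le[of x i y]] ij yi b[OF ij(1)] card_canonset_cell[OF ij(1)] by simp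
  then show "card (canonset y - canonset x) = 1" using yi by simp
qed

lemma canon_eq: "bounded x \<Longrightarrow> canon J x = map enc_nat (sorted_list_of_set (canonset x))"
proof -
  assume b: "bounded x"
  have z: "zip x cls = map (\<lambda>t. (x ! t, cls ! t)) [0..<T]"
    by (rule nth_equalityI) (use b in \<open>auto simp: bounded_def\<close>)
  have "canon J x = map enc_nat (filter (\<lambda>u. \<exists>t<T. enc_nat u \<in> set (take (x ! t) (cls ! t))) (sorted_list_of_set V))"
    unfolding canon_def vlist(1) z filter_map comp_def by (intro arg_cong[where f = "map enc_nat"] filter_cong refl) auto
  also have "filter (\<lambda>u. \<exists>t<T. enc_nat u \<in> set (take (x ! t) (cls ! t))) (sorted_list_of_set V) = sorted_list_of_set (canonset x)"
  proof (rule sorted_distinct_set_unique)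
    show "set (filter (\<lambda>u. \<exists>t<T. enc_nat u \<in> set (take (x ! t) (cls ! t))) (sorted_list_of_set V)) = set (sorted_list_of_set (canonset x))"
      using finV finite_subset[OF canonset_sub finV] by (simp add: canonset_def)
  qed (use finV in \<open>simp_all add: sorted_wrt_filter\<close>)
  finally show ?thesis .
qed

definition lstate :: "nat list \<Rightarrow> bool" where
  "lstate x \<longleftrightarrow> bounded x \<and> lcl q ns x \<in> set (fst (snd R)) \<and> sum_list x = card (source I)"

lemma valid_iff:
  assumes "\<And>x. x \<in> set rows \<Longrightarrow> length x = T"
  shows "valid J R rows \<longleftrightarrow> hd rows = cnt (source I) \<and> hd (rev rows) = cnt (target I) \<and> (\<forall>x\<in>set rows. lstate x) \<and>
    (\<forall>p\<in>set (zip rows (tl rows)). llinked q ns (fst p) (snd p))"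
proof -
  have "(\<forall>p\<in>set (zip x ns). fst p \<le> snd p) \<longleftrightarrow> (\<forall>t<T. x ! t \<le> ns ! t)" if "length x = T" for x
    using that len_ns by (auto simp: set_zip)
  then have "(\<forall>x\<in>set rows. (\<forall>p\<in>set (zip x ns). fst p \<le> snd p) \<and> lcl q ns x \<in> set (fst (snd R)) \<and> sum_list x = card (source I)) \<longleftrightarrow>
     (\<forall>x\<in>set rows. lstate x)"
    using assms by (intro ball_cong refl) (simp add: lstate_def bounded_def)
  then show ?thesis unfolding valid_def svec_source(1) svec_target(1) R_parts(1) sum_cnt[OF src_sub] by simp
qed

text \<open>Every vector of the expansion has the class of some row and is thus feasible, and
  canonical sets turn moves into jumps. A move contributes 2 to \<open>lcost\<close>, and there is
  one set more than there are moves.\<close>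

theorem sound:
  assumes "rows \<noteq> []" "\<And>x. x \<in> set rows \<Longrightarrow> length x = T" "valid J R rows"
  shows "TJ_sequence G (formula I) (free_var I) (source I) (target I) (map canonset (expand rows))"
    "2 * length (map canonset (expand rows)) = lcost rows + 2"
    "map (\<lambda>x. canon J x) (expand rows) = map (\<lambda>A. map enc_nat (sorted_list_of_set A)) (map canonset (expand rows))"
proof -
  have v: "hd rows = cnt (source I)" "last rows = cnt (target I)" "\<And>x. x \<in> set rows \<Longrightarrow> lstate x"
    "\<And>p. p \<in> set (zip rows (tl rows)) \<Longrightarrow> llinked q ns (fst p) (snd p)"
  proof -
    have "valid J R rows \<longleftrightarrow> hd rows = cnt (source I) \<and> hd (rev rows) = cnt (target I) \<and> (\<forall>x\<in>set rows. lstate x) \<and>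
      (\<forall>p\<in>set (zip rows (tl rows)). llinked q ns (fst p) (snd p))" by (rule valid_iff) (rule assms(2))
    then show "hd rows = cnt (source I)" "last rows = cnt (target I)" "\<And>x. x \<in> set rows \<Longrightarrow> lstate x"
      "\<And>p. p \<in> set (zip rows (tl rows)) \<Longrightarrow> llinked q ns (fst p) (snd p)" using assms(3) unfolding hd_rev by auto
  qed
  let ?E = "expand rows"
  have "x \<in> set rows \<Longrightarrow> length x = T \<and> sum_list x = card (source I)" for x using v(3) by (simp add: lstate_def bounded_def)
  note ep = expand_props[OF assms(1) this]
  have E: "?E \<noteq> []" "hd ?E = cnt (source I)" "last ?E = cnt (target I)" "successively mv ?E" "2 * length ?E = lcost rows + 2"
    using ep v(1,2) by simp_all
  have good: "bounded z \<and> lcl q ns z \<in> set (fst (snd R))" if z: "z \<in> set ?E" for z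
  proof -
    from ep z have "z \<in> set rows \<or> (\<exists>p\<in>set (zip rows (tl rows)). z \<in> set (seg (fst p) (snd p)))" by blast
    then show ?thesis
    proof (elim disjE bexE)
      assume "z \<in> set rows" then show ?thesis using v(3) by (simp add: lstate_def)
    next
      fix p assume p: "p \<in> set (zip rows (tl rows))" and zs: "z \<in> set (seg (fst p) (snd p))"
      have m: "fst p \<in> set rows" "snd p \<in> set rows"
        using p set_zip_leftD[of "fst p" "snd p" rows "tl rows"] set_zip_rightD[of "fst p" "snd p" rows "tl rows"] list.set_sel(2)[of rows] assms(1) by auto
      note sx = v(3)[OF m(1)] and sy = v(3)[OF m(2)]
      have l: "length (fst p) = T" "length (snd p) = T" using sx sy by (simp_all add: lstate_def bounded_def)
      have "z = fst p \<or> lcl q ns z = lcl q ns (fst p) \<and> between (fst p) (snd p) z"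
        by (rule seg_cases[OF _ _ v(4)[OF p] zs]) (use sx sy l len_ns in \<open>simp_all add: lstate_def\<close>)
      then show ?thesis
      proof (elim disjE conjE)
        assume "z = fst p" then show ?thesis using sx by (simp add: lstate_def)
      next
        assume e: "lcl q ns z = lcl q ns (fst p)" and b: "between (fst p) (snd p) z"
        have "z ! t \<le> ns ! t" if "t < T" for t
        proof -
          have "z ! t \<le> max (fst p ! t) (snd p ! t)" using b that l by (simp add: between_def)
          moreover have "fst p ! t \<le> ns ! t" "snd p ! t \<le> ns ! t" using sx sy that by (simp_all add: lstate_def bounded_def)
          ultimately show ?thesis by simp
        qed
        then show ?thesis using e b l sx by (simp add: bounded_def between_def lstate_def)
      qed
    qed
  qed
  have src: "canonset (cnt (source I)) = source I" by (rule canonset_cnt[OF svec_source(3,2) src_sub])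
  have tgt: "canonset (cnt (target I)) = target I" by (rule canonset_cnt[OF svec_target(3,2) tgt_sub])
  show "TJ_sequence G (formula I) (free_var I) (source I) (target I) (map canonset ?E)"
    unfolding TJ_sequence_def
  proof (intro conjI ballI allI impI)
    show "map canonset ?E \<noteq> []" "hd (map canonset ?E) = source I" "last (map canonset ?E) = target I"
      using E src tgt by (simp_all add: hd_map last_map)
    fix A assume "A \<in> set (map canonset ?E)"
    then obtain z where z: "z \<in> set ?E" "A = canonset z" by auto
    then show "A \<subseteq> V" "models_set G (formula I) (free_var I) A"
      using canonset_sub feas_cnt[OF canonset_sub, of z] good[OF z(1)] cnt_canonset[of z] by auto
  next
    fix l assume l: "Suc l < length (map canonset ?E)"
    have "mv (?E ! l) (?E ! Suc l)" using E(4) l by (simp add: successively_conv_nth)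
    moreover have "bounded (?E ! l)" "bounded (?E ! Suc l)" using good l by simp_all
    ultimately show "card (map canonset ?E ! l - map canonset ?E ! Suc l) = 1" "card (map canonset ?E ! Suc l - map canonset ?E ! l) = 1"
      using canonset_move l by simp_all
  qed
  show "2 * length (map canonset ?E) = lcost rows + 2" using E(5) by simp
  show "map (\<lambda>x. canon J x) ?E = map (\<lambda>A. map enc_nat (sorted_list_of_set A)) (map canonset ?E)"
    using canon_eq good by simp
qed

section \<open>Completeness: from jump sequences to candidates\<close>

definition rowsof :: "nat \<Rightarrow> (nat \<Rightarrow> nat \<Rightarrow> nat) \<Rightarrow> nat list list" where
  "rowsof M y = map (\<lambda>j. map (y j) [0..<T]) [0..<Suc M]"

sublocale jp: jump T q "\<lambda>t. card (cell t)" "\<lambda>t. cnt (source I) ! t" "\<lambda>t. cnt (target I) ! t" "card (source I)" "\<lambda>c. c \<in> set (fst (snd R))" .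

lemma jp_cl: "jp.cl x = lcl q ns (map x [0..<T])"
  unfolding jp.cl_def by (rule nth_equalityI) (simp_all add: lcl_def len_ns ns_nth)

lemma jp_rdist: "jp.rdist x y = ldist (map x [0..<T]) (map y [0..<T])"
  unfolding jp.rdist_def ldist_def ndist_def by (simp add: sum_list_zip[of _ T])

lemma jp_linked: "jp.linked x y \<longleftrightarrow> llinked q ns (map x [0..<T]) (map y [0..<T])"
proof -
  have "zip (map x [0..<T]) (map y [0..<T]) = map (\<lambda>t. (x t, y t)) [0..<T]" by (rule nth_equalityI) auto
  then show ?thesis unfolding jp.linked_def llinked_def jp_cl jp_rdist ndist_def by auto
qed

lemma jp_state: "jp.state x \<longleftrightarrow> lstate (map x [0..<T])"
  unfolding jp.state_def lstate_def bounded_def jp_cl by (simp add: sum_list_nth[of _ T] ns_nth)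

lemma zip_tl_rowsof: "zip (rowsof M y) (tl (rowsof M y)) = map (\<lambda>j. (map (y j) [0..<T], map (y (Suc j)) [0..<T])) [0..<M]"
  unfolding rowsof_def by (rule nth_equalityI) (simp_all del: upt_Suc add: nth_tl)

lemma valid_rowsof:
  assumes "jp.ok M y" shows "valid J R (rowsof M y)"
proof -
  have len: "length x = T" if "x \<in> set (rowsof M y)" for x using that by (auto simp: rowsof_def)
  have "hd (rowsof M y) = map (y 0) [0..<T]" "last (rowsof M y) = map (y M) [0..<T]"
    unfolding rowsof_def by (simp_all del: upt_Suc add: hd_map last_map)
  moreover have "map (y 0) [0..<T] = cnt (source I)" "map (y M) [0..<T] = cnt (target I)"
    using assms by (auto intro!: nth_equalityI simp: jp.ok_def length_cnt)
  moreover have "\<forall>x\<in>set (rowsof M y). lstate x"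
  proof
    fix x assume "x \<in> set (rowsof M y)"
    then have "x \<in> (\<lambda>j. map (y j) [0..<T]) ` {..<Suc M}" unfolding rowsof_def by (simp del: upt_Suc add: atLeast0LessThan)
    then show "lstate x"
    proof (rule imageE)
      fix j assume j: "x = map (y j) [0..<T]" "j \<in> {..<Suc M}"
      then have "jp.state (y j)" using assms by (simp add: jp.ok_def)
      then show "lstate x" unfolding j(1) jp_state .
    qed
  qed
  moreover have "\<forall>p\<in>set (zip (rowsof M y) (tl (rowsof M y))). llinked q ns (fst p) (snd p)"
    unfolding zip_tl_rowsof using assms jp_linked by (auto simp: jp.ok_def)
  moreover have "valid J R (rowsof M y) \<longleftrightarrow> hd (rowsof M y) = cnt (source I) \<and> hd (rev (rowsof M y)) = cnt (target I) \<and>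
     (\<forall>x\<in>set (rowsof M y). lstate x) \<and> (\<forall>p\<in>set (zip (rowsof M y) (tl (rowsof M y))). llinked q ns (fst p) (snd p))"
    by (rule valid_iff) (rule len)
  ultimately show ?thesis unfolding hd_rev by simp
qed

lemma lcost_rowsof: "lcost (rowsof M y) = jp.cost M y"
  unfolding lcost_def zip_tl_rowsof jp.cost_def jp_rdist
  by (simp add: comp_def interv_sum_list_conv_sum_set_nat atLeast0LessThan)

text \<open>Split each coefficient into its positive and negative part. The subtraction is exact
  because the value is a natural number.\<close>

lemma form_evalf:
  assumes "jp.form (fbound K) (int z)"
  shows "\<exists>f\<in>set (fpairs K). evalf ns (fst f) - evalf ns (snd f) = z"
proof -
  obtain a0 a where a: "\<bar>a0\<bar> \<le> int (fbound K)" "\<And>t. t < T \<Longrightarrow> \<bar>a t\<bar> \<le> int (fbound K)"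
    and z: "int z = a0 + (\<Sum>t<T. a t * int (card (cell t)))" using assms unfolding jp.form_def by blast
  let ?P = "nat a0 # map (\<lambda>t. nat (a t)) [0..<T]" and ?N = "nat (- a0) # map (\<lambda>t. nat (- a t)) [0..<T]"
  have mem: "?P \<in> set (forms K)" "?N \<in> set (forms K)"
  proof -
    have "set ?P \<subseteq> {..<Suc (fbound K)}" "set ?N \<subseteq> {..<Suc (fbound K)}" using a by (fastforce simp: abs_le_iff)+
    then show "?P \<in> set (forms K)" "?N \<in> set (forms K)"
      unfolding forms_def set_product_replicate kern_parts(4) by (simp_all add: atLeast0LessThan del: upt_Suc)
  qed
  have "(?P, ?N) \<in> set (fpairs K)" unfolding fpairs_def using mem by auto
  moreover have ev: "evalf ns (c # map b [0..<T]) = c + (\<Sum>t<T. b t * card (cell t))" for c b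
    unfolding evalf_def by (simp add: sum_list_zip[of _ T] len_ns ns_nth)
  have "int (evalf ns ?P) - int (evalf ns ?N) = int z"
  proof -
    have "int (nat b) = b + int (nat (- b))" for b :: int by simp
    then have "(\<Sum>t<T. int (nat (a t)) * int (card (cell t))) = (\<Sum>t<T. a t * int (card (cell t)) + int (nat (- a t)) * int (card (cell t)))"
      by (intro sum.cong refl) (simp add: distrib_right[symmetric])
    then show ?thesis unfolding ev z of_nat_add of_nat_sum of_nat_mult sum.distrib by simp
  qed
  then have "evalf ns ?P - evalf ns ?N = z" by linarith
  ultimately show ?thesis by (intro bexI[of _ "(?P, ?N)"]) simp_all
qed

lemma rowsof_valids:
  assumes ok: "jp.ok (rnum K) y" and fy: "\<And>j t. j \<le> rnum K \<Longrightarrow> t < T \<Longrightarrow> jp.form (fbound K) (int (y j t))"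
  shows "rowsof (rnum K) y \<in> set (valids J R)"
proof -
  define F where "F j t = (SOME f. f \<in> set (fpairs K) \<and> evalf ns (fst f) - evalf ns (snd f) = y j t)" for j t
  have F: "F j t \<in> set (fpairs K) \<and> evalf ns (fst (F j t)) - evalf ns (snd (F j t)) = y j t" if "j \<le> rnum K" "t < T" for j t
    unfolding F_def by (rule someI_ex) (rule form_evalf[OF fy[OF that], unfolded Bex_def])
  define cand where "cand = map (\<lambda>j. map (F j) [0..<T]) [0..<Suc (rnum K)]"
  have row: "map (F j) [0..<T] \<in> set (product_lists (replicate T (fpairs K)))" if "j \<le> rnum K" for j
  proof -
    have "set (map (F j) [0..<T]) \<subseteq> set (fpairs K)" using F[OF that] by (simp add: image_subset_iff)
    then show ?thesis unfolding set_product_replicate by simp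
  qed
  have "set cand \<subseteq> set (product_lists (replicate T (fpairs K)))"
  proof
    fix r assume "r \<in> set cand"
    then have "r \<in> (\<lambda>j. map (F j) [0..<T]) ` {..<Suc (rnum K)}" unfolding cand_def by (simp del: upt_Suc add: atLeast0LessThan)
    then show "r \<in> set (product_lists (replicate T (fpairs K)))"
    proof (rule imageE)
      fix j assume j: "r = map (F j) [0..<T]" "j \<in> {..<Suc (rnum K)}"
      then show ?thesis using row[of j] by simp
    qed
  qed
  moreover have "length cand = Suc (rnum K)" unfolding cand_def by (simp del: upt_Suc)
  ultimately have mem: "cand \<in> set (snd (snd R))"
    unfolding R_parts(2) unfolding set_product_replicate[of "Suc (rnum K)"] by blast
  have "map (\<lambda>f. evalf ns (fst f) - evalf ns (snd f)) (map (F j) [0..<T]) = map (y j) [0..<T]" if "j \<in> set [0..<Suc (rnum K)]" for j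
  proof -
    have "j \<le> rnum K" using that by (simp del: upt_Suc add: less_Suc_eq_le)
    from F[OF this] show ?thesis unfolding map_map comp_def by (intro map_cong refl) simp
  qed
  then have ev: "map (\<lambda>row. map (\<lambda>f. evalf ns (fst f) - evalf ns (snd f)) row) cand = rowsof (rnum K) y"
    unfolding rowsof_def cand_def map_map[of _ _ "[0..<Suc (rnum K)]"] comp_def[of "\<lambda>row. map _ row"] by (rule map_cong[OF refl])
  have "rowsof (rnum K) y \<in> (\<lambda>rows. map (\<lambda>row. map (\<lambda>f. evalf ns (fst f) - evalf ns (snd f)) row) rows) ` set (snd (snd R))"
    by (rule rev_image_eqI, rule mem, rule ev[symmetric])
  then show ?thesis using valid_rowsof[OF ok] unfolding valids_def by simp
qed

text \<open>Counting vertices in cells gives an \<open>ok\<close> sequence. A jump changes at most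
  two counts, each by one, and costs at most 2; inside a cell it is free. \<open>normal_form\<close>
  then yields a candidate of no larger cost.\<close>

theorem complete:
  assumes tj: "TJ_sequence G (formula I) (free_var I) (source I) (target I) Ss"
  shows "\<exists>rows\<in>set (valids J R). lcost rows + 2 \<le> 2 * length Ss"
proof -
  let ?m = "length Ss - 1"
  define x where "x j t = card (Ss ! j \<inter> cell t)" for j t
  have ne: "Ss \<noteq> []" and ends: "hd Ss = source I" "last Ss = target I"
    and sets: "\<And>A. A \<in> set Ss \<Longrightarrow> A \<subseteq> V \<and> models_set G (formula I) (free_var I) A"
    and step: "\<And>l. Suc l < length Ss \<Longrightarrow> card (Ss ! l - Ss ! Suc l) = 1 \<and> card (Ss ! Suc l - Ss ! l) = 1"
    using tj unfolding TJ_sequence_def by blast+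
  have xm: "map (x j) [0..<T] = cnt (Ss ! j)" for j by (simp add: cnt_def x_def[abs_def])
  have nth: "Ss ! j \<subseteq> V" "models_set G (formula I) (free_var I) (Ss ! j)" "finite (Ss ! j)" if "j \<le> ?m" for j
  proof -
    have "Ss ! j \<in> set Ss" using that ne by (simp add: Suc_leI le_less_trans)
    then show "Ss ! j \<subseteq> V" "models_set G (formula I) (free_var I) (Ss ! j)" "finite (Ss ! j)"
      using sets finite_subset[OF _ finV] by blast+
  qed
  have delta: "\<exists>a b. a \<noteq> b \<and> Ss ! j - Ss ! Suc j = {a} \<and> Ss ! Suc j - Ss ! j = {b}" if "j < ?m" for j
  proof -
    have "Suc j < length Ss" using that by linarith
    from step[OF this] obtain a b where "Ss ! j - Ss ! Suc j = {a}" "Ss ! Suc j - Ss ! j = {b}" by (auto simp: card_1_singleton_iff)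
    moreover from this have "a \<noteq> b" by blast
    ultimately show ?thesis by blast
  qed
  have splitc: "card (Ss ! j \<inter> D) = card (Ss ! j \<inter> Ss ! Suc j \<inter> D) + card ((Ss ! j - Ss ! Suc j) \<inter> D)"
    "card (Ss ! Suc j \<inter> D) = card (Ss ! j \<inter> Ss ! Suc j \<inter> D) + card ((Ss ! Suc j - Ss ! j) \<inter> D)" if j: "j < ?m" for j D
  proof -
    have f: "finite (Ss ! j \<inter> D)" "finite (Ss ! Suc j \<inter> D)" using nth(3)[of j] nth(3)[of "Suc j"] j by simp_all
    have "Ss ! j \<inter> D \<inter> Ss ! Suc j = Ss ! j \<inter> Ss ! Suc j \<inter> D" "Ss ! j \<inter> D - Ss ! Suc j = (Ss ! j - Ss ! Suc j) \<inter> D"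
      "Ss ! Suc j \<inter> D \<inter> Ss ! j = Ss ! j \<inter> Ss ! Suc j \<inter> D" "Ss ! Suc j \<inter> D - Ss ! j = (Ss ! Suc j - Ss ! j) \<inter> D" by auto
    then show "card (Ss ! j \<inter> D) = card (Ss ! j \<inter> Ss ! Suc j \<inter> D) + card ((Ss ! j - Ss ! Suc j) \<inter> D)"
      "card (Ss ! Suc j \<inter> D) = card (Ss ! j \<inter> Ss ! Suc j \<inter> D) + card ((Ss ! Suc j - Ss ! j) \<inter> D)"
      using card_Int_Diff[OF f(1), of "Ss ! Suc j"] card_Int_Diff[OF f(2), of "Ss ! j"] by simp_all
  qed
  have cards: "card (Ss ! j) = card (source I)" if "j \<le> ?m" for j
    using that
  proof (induction j)
    case 0 then show ?case using ends ne by (simp add: hd_conv_nth)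
  next
    case (Suc j)
    then have j: "j < ?m" by simp
    obtain a b where ab: "Ss ! j - Ss ! Suc j = {a}" "Ss ! Suc j - Ss ! j = {b}" using delta[OF j] by (elim exE conjE)
    have "card (Ss ! Suc j) = card (Ss ! j)" using splitc[OF j, of UNIV] unfolding ab by simp
    also have "\<dots> = card (source I)" by (rule Suc.IH) (use j in simp)
    finally show ?case .
  qed
  have one: "card ({a} \<inter> D) = of_bool (a \<in> D)" for a :: nat and D by (cases "a \<in> D") simp_all
  have dist: "ndist (x j t) (x (Suc j) t) \<le> 1 \<and> (\<exists>a b. a \<in> V \<and> b \<in> V \<and> (\<forall>t. ndist (x j t) (x (Suc j) t) \<le> of_bool (a \<in> cell t) + of_bool (b \<in> cell t)))"
    if j: "j < ?m" for j t
  proof -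
    obtain a b where ab: "Ss ! j - Ss ! Suc j = {a}" "Ss ! Suc j - Ss ! j = {b}" using delta[OF j] by blast
    have "x j t = card (Ss ! j \<inter> Ss ! Suc j \<inter> cell t) + of_bool (a \<in> cell t)"
      "x (Suc j) t = card (Ss ! j \<inter> Ss ! Suc j \<inter> cell t) + of_bool (b \<in> cell t)" for t
      unfolding x_def using splitc[OF j, of "cell t"] unfolding ab one by simp_all
    moreover have "ndist (k + m) (k + n) = ndist m n" for k m n by (simp add: ndist_def)
    ultimately have "ndist (x j t) (x (Suc j) t) = ndist (of_bool (a \<in> cell t)) (of_bool (b \<in> cell t))" for t by simp
    moreover have "ndist (of_bool P) (of_bool Q) \<le> 1 \<and> ndist (of_bool P) (of_bool Q) \<le> of_bool P + of_bool Q" for P Q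
      by (simp add: ndist_def)
    ultimately have nd: "ndist (x j t) (x (Suc j) t) \<le> 1" "ndist (x j t) (x (Suc j) t) \<le> of_bool (a \<in> cell t) + of_bool (b \<in> cell t)" for t
      by metis+
    have "a \<in> Ss ! j" "b \<in> Ss ! Suc j" using ab by blast+
    then have "a \<in> V" "b \<in> V" using nth(1)[of j] nth(1)[of "Suc j"] j by (meson less_imp_le_nat subsetD Suc_leI)+
    then show ?thesis using nd by (intro conjI exI[of _ a] exI[of _ b]) simp_all
  qed
  have onecell: "(\<Sum>t<T. of_bool (a \<in> cell t)) = (1::nat)" if "a \<in> V" for a
  proof -
    have "of_bool (a \<in> cell t) = (if t = ty a then 1 else (0::nat))" if "t < T" for t
      using ty_iff[OF that \<open>a \<in> V\<close>] by auto
    then have "(\<Sum>t<T. of_bool (a \<in> cell t)) = (\<Sum>t<T. if t = ty a then 1 else (0::nat))" by (intro sum.cong) auto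
    then show ?thesis using ty[OF that] by simp
  qed
  have rd: "jp.rdist (x j) (x (Suc j)) \<le> 2" if j: "j < ?m" for j
  proof -
    obtain a b where ab: "a \<in> V" "b \<in> V" "\<And>t. ndist (x j t) (x (Suc j) t) \<le> of_bool (a \<in> cell t) + of_bool (b \<in> cell t)"
      using dist[OF j, of 0] by blast
    have "jp.rdist (x j) (x (Suc j)) \<le> (\<Sum>t<T. of_bool (a \<in> cell t) + of_bool (b \<in> cell t))"
      unfolding jp.rdist_def by (rule sum_mono) (rule ab(3))
    also have "\<dots> = 2" using onecell ab(1,2) by (simp add: sum.distrib)
    finally show ?thesis .
  qed
  have ok: "jp.ok ?m x" unfolding jp.ok_def
  proof (intro conjI allI impI)
    fix t assume t: "t < T"
    show "x 0 t = cnt (source I) ! t" "x ?m t = cnt (target I) ! t"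
      using t ends ne by (simp_all add: x_def cnt_def hd_conv_nth last_conv_nth)
  next
    fix j assume j: "j \<le> ?m"
    have "cnt (Ss ! j) ! t \<le> ns ! t" if "t < T" for t
      using that card_mono[OF fin_cell, of "Ss ! j \<inter> cell t" t] by (simp add: cnt_def ns_nth)
    then show "jp.state (x j)" unfolding jp_state xm lstate_def bounded_def
      using feas_cnt[OF nth(1)[OF j]] nth(2)[OF j] sum_cnt[OF nth(1)[OF j]] cards[OF j] by (simp add: length_cnt)
  next
    fix j assume j: "j < ?m"
    show "jp.linked (x j) (x (Suc j))" unfolding jp.linked_def using dist[OF j] rd[OF j] by blast
  qed
  have s: "cnt (source I) ! t \<in> {0, card (cell t)}" "cnt (target I) ! t \<in> {0, card (cell t)}" if "t < T" for t
    using svec_source(2)[OF that] svec_target(2)[OF that] ns_nth[OF that] by simp_all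
  have "rnum K = 2 * ((q + 1) * (q + 1)) ^ T" by (simp add: rnum_def kern_parts(4))
  note nf = jp.normal_form[OF ok s this]
  have "\<exists>y. jp.ok (rnum K) y \<and> jp.cost (rnum K) y \<le> jp.cost ?m x \<and>
      (\<forall>j\<le>rnum K. \<forall>t<T. jp.form ((q + 1) * (3 * T + 3) ^ ((rnum K + 1) * T)) (int (y j t)))"
    by (rule nf) assumption+
  then obtain y where y: "jp.ok (rnum K) y" "jp.cost (rnum K) y \<le> jp.cost ?m x"
    and fy: "\<And>j t. j \<le> rnum K \<Longrightarrow> t < T \<Longrightarrow> jp.form ((q + 1) * (3 * T + 3) ^ ((rnum K + 1) * T)) (int (y j t))" by (elim exE conjE) simp
  have fb: "(q + 1) * (3 * T + 3) ^ ((rnum K + 1) * T) = fbound K" by (simp add: fbound_def kern_parts(4))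
  have "jp.cost ?m x \<le> (\<Sum>j<?m. 2)" unfolding jp.cost_def by (rule sum_mono) (use rd in simp)
  then have cx: "jp.cost ?m x + 2 \<le> 2 * length Ss" using ne by (cases Ss) simp_all
  have "rowsof (rnum K) y \<in> set (valids J R)"
    using y(1) fy unfolding fb by (rule rowsof_valids)
  moreover have "lcost (rowsof (rnum K) y) + 2 \<le> 2 * length Ss" unfolding lcost_rowsof using y(2) cx by linarith
  ultimately show ?thesis by (intro bexI)
qed

end


section \<open>Optimality of the output and size of the kernel\<close>

lemma ex_min_in_set: "xs \<noteq> [] \<Longrightarrow> \<exists>x\<in>set xs. \<forall>y\<in>set xs. (f x :: nat) \<le> f y"
  by (metis arg_min_if_finite(1) arg_min_least finite_set set_empty)

lemma best_valids:
  assumes "valids i r \<noteq> []"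
  shows "best i r \<in> set (valids i r)" "\<And>y. y \<in> set (valids i r) \<Longrightarrow> lcost (best i r) \<le> lcost y"
proof -
  let ?F = "filter (\<lambda>x. \<forall>y\<in>set (valids i r). lcost x \<le> lcost y) (valids i r)"
  have "?F \<noteq> []" using ex_min_in_set[OF assms, of lcost] unfolding filter_empty_conv by blast
  then have "best i r \<in> set ?F" unfolding best_def by (rule hd_in_set)
  then show "best i r \<in> set (valids i r)" "\<And>y. y \<in> set (valids i r) \<Longrightarrow> lcost (best i r) \<le> lcost y" by simp_all
qed

lemma length_code: "length (code p) \<le> mso1_length p"
  by (induction p) auto

text \<open>Bounded tags give an instruction bounded size once its operands are positions.\<close>

lemma code_tag: "x \<in> set (code p) \<Longrightarrow> \<exists>n\<le>12. fst x = enc_nat n"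
  by (induction p) (auto intro: exI[of _ "0::nat"] exI[of _ "1::nat"] exI[of _ "2::nat"] exI[of _ "3::nat"] exI[of _ "4::nat"]
    exI[of _ "5::nat"] exI[of _ "6::nat"] exI[of _ "7::nat"] exI[of _ "8::nat"] exI[of _ "9::nat"] exI[of _ "10::nat"] exI[of _ "11::nat"]
    exI[of _ "12::nat"])

lemma tree_size_enc_nat: "tree_size (enc_nat n) \<le> 1 + 4 * n"
proof (induction n rule: less_induct)
  case (less n)
  show ?case
  proof (cases "n = 0")
    case False
    then have "tree_size (enc_nat (n div 2)) \<le> 1 + 4 * (n div 2)" "0 < n" by (auto intro!: less.IH[simplified])
    moreover have "odd n \<longrightarrow> tree_size (enc_nat n) = 4 + tree_size (enc_nat (n div 2))"
      "even n \<longrightarrow> tree_size (enc_nat n) = 2 + tree_size (enc_nat (n div 2))"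
      using False by (subst enc_nat.simps, simp)+
    ultimately show ?thesis by presburger
  qed (simp add: enc_nat.simps)
qed

context msor1_inst
begin

lemma valids_rows:
  assumes "rows \<in> set (valids J R)"
  shows "rows \<noteq> []" "\<And>x. x \<in> set rows \<Longrightarrow> length x = T" "valid J R rows"
proof -
  obtain cand where c: "cand \<in> set (snd (snd R))" "rows = map (\<lambda>row. map (\<lambda>f. evalf ns (fst f) - evalf ns (snd f)) row) cand"
    and v: "valid J R rows" using assms unfolding valids_def by auto
  have "length cand = Suc (rnum K)" "set cand \<subseteq> set (product_lists (replicate T (fpairs K)))"
    using c(1) unfolding R_parts(2) set_product_replicate[of "Suc (rnum K)"] by simp_all
  moreover have "length r = T" if "r \<in> set (product_lists (replicate T (fpairs K)))" for r
    using that unfolding set_product_replicate by simp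
  ultimately have "length cand = Suc (rnum K)" "\<And>r. r \<in> set cand \<Longrightarrow> length r = T" by blast+
  then show "rows \<noteq> []" "\<And>x. x \<in> set rows \<Longrightarrow> length x = T" unfolding c(2) by auto
  show "valid J R rows" by (rule v)
qed

theorem decide_iff: "decide J R \<longleftrightarrow> msor1_yes I"
proof
  assume "decide J R"
  then obtain rows where "rows \<in> set (valids J R)" unfolding decide_def by (meson hd_in_set)
  from sound(1)[OF valids_rows[OF this]] show "msor1_yes I" unfolding msor1_yes_def by blast
next
  assume "msor1_yes I"
  then obtain Ss where "TJ_sequence G (formula I) (free_var I) (source I) (target I) Ss" unfolding msor1_yes_def by blast
  from complete[OF this] show "decide J R" unfolding decide_def by (elim bexE) (metis list.set(1) empty_iff)
qed

text \<open>The length of the output is determined by \<open>lcost\<close> (\<open>sound\<close>),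
  and every sequence is matched by a candidate at least as cheap (\<open>complete\<close>); so
  minimal cost means minimal length.\<close>

theorem search_correct:
  assumes "msor1_yes I" shows "encodes_shortest_TJ_sequence I (encode (search J R))"
proof -
  let ?b = "best J R"
  let ?Ss = "map canonset (expand ?b)"
  have "valids J R \<noteq> []" using assms decide_iff by (simp add: decide_def)
  note best = best_valids[OF this]
  note snd = sound[OF valids_rows[OF best(1)]]
  have "length ?Ss \<le> length Ts" if Ts: "TJ_sequence G (formula I) (free_var I) (source I) (target I) Ts" for Ts
  proof -
    obtain rows where "rows \<in> set (valids J R)" "lcost rows + 2 \<le> 2 * length Ts" using complete[OF Ts] by blast
    then show ?thesis using best(2)[of rows] snd(2) by linarith
  qed
  then have sh: "shortest_TJ_sequence G (formula I) (free_var I) (source I) (target I) ?Ss"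
    unfolding shortest_TJ_sequence_def using snd(1) by blast
  have eq: "search J R = map (\<lambda>A. map enc_nat (sorted_list_of_set A)) ?Ss"
    using snd(3) by (simp only: search_def)
  have "encode (map (\<lambda>A. map enc_nat (sorted_list_of_set A)) Ts) = enc_list enc_vset Ts" for Ts
    by (induction Ts) (simp_all add: encode_map enc_vset_def encode_tree_def)
  from this[of ?Ss] have "encode (search J R) = enc_list enc_vset ?Ss" unfolding eq .
  with sh show ?thesis unfolding encodes_shortest_TJ_sequence_def by blast
qed

lemma length_nms: "length nms \<le> 1 + 2 * length (code (formula I))"
proof -
  have "length nms = card (set nms)" using nms_props(2) by (simp add: distinct_card)
  also have "\<dots> \<le> Suc (card (cnames (code (formula I))))" unfolding nms_props(1) by (rule card_insert_le_m1) simp_all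
  also have "card (cnames (code (formula I))) \<le> (\<Sum>c\<in>set (code (formula I)). 2)"
    unfolding cnames_def by (rule order_trans[OF card_UN_le[OF finite_set] sum_mono]) (simp add: card_insert_if)
  also have "\<dots> \<le> 2 * length (code (formula I))" using card_length[of "code (formula I)"] by simp
  finally show ?thesis by simp
qed

definition twin_class :: "nat \<Rightarrow> nat set" where
  "twin_class u = {v \<in> V. twins G u v}"

text \<open>Being twins is transitive on the vertices, so its equivalence classes are the maximal
  sets of pairwise twins.\<close>

lemma twin_class: "u \<in> V \<Longrightarrow> twin_class u \<in> twin_classes G"
proof -
  assume u: "u \<in> V"
  have uu: "twins G u u" by (simp add: twins_def)
  have "twins G v w" if "v \<in> V" "w \<in> V" "twins G u v" "twins G u w" for v w
    by (rule twins_trans[OF graph that(1) u that(2) twins_sym[OF that(3)] that(4)])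
  then have "twin_set G (twin_class u)" using u uu by (auto simp: twin_set_def twin_class_def)
  moreover have "T' = twin_class u" if T': "twin_set G T'" "twin_class u \<subseteq> T'" for T'
  proof
    have "u \<in> T'" using T'(2) u uu by (auto simp: twin_class_def)
    then show "T' \<subseteq> twin_class u" using T'(1) by (auto simp: twin_set_def twin_class_def)
  qed (rule T'(2))
  ultimately show ?thesis unfolding twin_classes_def by blast
qed

text \<open>A cell is determined by its twin class, by the names that are colors of its vertices,
  and by its sides with respect to source and target; the last two bits give the factor 4.\<close>

lemma T_le: "T \<le> nd G * 2 ^ length nms * 4"
proof -
  define f where "f u = (twin_class u, {c \<in> set nms. incol J c (enc_nat u)}, u \<in> source I, u \<in> target I)" for u
  define r where "r t = (SOME u. u \<in> cell t)" for t
  have r: "r t \<in> cell t" "r t \<in> V" if t: "t < T" for t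
  proof -
    obtain u where "u \<in> V" "cell t = {v \<in> V. rel u v}" using cls_nth[OF t] by blast
    then have "u \<in> cell t" using rel_refl by simp
    then show "r t \<in> cell t" unfolding r_def by (rule someI)
    then show "r t \<in> V" using cell_sub by blast
  qed
  let ?S = "twin_classes G \<times> Pow (set nms) \<times> (UNIV :: bool set) \<times> (UNIV :: bool set)"
  have "inj_on (\<lambda>t. f (r t)) {..<T}"
  proof (rule inj_onI)
    fix s t assume st: "s \<in> {..<T}" "t \<in> {..<T}" and e: "f (r s) = f (r t)"
    then have lt: "s < T" "t < T" by simp_all
    have "twins G (r t) (r t)" by (simp add: twins_def)
    then have "r t \<in> twin_class (r t)" using r(2)[OF lt(2)] by (simp add: twin_class_def)
    moreover have "twin_class (r s) = twin_class (r t)" using e by (simp add: f_def)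
    ultimately have "twins G (r s) (r t)" by (auto simp: twin_class_def)
    moreover have "{c \<in> set nms. incol J c (enc_nat (r s))} = {c \<in> set nms. incol J c (enc_nat (r t))}"
      "(r s \<in> source I) = (r t \<in> source I)" "(r s \<in> target I) = (r t \<in> target I)" using e by (simp_all add: f_def)
    ultimately have "rel (r s) (r t)" unfolding rel_def by blast
    moreover obtain u where u: "u \<in> V" "cell s = {v \<in> V. rel u v}" using cls_nth[OF lt(1)] by blast
    ultimately have "r t \<in> cell s" using r[OF lt(1)] r(2)[OF lt(2)] rel_trans[of u "r s" "r t"] by blast
    then show "s = t" using cell_disjoint[OF lt _ r(1)[OF lt(2)]] by blast
  qed
  moreover have "(\<lambda>t. f (r t)) ` {..<T} \<subseteq> ?S"
  proof
    fix y assume "y \<in> (\<lambda>t. f (r t)) ` {..<T}"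
    then obtain t where t: "t < T" "y = f (r t)" by blast
    then show "y \<in> ?S" using twin_class[OF r(2)[OF t(1)]] by (simp add: f_def)
  qed
  moreover have fin: "finite ?S"
  proof -
    have "twin_classes G \<subseteq> Pow V" by (auto simp: twin_classes_def twin_set_def)
    then have "finite (twin_classes G)" by (rule finite_subset) (simp add: finV)
    then show ?thesis by simp
  qed
  ultimately have "card {..<T} \<le> card ?S" by (rule card_inj_on_le)
  also have "\<dots> = nd G * 2 ^ length nms * 4"
    using nms_props(2) by (simp add: card_cartesian_product nd_def card_Pow distinct_card del: UNIV_Times_UNIV)
  finally show ?thesis by simp
qed

lemma sz_kern_le: "sz K \<le> (\<lambda>l w t. 20 + (l + 1) * (4 * w + 100) + 2 * w + 2 * w + t * (w * 4 + 10) + t * (t * 4 + 10))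
    (length (code (formula I))) (length nms) T"
proof -
  let ?l = "length (code (formula I))"
  have 1: "sz (fst K) \<le> ?l * (4 * length nms + 59 + 1) + 1"
  proof -
    have "sz (fst c, idx nms (fst (snd c)), idx nms (snd (snd c))) \<le> 4 * length nms + 59" if "c \<in> set (code (formula I))" for c
    proof -
      obtain n where "n \<le> 12" "fst c = enc_nat n" using code_tag[OF \<open>c \<in> _\<close>] by blast
      \<comment> \<open>Tags are at most 12, and \<open>1 + 4 * 12 = 49\<close>.\<close>
      then have "sz (fst c) \<le> 49" using tree_size_enc_nat[of n] by (simp add: encode_tree_def)
      then show ?thesis using idx_length[of nms "fst (snd c)"] idx_length[of nms "snd (snd c)"] by simp
    qed
    then have "sz (fst K) \<le> length (fst K) * (4 * length nms + 59 + 1) + 1"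
      by (intro sz_list_le) (auto simp: kern_def icode_eq)
    then show ?thesis by (simp only: kern_def icode_eq fst_conv length_map)
  qed
  have bools: "sz bs \<le> 1 + length bs * 4" for bs :: "bool list" using sz_list_le[of bs 3] sz_bool by simp
  have rows: "sz (map g cls) \<le> 1 + T * (k * 4 + 2)" if "\<And>x. x \<in> set cls \<Longrightarrow> length (g x) = k" for g :: "tree list \<Rightarrow> bool list" and k
  proof -
    have "sz b \<le> 1 + k * 4" if "b \<in> set (map g cls)" for b using that bools[of b] \<open>\<And>x. x \<in> set cls \<Longrightarrow> length (g x) = k\<close> by auto
    then have "sz (map g cls) \<le> length (map g cls) * ((1 + k * 4) + 1) + 1" by (rule sz_list_le)
    then show ?thesis by simp
  qed
  have 2: "sz (fst (snd K)) \<le> 2 * length nms + 1" "sz (fst (snd (snd K))) \<le> 2 * length nms + 1"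
    using idx_length by (simp_all add: kern_def)
  have 3: "sz (fst (snd (snd (snd K)))) \<le> 1 + T * (length nms * 4 + 2)" unfolding kern_def fst_conv snd_conv by (rule rows) simp
  have 4: "sz (snd (snd (snd (snd K)))) \<le> 1 + T * (T * 4 + 2)" unfolding kern_def fst_conv snd_conv by (rule rows) simp
  have "sz K = 4 + sz (fst K) + sz (fst (snd K)) + sz (fst (snd (snd K))) + sz (fst (snd (snd (snd K)))) + sz (snd (snd (snd (snd K))))"
    by (cases K) simp
  moreover have "?l * (4 * length nms + 59 + 1) \<le> (?l + 1) * (4 * length nms + 100)" "1 + T * (length nms * 4 + 2) \<le> 1 + T * (length nms * 4 + 10)"
    "1 + T * (T * 4 + 2) \<le> 1 + T * (T * 4 + 10)" by (intro add_left_mono mult_le_mono; simp)+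
  ultimately show ?thesis using 1 2 3 4 by linarith
qed

end


section \<open>Assembling the running time\<close>

lemma bd_power: "cf.bd f \<Longrightarrow> cf.bd (\<lambda>n. f n ^ c)"
  by (induction c) (auto intro: cf.bd_const cf.bd_mult)

lemma bd_pow2: "cf.bd f \<Longrightarrow> cf.bd (\<lambda>n. 2 ^ f n)"
proof -
  assume f: "cf.bd f"
  have "cf.bd (\<lambda>n. 2 ^ n)" by (rule cf.bd_le[OF cf.bd_mem pow2_le_grow]) (simp add: fast_def)
  from cf.bd_comp[OF this f] show ?thesis .
qed

text \<open>\<open>g\<close> extracts a kernel, \<open>s\<close> works on the kernel alone, and
  \<open>h\<close> combines its result with the input. With input size \<open>n\<close> and solver
  bound \<open>F\<close>, the bases are at most \<open>3 * n\<close> and \<open>(F + 4) * n\<close>,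
  so parameter and input size separate into a product.\<close>

lemma fpt_kernel:
  fixes g :: "'a::encodable \<Rightarrow> 'b::encodable" and s :: "'b \<Rightarrow> 'c::encodable" and h :: "'a \<Rightarrow> 'c \<Rightarrow> 'd::encodable"
  assumes g: "fc polys g" and s: "fc fast s" and h: "fc polys (\<lambda>p. h (fst p) (snd p))"
    and small: "\<And>I. I \<in> A \<Longrightarrow> sz (g (inst I)) \<le> b (param I)" and b: "cf.bd b"
  shows "\<exists>P f c. computable f \<and> (\<forall>I\<in>A. runs_in_time P (encode (inst I)) (encode (h (inst I) (s (g (inst I)))))
     (f (param I) * tree_size (encode (inst I)) ^ c))"
proof -
  obtain i where i: "runs g (\<lambda>x. (sz x + 2) ^ i)" using g by (auto simp: fc_def polys_def)
  obtain m where m: "runs s (\<lambda>x. grow m (sz x))" "\<And>x. sz (s x) \<le> grow m (sz x)" using s by (auto simp: fc_def fast_def)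
  obtain j where j: "runs (\<lambda>p. h (fst p) (snd p)) (\<lambda>p. (sz p + 2) ^ j)"
    "\<And>p. sz (h (fst p) (snd p)) \<le> (sz p + 2) ^ j" using h by (auto simp: fc_def polys_def)
  let ?t = "\<lambda>x. 1 + ((sz x + 2) ^ i + grow m (sz (g x)) + 3) + 5 + (sz (x, s (g x)) + 2) ^ j + 3"
  have "runs (\<lambda>x. h x (s (g x))) ?t"
    using runs_comp[OF j(1) runs_pair[OF runs_id runs_comp[OF m(1) i]]] by simp
  then obtain P where P: "prog P (\<lambda>x. h x (s (g x))) ?t" unfolding runs_def by blast
  let ?F = "\<lambda>k. grow m (b k)"
  \<comment> \<open>The summands pay for the extraction, for the solver with all constant overheads,
    and twice for the last stage: its time and the size of its output.\<close>
  let ?f = "\<lambda>k. 3 ^ i + ?F k + 14 + 2 * (?F k + 4) ^ j"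
  have "cf.bd ?F" by (rule cf.bd_comp[OF cf.bd_mem b]) (simp add: fast_def)
  then have "cf.bd ?f" by (intro cf.bd_add cf.bd_mult cf.bd_const bd_power)
  then obtain d where d: "d \<in> fast" "\<And>k. ?f k \<le> d k" unfolding cf.bd_def by blast
  then obtain M where "d = grow M" unfolding fast_def by blast
  with d(2) have M: "?f k \<le> grow M k" for k by simp
  have "runs_in_time P (encode (inst I)) (encode (h (inst I) (s (g (inst I))))) (grow M (param I) * sz (inst I) ^ (i + j))"
    if I: "I \<in> A" for I
  proof (rule runs_in_timeI[OF P])
    let ?x = "inst I" and ?k = "param I"
    define n where "n = sz ?x"
    define F where "F = ?F ?k"
    have n: "1 \<le> n" unfolding n_def by (cases "encode ?x") simp_all
    have g: "grow m (sz (g ?x)) \<le> F" unfolding F_def by (rule grow_mono) (rule small[OF I])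
    then have o: "sz (s (g ?x)) \<le> F" using m(2)[of "g ?x"] by linarith
    let ?N = "n ^ (i + j)"
    have N: "n ^ i \<le> ?N" "n ^ j \<le> ?N" "1 \<le> ?N" using n by (auto intro: power_increasing)
    have "(n + 2) ^ i \<le> (3 * n) ^ i" using n by (intro power_mono) simp_all
    also have "\<dots> \<le> 3 ^ i * ?N" using N(1) by (simp add: power_mult_distrib)
    finally have 1: "(sz ?x + 2) ^ i \<le> 3 ^ i * ?N" unfolding n_def .
    have "F + 3 \<le> (F + 3) * n" using n by simp
    then have "sz (?x, s (g ?x)) + 2 \<le> (F + 4) * n" using o by (simp add: n_def algebra_simps)
    then have "(sz (?x, s (g ?x)) + 2) ^ j \<le> ((F + 4) * n) ^ j" by (intro power_mono) simp_all
    also have "\<dots> \<le> (F + 4) ^ j * ?N" using N(2) by (simp add: power_mult_distrib)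
    finally have 2: "(sz (?x, s (g ?x)) + 2) ^ j \<le> (F + 4) ^ j * ?N" .
    have 3: "grow m (sz (g ?x)) + 14 \<le> (F + 14) * ?N"
      by (rule order_trans[OF _ mult_le_mono2[OF N(3)]]) (use g in simp)
    have "?t ?x + 2 + sz (h ?x (s (g ?x))) \<le> (3 ^ i + F + 14 + 2 * (F + 4) ^ j) * ?N"
      using 1 2 3 j(2)[of "(?x, s (g ?x))"] unfolding distrib_right fst_conv snd_conv mult.assoc by linarith
    also have "\<dots> \<le> grow M ?k * ?N" unfolding F_def by (rule mult_le_mono1[OF M])
    finally show "?t ?x + 2 + sz (h ?x (s (g ?x))) \<le> grow M ?k * sz ?x ^ (i + j)" unfolding n_def .
  qed
  then show ?thesis using computable_grow by blast
qed

lemma kernel_bound: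
  "\<exists>b. cf.bd b \<and> (\<forall>I\<in>msor1_instances. sz (kern (inst_of I)) \<le> b (msor1_param I))"
proof -
  define c where "c l w t = 20 + (l + 1) * (4 * w + 100) + 2 * w + 2 * w + t * (w * 4 + 10) + t * (t * 4 + 10)" for l w t :: nat
  have cmono: "c l w t \<le> c l' w' t'" if "l \<le> l'" "w \<le> w'" "t \<le> t'" for l w t l' w' t'
    unfolding c_def using that by (intro add_mono mult_le_mono) simp_all
  let ?b = "\<lambda>k. c k (1 + 2 * k) (k * 2 ^ (1 + 2 * k) * 4)"
  have "sz (kern (inst_of I)) \<le> ?b (msor1_param I)" if "I \<in> msor1_instances" for I
  proof -
    interpret msor1_inst I by unfold_locales (rule that)
    let ?k = "msor1_param I"
    have k: "nd G \<le> ?k" "length (code (formula I)) \<le> ?k" using length_code[of "formula I"] by (simp_all add: msor1_param_def)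
    have w: "length nms \<le> 1 + 2 * ?k" using length_nms k(2) by linarith
    have "nd G * 2 ^ length nms * 4 \<le> ?k * 2 ^ (1 + 2 * ?k) * 4"
      using k(1) w by (intro mult_le_mono power_increasing) simp_all
    then have "T \<le> ?k * 2 ^ (1 + 2 * ?k) * 4" using T_le by linarith
    from cmono[OF k(2) w this] show ?thesis using sz_kern_le unfolding c_def by linarith
  qed
  moreover have "cf.bd ?b" unfolding c_def by (intro cf.bd_intros bd_pow2)
  ultimately show ?thesis by (intro exI[of _ ?b]) blast
qed

theorem theorem3p1:
  "fpt_decision msor1_instances enc_msor1 msor1_param msor1_yes \<and>
   fpt_search {I \<in> msor1_instances. msor1_yes I} enc_msor1 msor1_param
     encodes_shortest_TJ_sequence"
proof
  obtain b where b: "cf.bd b" and small: "\<And>I. I \<in> msor1_instances \<Longrightarrow> sz (kern (inst_of I)) \<le> b (msor1_param I)"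
    using kernel_bound by (elim exE conjE) simp
  have inst: "msor1_inst I" if "I \<in> msor1_instances" for I by unfold_locales (rule that)
  have "\<exists>P f c. computable f \<and> (\<forall>I\<in>msor1_instances. runs_in_time P (encode (inst_of I))
      (encode (decide (inst_of I) (solve (kern (inst_of I))))) (f (msor1_param I) * tree_size (encode (inst_of I)) ^ c))"
    by (rule fpt_kernel[where b = b, OF pt.fc_kern fc_solve pt.fc_decide]) (erule small, rule b)
  then obtain P f c where f: "computable f" and P: "\<forall>I\<in>msor1_instances. runs_in_time P (enc_msor1 I)
      (encode (decide (inst_of I) (solve (kern (inst_of I))))) (f (msor1_param I) * tree_size (enc_msor1 I) ^ c)"
    unfolding encode_inst_of by (elim exE conjE) iprover
  have "encode (decide (inst_of I) (solve (kern (inst_of I)))) = (if msor1_yes I then Node Leaf Leaf else Leaf)"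
    if "I \<in> msor1_instances" for I
    unfolding msor1_inst.decide_iff[OF inst[OF that]] encode_bool_def ..
  then show "fpt_decision msor1_instances enc_msor1 msor1_param msor1_yes"
    unfolding fpt_decision_def fpt_search_def using f P by (intro exI[of _ P] exI[of _ f] exI[of _ c]) simp
  \<comment> \<open>The time bound of the search holds on all instances; the meaning of the output
    is established on yes-instances, where \<open>best\<close> picks from a nonempty list.\<close>
  have "\<exists>P f c. computable f \<and> (\<forall>I\<in>msor1_instances. runs_in_time P (encode (inst_of I))
      (encode (search (inst_of I) (solve (kern (inst_of I))))) (f (msor1_param I) * tree_size (encode (inst_of I)) ^ c))"
    by (rule fpt_kernel[where b = b, OF pt.fc_kern fc_solve pt.fc_search]) (erule small, rule b)
  then obtain P f c where f: "computable f" and P: "\<forall>I\<in>msor1_instances. runs_in_time P (enc_msor1 I)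
      (encode (search (inst_of I) (solve (kern (inst_of I))))) (f (msor1_param I) * tree_size (enc_msor1 I) ^ c)"
    unfolding encode_inst_of by (elim exE conjE) iprover
  have "encodes_shortest_TJ_sequence I (encode (search (inst_of I) (solve (kern (inst_of I)))))"
    if "I \<in> msor1_instances" "msor1_yes I" for I
    by (rule msor1_inst.search_correct[OF inst[OF that(1)] that(2)])
  with f P show "fpt_search {I \<in> msor1_instances. msor1_yes I} enc_msor1 msor1_param encodes_shortest_TJ_sequence"
    unfolding fpt_search_def by (intro exI[of _ P] exI[of _ f] exI[of _ c]) blast
qed

end
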